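(* Let $\Xi(z)=\tfrac12 s(s-1)\pi^{-s/2}\Gamma(s/2)\zeta(s)$ with $s=\tfrac12+iz$ be the Riemann Xi function, and let $A_n^\flat$ be the (strictly positive) numbers defined by $\Xi(z)=\sum_{n=0}^\infty(-1)^nA_n^\flat z^{2n}$. For each integer $n\ge2$ denote by $\Delta_n(y)$ the discriminant, with respect to $x$, of the polynomial $$B_y(J_n^\flat)(x)=\sum_{k=0}^n\frac{n!}{(n-k)!}A_k^\flat\, x^k\,y^{k(k+1)/2}.$$ Then the Riemann hypothesis is true if and only if for all $n\ge2$, $\Delta_n(y)$ does not vanish on the interval $[1/4,1)$.
   Context: The Riemann hypothesis is the assertion that all zeros of $\Xi$ are real (equivalently, that all nontrivial zeros of the Riemann zeta function $\zeta$ have real part $1/2$). The polynomial $B_y(J_n^\flat)$ is viewed as a polynomial in $x$ of degree $n$ with coefficients depending on the parameter $y$. *)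

theory Defs
  imports
    "HOL-Complex_Analysis.Complex_Analysis"
    "Subresultants.Resultant_Prelim"
begin

text \<open>
  The analytic continuation of the Dirichlet series is unique on the complement of the
  pole \<open>1\<close> by the identity theorem; the value at the pole is fixed to be \<open>0\<close>, as the library
  does for its own meromorphic functions such as \<^const>\<open>Gamma\<close>.
\<close>
definition riemann_zeta :: "complex \<Rightarrow> complex" where
  "riemann_zeta = (THE f. f holomorphic_on (- {1}) \<and>
     (\<forall>s. Re s > 1 \<longrightarrow> f s = (\<Sum>n. 1 / of_nat (Suc n) powr s)) \<and> f 1 = 0)"

text \<open>
  The defining product is meaningless at the pole of zeta and at the poles of Gamma, where
  \<^const>\<open>Gamma\<close> is \<open>0\<close> by convention. These are removable singularities, and \<^const>\<open>remove_sings\<close>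
  replaces the values there by the limits, so that the result is an entire function.
\<close>
definition riemann_Xi :: "complex \<Rightarrow> complex" where
  "riemann_Xi = remove_sings (\<lambda>z. let s = 1 / 2 + \<i> * z in
     1 / 2 * s * (s - 1) * complex_of_real pi powr (- s / 2) * Gamma (s / 2) * riemann_zeta s)"

definition riemann_hypothesis :: bool where
  "riemann_hypothesis \<longleftrightarrow> (\<forall>z. riemann_Xi z = 0 \<longrightarrow> z \<in> \<real>)"

definition A_flat :: "nat \<Rightarrow> real" where
  "A_flat = (THE a. \<forall>z. (\<lambda>n. (-1) ^ n * complex_of_real (a n) * z ^ (2 * n)) sums riemann_Xi z)"

text \<open>The image of the Jensen polynomial under the operator sending \<open>x^k\<close> to \<open>y^(k(k+1)/2) x^k\<close>.\<close>
definition B_J_flat :: "real \<Rightarrow> nat \<Rightarrow> real poly" where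
  "B_J_flat y n =
     (\<Sum>k\<le>n. monom (fact n / fact (n - k) * A_flat k * y ^ (k * (k + 1) div 2)) k)"

definition poly_discriminant :: "'a :: field poly \<Rightarrow> 'a" where
  "poly_discriminant p =
     (-1) ^ (degree p * (degree p - 1) div 2) * resultant p (pderiv p) / lead_coeff p"

text \<open>
  For \<open>y \<noteq> 0\<close> the leading coefficient in \<open>x\<close> is nonzero, so specialising \<open>y\<close> before taking the
  discriminant agrees with evaluating the discriminant over \<open>\<real>[y]\<close> at \<open>y\<close>.
\<close>
definition Delta :: "nat \<Rightarrow> real \<Rightarrow> real" where
  "Delta n y = poly_discriminant (B_J_flat y n)"

end

theory Submission
  imports Defs
    "HOL-Computational_Algebra.Fundamental_Theorem_Algebra"
    "HOL-Computational_Algebra.Field_as_Ring"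
    "Subresultants.Subresultant_Gcd"
    "HOL-Probability.Probability"
    "HOL-Real_Asymp.Real_Asymp"
begin

text \<open>
  Write \<open>\<Xi>(z) = F(- z\<^sup>2)\<close> with \<open>F(w) = \<Sum> A\<^sub>k w\<^sup>k\<close>. The theta transformation represents the
  \<open>A\<^sub>k\<close> as moments of a positive kernel. Since \<open>F\<close> has order \<open>1/2\<close>, it is a limit of real
  polynomials whose zeros are zeros of \<open>F\<close>. A crude zero-free region of \<open>\<Xi>\<close> puts these zeros
  in the sector \<open>\<bar>arg (- w)\<bar> \<le> \<pi>/3\<close>, where every real factor is log-concave; hence
  \<open>A\<^sub>k\<^sup>2 \<ge> A\<^sub>k\<^sub>-\<^sub>1 A\<^sub>k\<^sub>+\<^sub>1\<close> unconditionally, and at \<open>y = 1/4\<close> the criterion of Hutchinson and Kurtz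
  applies: all zeros of \<open>B\<^sub>y(J\<^sub>n)\<close> are real. If the discriminant does not vanish on \<open>[1/4, 1)\<close>,
  the zeros stay real up to \<open>y = 1\<close>, and \<open>J\<^sub>n(w/n) \<longrightarrow> F(w)\<close> gives the Riemann hypothesis
  by Hurwitz's theorem.
  Conversely the Riemann hypothesis makes the Jensen polynomials hyperbolic, and \<open>B\<^sub>y\<close> is a
  backward heat flow in \<open>log x\<close>, which preserves real zeros and makes them simple for \<open>y < 1\<close>.
\<close>

hide_const (open) module.smult

subsection \<open>Hyperbolic polynomials\<close>

text \<open>The constant 1/4 is where soft information just suffices. The second difference of
  \<open>k(k+1)/2\<close> is 1, so passing to \<open>B_y\<close> multiplies each quotient
  \<open>a_k^2 / (a_(k-1) a_(k+1))\<close> by \<open>1/y\<close>, and the factors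
  \<open>n!/(n-k)!\<close> contribute a further \<open>(n-k+1)/(n-k) > 1\<close>. Bare log-concavity
  of the \<open>A_k\<close> therefore pushes all quotients above 4 at \<open>y = 1/4\<close>, and it
  follows from the rough location of the zeros, without fine estimates of the kernel. At the other
  end \<open>y = 1\<close> stays out: nothing excludes multiple zeros of the Jensen polynomials
  themselves, and only the flow to \<open>y < 1\<close> separates them. Zeta and the
  \<open>A_k\<close> are given by definite descriptions, so existence is part of the work: the
  continuation of zeta has to be constructed, here from the theta integral, before anything can be
  said about the discriminants. All coefficients are positive, so real zeros in the variable
  \<open>w\<close> are negative, and reality of zeros becomes a condition on the upper half-plane
  alone, in a quantitative form that is closed under limits.\<close>

definition cpoly :: "real poly \<Rightarrow> complex \<Rightarrow> complex" where
  "cpoly f = poly (map_poly of_real f)"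

lemma cpoly_0 [simp]: "cpoly 0 z = 0"
  by (simp add: cpoly_def)

lemma cpoly_1 [simp]: "cpoly 1 z = 1"
  by (simp add: cpoly_def)

lemma cpoly_pCons [simp]: "cpoly (pCons a f) z = of_real a + z * cpoly f z"
  by (simp add: cpoly_def of_real_hom.map_poly_pCons_hom)

lemma cpoly_add [simp]: "cpoly (f + g) z = cpoly f z + cpoly g z"
  by (simp add: cpoly_def of_real_hom.map_poly_hom_add)

lemma cpoly_smult [simp]: "cpoly (smult c f) z = of_real c * cpoly f z"
  by (simp add: cpoly_def of_real_hom.map_poly_hom_smult)

lemma cpoly_mult: "cpoly (f * g) z = cpoly f z * cpoly g z"
  by (induction f) (simp_all add: algebra_simps)

lemma cpoly_minus [simp]: "cpoly (- f) z = - cpoly f z"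
  using cpoly_smult[of "- 1" f z] by simp

lemma cpoly_diff [simp]: "cpoly (f - g) z = cpoly f z - cpoly g z"
  using cpoly_add[of f "- g" z] by simp

lemma cpoly_of_real: "cpoly f (of_real x) = of_real (poly f x)"
  by (induction f) simp_all

text \<open>A diagonal operator given by its eigenvalues on the monomials. The Euler operator, the
  heat flow and the Jensen factors are all of this kind, so they commute and compose by multiplying
  sequences.\<close>

definition coeff_mult :: "(nat \<Rightarrow> 'a) \<Rightarrow> 'a::comm_semiring_1 poly \<Rightarrow> 'a poly" where
  "coeff_mult c f = (\<Sum>k\<le>degree f. monom (c k * coeff f k) k)"

lemma coeff_coeff_mult [simp]: "coeff (coeff_mult c f) k = c k * coeff f k"
  by (auto simp: coeff_mult_def coeff_sum coeff_eq_0)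

lemma degree_coeff_mult_le: "degree (coeff_mult c f) \<le> degree f"
  by (rule degree_le) (auto simp: coeff_eq_0)

lemma degree_coeff_mult:
  fixes f :: "'a::idom poly"
  assumes "c (degree f) \<noteq> 0" shows "degree (coeff_mult c f) = degree f"
proof (cases "f = 0")
  case False
  then have "coeff (coeff_mult c f) (degree f) \<noteq> 0" using assms by simp
  then show ?thesis using degree_coeff_mult_le le_degree by (metis antisym)
qed (use degree_coeff_mult_le[of c f] in auto)

lemma coeff_mult_coeff_mult: "coeff_mult c (coeff_mult d f) = coeff_mult (\<lambda>k. c k * d k) f"
  by (rule poly_eqI) (simp add: mult_ac)

text \<open>Eigenvalues \<open>k\<close> give the Euler operator \<open>\<theta> = x d/dx\<close>,
  written \<open>pCons 0 (pderiv f)\<close> from here on.\<close>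

lemma coeff_mult_real [simp]: "coeff_mult of_nat f = pCons 0 (pderiv f)" for f :: "real poly"
  by (rule poly_eqI) (auto simp: coeff_pCons coeff_pderiv split: nat.splits)

lemma cpoly_eq_sum:
  assumes "degree f \<le> n" shows "cpoly f z = (\<Sum>k\<le>n. of_real (coeff f k) * z ^ k)"
proof -
  have "cpoly f z = (\<Sum>k\<le>degree f. of_real (coeff f k) * z ^ k)"
    by (simp add: cpoly_def poly_altdef)
  also have "\<dots> = (\<Sum>k\<le>n. of_real (coeff f k) * z ^ k)"
    by (rule sum.mono_neutral_left) (use assms in \<open>auto simp: coeff_eq_0\<close>)
  finally show ?thesis .
qed

lemma poly_eq_sum:
  fixes f :: "'a::comm_semiring_1 poly"
  assumes "degree f \<le> n" shows "poly f z = (\<Sum>k\<le>n. coeff f k * z ^ k)"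
  unfolding poly_altdef by (rule sum.mono_neutral_left) (use assms in \<open>auto simp: coeff_eq_0\<close>)

lemma cpoly_cnj: "cpoly f (cnj z) = cnj (cpoly f z)"
  by (induction f) simp_all

text \<open>The zeros are the numbers \<open>- r\<close>: real and nonpositive, with 0 allowed. The
  explicit product gives induction on linear factors; positivity of \<open>c\<close> makes all
  coefficients nonnegative and excludes the zero polynomial.\<close>

definition hyp :: "real poly \<Rightarrow> bool" where
  "hyp f \<longleftrightarrow> (\<exists>c rs. c > 0 \<and> (\<forall>r\<in>set rs. r \<ge> 0) \<and> f = smult c (\<Prod>r\<leftarrow>rs. [:r, 1:]))"

lemma hyp_induct [consumes 1, case_names const linear]:
  assumes "hyp f" "\<And>c. c > 0 \<Longrightarrow> P [:c:]"
    "\<And>r f. r \<ge> 0 \<Longrightarrow> hyp f \<Longrightarrow> P f \<Longrightarrow> P ([:r, 1:] * f)"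
  shows "P f"
proof -
  from assms(1) obtain c rs where c: "c > 0" and rs: "\<forall>r\<in>set rs. r \<ge> 0"
    and f: "f = smult c (\<Prod>r\<leftarrow>rs. [:r, 1:])" unfolding hyp_def by blast
  have "P (smult c (\<Prod>r\<leftarrow>rs. [:r, 1:]))" using rs
  proof (induction rs)
    case Nil then show ?case using assms(2)[OF c] by simp
  next
    case (Cons r rs)
    have "P ([:r,1:] * smult c (\<Prod>r\<leftarrow>rs. [:r, 1:]))"
      by (rule assms(3)) (use Cons c in \<open>auto simp: hyp_def\<close>)
    then show ?case by (simp only: list.map prod_list.Cons mult_smult_right)
  qed
  then show ?thesis using f by simp
qed

lemma hyp_const: "c > 0 \<Longrightarrow> hyp [:c:]"
  unfolding hyp_def by (intro exI[of _ c] exI[of _ "[]"]) auto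

lemma hyp_linear_mult: assumes "r \<ge> 0" "hyp f" shows "hyp ([:r, 1:] * f)"
proof -
  from assms(2) obtain c rs where "c > 0" "\<forall>r\<in>set rs. r \<ge> 0"
    "f = smult c (\<Prod>r\<leftarrow>rs. [:r, 1:])" unfolding hyp_def by blast
  then show ?thesis unfolding hyp_def using assms(1)
    by (intro exI[of _ c] exI[of _ "r # rs"]) (auto simp: mult_smult_right simp del: mult_pCons_left)
qed

lemma hyp_nonzero: "hyp f \<Longrightarrow> f \<noteq> 0"
  by (induction rule: hyp_induct) (simp_all del: mult_pCons_left add: pCons_eq_0_iff)

lemma degree_linear_mult: "f \<noteq> 0 \<Longrightarrow> degree ([:r, 1:] * f) = Suc (degree f)" for f :: "real poly"
  by (subst degree_mult_eq) auto

lemma hyp_coeff_nonneg: "hyp f \<Longrightarrow> coeff f k \<ge> 0"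
proof (induction arbitrary: k rule: hyp_induct)
  case (linear r f)
  then show ?case by (cases k) auto
qed (auto simp: coeff_pCons split: nat.splits)

lemma hyp_lead_coeff_pos: "hyp f \<Longrightarrow> lead_coeff f > 0"
  using hyp_coeff_nonneg[of f "degree f"] hyp_nonzero[of f] leading_coeff_neq_0[of f] by linarith

text \<open>Each factor satisfies \<open>|r + z| \<ge> |Im z|\<close>. The bound involves only the
  degree and the leading coefficient, so it survives limits and turns the absence of nonreal zeros
  into a closed condition.\<close>

lemma hyp_norm_ge: "hyp f \<Longrightarrow> cmod (cpoly f z) \<ge> lead_coeff f * \<bar>Im z\<bar> ^ degree f"
proof (induction rule: hyp_induct)
  case (linear r f)
  have "lead_coeff ([:r, 1:] * f) * \<bar>Im z\<bar> ^ degree ([:r, 1:] * f)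
      = \<bar>Im z\<bar> * (lead_coeff f * \<bar>Im z\<bar> ^ degree f)"
    using hyp_nonzero[OF linear(2)] unfolding degree_linear_mult[OF hyp_nonzero[OF linear(2)]] lead_coeff_mult by (simp add: coeff_eq_0)
  also have "\<dots> \<le> cmod (cpoly [:r, 1:] z) * cmod (cpoly f z)"
    using abs_Im_le_cmod[of "cpoly [:r,1:] z"] linear hyp_lead_coeff_pos[OF linear(2)]
    by (intro mult_mono) auto
  also have "\<dots> = cmod (cpoly ([:r, 1:] * f) z)"
    by (simp only: cpoly_mult norm_mult)
  finally show ?case .
qed auto

lemma hyp_upper: assumes "hyp f" "Im z \<noteq> 0" shows "cpoly f z \<noteq> 0"
proof -
  have "0 < lead_coeff f * \<bar>Im z\<bar> ^ degree f" using assms hyp_lead_coeff_pos by auto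
  with hyp_norm_ge[OF assms(1), of z] show ?thesis by auto
qed

lemma hypI_roots:
  assumes "lead_coeff f > 0" "\<And>x. poly f x = 0 \<Longrightarrow> x \<le> 0" "\<And>z. Im z > 0 \<Longrightarrow> cpoly f z \<noteq> 0"
  shows "hyp f"
  using assms
proof (induction "degree f" arbitrary: f)
  case 0
  then obtain c where "f = [:c:]" by (metis degree_eq_zeroE)
  with 0 show ?case by (auto intro: hyp_const)
next
  case (Suc n)
  have "degree (map_poly complex_of_real f) > 0" using Suc(2) by (metis of_real_hom.degree_map_poly_hom zero_less_Suc)
  then obtain w where w: "cpoly f w = 0" using alg_closed_imp_poly_has_root[of "map_poly complex_of_real f"] unfolding cpoly_def by metis
  have "Im w = 0"
    using Suc.prems(3)[of w] Suc.prems(3)[of "cnj w"] w by (cases "Im w" "0::real" rule: linorder_cases) (auto simp: cpoly_cnj)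
  then have "w = of_real (Re w)" by (simp add: complex_eq_iff)
  then have root: "poly f (Re w) = 0" using w by (metis cpoly_of_real of_real_eq_0_iff)
  then obtain g where g: "f = [:- Re w, 1:] * g" by (auto simp: poly_eq_0_iff_dvd)
  have "g \<noteq> 0" using g Suc.prems(1) by auto
  then have deg: "n = degree g" using Suc(2) degree_linear_mult[of g "-Re w"] g by simp
  have "hyp g"
  proof (rule Suc(1)[OF deg])
    show "lead_coeff g > 0" using Suc.prems(1) unfolding g lead_coeff_mult by simp
    show "x \<le> 0" if "poly g x = 0" for x using that Suc.prems(2)[of x] g by simp
    show "cpoly g z \<noteq> 0" if "Im z > 0" for z using Suc.prems(3)[OF that] unfolding g cpoly_mult by auto
  qed
  with Suc.prems(2)[OF root] show ?case unfolding g by (intro hyp_linear_mult) auto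
qed

lemma poly_pos_of_coeffs:
  fixes f :: "real poly"
  assumes "f \<noteq> 0" "\<And>k. coeff f k \<ge> 0" "x > 0" shows "poly f x > 0"
proof -
  have "0 < coeff f (degree f) * x ^ degree f"
    using assms(1,3) assms(2)[of "degree f"] leading_coeff_neq_0[of f] by (intro mult_pos_pos) (linarith | simp)+
  also have "\<dots> \<le> (\<Sum>k\<le>degree f. coeff f k * x ^ k)"
    by (rule member_le_sum) (use assms in auto)
  finally show ?thesis by (simp add: poly_altdef)
qed

text \<open>Nonnegative coefficients exclude positive zeros and conjugation takes care of the lower
  half-plane, so only the upper half-plane has to be inspected.\<close>

lemma hypI:
  assumes "f \<noteq> 0" "\<And>k. coeff f k \<ge> 0" "\<And>z. Im z > 0 \<Longrightarrow> cpoly f z \<noteq> 0"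
  shows "hyp f"
proof (rule hypI_roots)
  show "lead_coeff f > 0" using assms(1) assms(2)[of "degree f"] leading_coeff_neq_0[of f] by linarith
  show "x \<le> 0" if "poly f x = 0" for x
    using poly_pos_of_coeffs[OF assms(1,2), of x] that by force
qed (use assms in auto)

lemma hyp_root_nonpos: "hyp f \<Longrightarrow> poly f x = 0 \<Longrightarrow> x \<le> 0"
  using poly_pos_of_coeffs[of f x] hyp_nonzero[of f] hyp_coeff_nonneg[of f] by force

lemma hyp_smult: assumes "c > 0" "hyp f" shows "hyp (smult c f)"
  by (rule hypI) (use assms hyp_nonzero hyp_coeff_nonneg hyp_upper in \<open>auto\<close>)

text \<open>Equal degrees make the leading coefficients converge to a nonzero number, so the lower
  bound of \<open>hyp_norm_ge\<close> passes to \<open>g\<close> with a positive right-hand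
  side.\<close>

lemma hyp_limit:
  assumes F: "F \<noteq> bot" and ev: "eventually (\<lambda>m. hyp (f m) \<and> degree (f m) = degree g) F"
    and lim: "\<And>k. ((\<lambda>m. coeff (f m) k) \<longlongrightarrow> coeff g k) F" and "g \<noteq> 0"
  shows "hyp g"
proof (rule hypI)
  show nn: "coeff g k \<ge> 0" for k
    by (rule tendsto_lowerbound[OF lim _ F]) (use ev in \<open>auto elim!: eventually_mono intro: hyp_coeff_nonneg\<close>)
  fix z :: complex assume z: "Im z > 0"
  let ?n = "degree g"
  have "((\<lambda>m. cmod (\<Sum>k\<le>?n. of_real (coeff (f m) k) * z ^ k)) \<longlongrightarrow> cmod (\<Sum>k\<le>?n. of_real (coeff g k) * z ^ k)) F"
    by (intro tendsto_intros lim)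
  moreover have "((\<lambda>m. coeff (f m) ?n * \<bar>Im z\<bar> ^ ?n) \<longlongrightarrow> coeff g ?n * \<bar>Im z\<bar> ^ ?n) F"
    by (intro tendsto_intros lim)
  moreover have "eventually (\<lambda>m. coeff (f m) ?n * \<bar>Im z\<bar> ^ ?n \<le> cmod (\<Sum>k\<le>?n. of_real (coeff (f m) k) * z ^ k)) F"
    using ev
  proof eventually_elim
    case (elim m)
    then show ?case using hyp_norm_ge[of "f m" z] cpoly_eq_sum[of "f m" ?n z] by simp
  qed
  ultimately have "coeff g ?n * \<bar>Im z\<bar> ^ ?n \<le> cmod (cpoly g z)"
    using tendsto_le[OF F] cpoly_eq_sum[of g ?n z] by fastforce
  moreover have "coeff g ?n * \<bar>Im z\<bar> ^ ?n > 0" using nn[of ?n] \<open>g \<noteq> 0\<close> leading_coeff_neq_0[of g] z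
    by (intro mult_pos_pos) (linarith | simp)+
  ultimately show "cpoly g z \<noteq> 0" by auto
qed fact

section \<open>Hyperbolicity under the Euler operator and its exponential flow\<close>

lemma Im_divide_add_pos:
  assumes "r > 0" "Im z > 0" shows "Im (z / (of_real r + z)) > 0"
proof -
  have "Im (z / (of_real r + z)) = r * Im z / ((r + Re z)\<^sup>2 + (Im z)\<^sup>2)"
    by (simp add: Im_divide algebra_simps)
  also have "\<dots> > 0" using assms by (intro divide_pos_pos mult_pos_pos add_nonneg_pos) auto
  finally show ?thesis .
qed

text \<open>\<open>z f'(z) / f(z) = \<Sum> z / (z + r)\<close> maps the upper half-plane to itself unless all roots vanish.\<close>
lemma hyp_logderiv:
  assumes "hyp f" "Im z > 0"
  shows "Im (z * cpoly (pderiv f) z / cpoly f z) > 0 \<or>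
    z * cpoly (pderiv f) z / cpoly f z = of_nat (degree f)"
  using assms(1)
proof (induction rule: hyp_induct)
  case (const c) then show ?case by (simp add: cpoly_def)
next
  case (linear r f)
  have f: "cpoly f z \<noteq> 0" using hyp_upper[of f z] linear assms(2) by auto
  have rz: "of_real r + z \<noteq> 0" using assms(2) by (metis Im_complex_of_real add_0 complex_Im_numeral(1) less_irrefl plus_complex.sel(2) zero_complex.sel(2))
  have pd: "pderiv ([:r, 1:] * f) = f + [:r, 1:] * pderiv f"
    by (subst pderiv_mult) (simp add: pderiv_pCons algebra_simps)
  have l: "cpoly [:r, 1:] z = of_real r + z" by simp
  have eq: "z * cpoly (pderiv ([:r, 1:] * f)) z / cpoly ([:r, 1:] * f) z =
     z / (of_real r + z) + z * cpoly (pderiv f) z / cpoly f z"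
    unfolding pd cpoly_add cpoly_mult l using f rz by (simp add: field_simps)
  show ?case
  proof (cases "r = 0")
    case True
    then have "z / (of_real r + z) = 1" using assms(2) by auto
    then show ?thesis using linear(3) unfolding eq degree_linear_mult[OF hyp_nonzero[OF linear(2)]] by auto
  next
    case False
    then show ?thesis using linear(3) linear(1) Im_divide_add_pos[of r z] assms(2) unfolding eq by auto
  qed
qed

lemma cpoly_theta_plus:
  "cpoly (coeff_mult (\<lambda>k. of_nat k + c) f) z = z * cpoly (pderiv f) z + of_real c * cpoly f z"
proof -
  have "coeff_mult (\<lambda>k. of_nat k + c) f = pCons 0 (pderiv f) + smult c f"
    by (rule poly_eqI) (auto simp: coeff_pCons coeff_pderiv algebra_simps split: nat.splits)
  then show ?thesis by simp
qed

text \<open>By \<open>hyp_logderiv\<close> the only real value of \<open>\<theta> f / f\<close> in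
  the upper half-plane is the degree, whereas a zero of \<open>(\<theta> + c) f\<close> would
  produce the value \<open>- c\<close>.\<close>

lemma theta_plus_nonzero:
  assumes "hyp f" "Im z > 0" "c \<noteq> - real (degree f)"
  shows "cpoly (coeff_mult (\<lambda>k. of_nat k + c) f) z \<noteq> 0"
proof
  assume "cpoly (coeff_mult (\<lambda>k. of_nat k + c) f) z = 0"
  moreover have "cpoly f z \<noteq> 0" using hyp_upper assms by force
  ultimately have "z * cpoly (pderiv f) z / cpoly f z = of_real (- c)"
    unfolding cpoly_theta_plus by (simp add: divide_eq_eq add_eq_0_iff2)
  with hyp_logderiv[OF assms(1,2)] have "complex_of_real (- c) = of_nat (degree f)" by auto
  then have "complex_of_real (- c) = of_real (real (degree f))" by simp
  then have "- c = real (degree f)" unfolding of_real_eq_iff .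
  then show False using assms(3) by simp
qed

lemma hyp_theta_plus: assumes "hyp f" "c > 0" shows "hyp (coeff_mult (\<lambda>k. of_nat k + c) f)"
proof (rule hypI)
  show "coeff_mult (\<lambda>k. of_nat k + c) f \<noteq> 0"
    using theta_plus_nonzero[OF assms(1), of \<i> c] assms(2) by auto
  show "coeff (coeff_mult (\<lambda>k. of_nat k + c) f) k \<ge> 0" for k
    using hyp_coeff_nonneg[OF assms(1)] assms(2) by simp
qed (use theta_plus_nonzero[OF assms(1)] assms(2) in auto)

text \<open>The bound on \<open>c\<close> keeps the eigenvalues \<open>c - k\<close> positive on all
  occurring degrees and avoids the exceptional value of \<open>theta_plus_nonzero\<close>.\<close>

lemma hyp_minus_theta: assumes "hyp f" "c > real (degree f)" shows "hyp (coeff_mult (\<lambda>k. c - of_nat k) f)"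
proof (rule hypI)
  have eq: "coeff_mult (\<lambda>k. c - of_nat k) f = - coeff_mult (\<lambda>k. of_nat k + (- c)) f"
    by (rule poly_eqI) (simp add: algebra_simps)
  show nz: "cpoly (coeff_mult (\<lambda>k. c - of_nat k) f) z \<noteq> 0" if "Im z > 0" for z
    using theta_plus_nonzero[OF assms(1) that, of "- c"] assms(2) unfolding eq cpoly_minus by simp
  show "coeff_mult (\<lambda>k. c - of_nat k) f \<noteq> 0" using nz[of \<i>] by auto
  show "coeff (coeff_mult (\<lambda>k. c - of_nat k) f) k \<ge> 0" for k
    using hyp_coeff_nonneg[OF assms(1)] assms(2) coeff_eq_0[of f k] by (cases "k \<le> degree f") auto
qed

lemma hyp_theta: assumes "hyp f" "degree f > 0" shows "hyp (pCons 0 (pderiv f))"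
proof (rule hypI)
  show nz: "cpoly (pCons 0 (pderiv f)) z \<noteq> 0" if "Im z > 0" for z
    using theta_plus_nonzero[OF assms(1) that, of 0] assms(2) by (simp del: cpoly_pCons)
  show "pCons 0 (pderiv f) \<noteq> 0" using nz[of \<i>] by auto
  show "coeff (pCons 0 (pderiv f)) k \<ge> 0" for k
    using hyp_coeff_nonneg[OF assms(1)] by (auto simp: coeff_pCons coeff_pderiv split: nat.splits)
qed

text \<open>With \<open>y = exp (- 2 s)\<close> the multiplier is \<open>y^(k(k+1)/2)\<close>, and
  as an operator it is \<open>exp (- s (\<theta>^2 + \<theta>))\<close>: in the parameter
  \<open>s\<close> the family \<open>B_y\<close> is a flow that starts at
  \<open>y = 1\<close>.\<close>

definition gauss_mult :: "real \<Rightarrow> real poly \<Rightarrow> real poly" where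
  "gauss_mult s = coeff_mult (\<lambda>k. exp (- s * (real k * (real k + 1))))"

lemma degree_gauss_mult [simp]: "degree (gauss_mult s f) = degree f"
  unfolding gauss_mult_def by (rule degree_coeff_mult) auto

lemma coeff_gauss_mult: "coeff (gauss_mult s f) k = exp (- s * (real k * (real k + 1))) * coeff f k"
  by (simp add: gauss_mult_def)

text \<open>With \<open>c (c + 1) = 1/t\<close> the quadratic splits as
  \<open>t (c - k) (k + c + 1)\<close>, a product of two linear multipliers; the hypothesis on
  \<open>t\<close> says that \<open>c\<close> exceeds the degree.\<close>

lemma hyp_quadratic_mult:
  assumes "hyp f" "t > 0" "t * (real (degree f) * (real (degree f) + 1)) < 1"
  shows "hyp (coeff_mult (\<lambda>k. 1 - t * (real k * (real k + 1))) f)"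
proof -
  define n where "n = real (degree f)"
  define c where "c = (sqrt (1 + 4 / t) - 1) / 2"
  have "(sqrt (1 + 4 / t))\<^sup>2 = 1 + 4 / t" using assms(2) by (intro real_sqrt_pow2) (simp add: add_nonneg_nonneg)
  moreover have s: "sqrt (1 + 4 / t) = 2 * c + 1" by (simp add: c_def field_simps)
  ultimately have "4 * (c * (c + 1)) = 4 / t" by (simp add: power2_eq_square algebra_simps)
  then have c: "t * (c * (c + 1)) = 1" using assms(2) by (simp add: field_simps)
  have "sqrt (1 + 4 / t) > 1" using assms(2) by (simp add: real_less_rsqrt)
  then have c0: "c > 0" using s by simp
  have cn: "c > n"
  proof (rule ccontr)
    assume "\<not> c > n"
    then have "c * (c + 1) \<le> n * (n + 1)" using c0 by (intro mult_mono) auto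
    then have "t * (c * (c + 1)) \<le> t * (n * (n + 1))" using assms(2) by (intro mult_left_mono) auto
    then show False using assms(3) c by (simp add: n_def)
  qed
  have h: "hyp (coeff_mult (\<lambda>k. of_nat k + (c + 1)) f)" by (rule hyp_theta_plus) (use assms c0 in auto)
  have "hyp (smult t (coeff_mult (\<lambda>k. c - of_nat k) (coeff_mult (\<lambda>k. of_nat k + (c + 1)) f)))"
  proof (rule hyp_smult[OF assms(2)], rule hyp_minus_theta[OF h])
    show "real (degree (coeff_mult (\<lambda>k. real k + (c + 1)) f)) < c"
      using degree_coeff_mult_le[of "\<lambda>k. real k + (c + 1)" f] cn unfolding n_def by linarith
  qed
  also have "smult t (coeff_mult (\<lambda>k. c - of_nat k) (coeff_mult (\<lambda>k. of_nat k + (c + 1)) f))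
     = coeff_mult (\<lambda>k. 1 - t * (real k * (real k + 1))) f"
  proof (rule poly_eqI)
    fix k
    have "t * ((c - real k) * (real k + (c + 1))) = t * (c * (c + 1)) - t * (real k * (real k + 1))"
      by (simp add: algebra_simps)
    then show "coeff (smult t (coeff_mult (\<lambda>k. c - of_nat k) (coeff_mult (\<lambda>k. of_nat k + (c + 1)) f))) k
      = coeff (coeff_mult (\<lambda>k. 1 - t * (real k * (real k + 1))) f) k"
      using c by (simp add: mult.assoc[symmetric])
  qed
  finally show ?thesis .
qed

text \<open>The exponential is the limit of \<open>(1 - s k(k+1) / m)^m\<close>, and each of the
  \<open>m\<close> factors preserves hyperbolicity once \<open>m\<close> exceeds
  \<open>s n (n + 1)\<close>, where \<open>n\<close> is the degree.\<close>

lemma hyp_gauss_mult: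
  assumes "hyp f" "s \<ge> 0" shows "hyp (gauss_mult s f)"
proof (cases "s = 0")
  case True
  have "gauss_mult 0 f = f" by (rule poly_eqI) (simp add: coeff_gauss_mult)
  with True assms show ?thesis by simp
next
  case False
  then have s: "s > 0" using assms by simp
  define q where "q k = real k * (real k + 1)" for k
  have iter: "hyp (coeff_mult (\<lambda>k. (1 - t * q k) ^ m) f) \<and> degree (coeff_mult (\<lambda>k. (1 - t * q k) ^ m) f) = degree f"
    if t: "t > 0" "t * q (degree f) < 1" for t m
  proof (induction m)
    case 0
    have "coeff_mult (\<lambda>k. (1 - t * q k) ^ 0) f = f" by (rule poly_eqI) simp
    then show ?case using assms by simp
  next
    case (Suc m)
    have "hyp (coeff_mult (\<lambda>k. 1 - t * (real k * (real k + 1))) (coeff_mult (\<lambda>k. (1 - t * q k) ^ m) f))"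
      by (rule hyp_quadratic_mult) (use Suc t in \<open>auto simp: q_def\<close>)
    then show ?case using t by (auto simp: coeff_mult_coeff_mult q_def[symmetric] intro!: degree_coeff_mult)
  qed
  show ?thesis
  proof (rule hyp_limit)
    show "sequentially \<noteq> bot" by simp
    have "eventually (\<lambda>m. real m > s * q (degree f)) sequentially"
      by (rule eventually_compose_filterlim[OF eventually_gt_at_top filterlim_real_sequentially])
    then show "eventually (\<lambda>m. hyp (coeff_mult (\<lambda>k. (1 - s / real m * q k) ^ m) f) \<and>
        degree (coeff_mult (\<lambda>k. (1 - s / real m * q k) ^ m) f) = degree (gauss_mult s f)) sequentially"
    proof eventually_elim
      case (elim m)
      have "q (degree f) \<ge> 0" by (simp add: q_def)
      then have "real m > 0" using elim s by (smt (verit) mult_nonneg_nonneg)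
      then show ?case using iter[of "s / real m" m] elim s by (simp add: field_simps)
    qed
    show "(\<lambda>m. coeff (coeff_mult (\<lambda>k. (1 - s / real m * q k) ^ m) f) k) \<longlonglongrightarrow> coeff (gauss_mult s f) k" for k
    proof -
      have "(\<lambda>m. (1 + (- s * q k) / real m) ^ m) \<longlonglongrightarrow> exp (- s * q k)" by (rule tendsto_exp_limit_sequentially)
      then show ?thesis unfolding coeff_gauss_mult coeff_coeff_mult q_def[symmetric] by (intro tendsto_mult) auto
    qed
    have "degree (gauss_mult s f) = degree f" by simp
    show "gauss_mult s f \<noteq> 0"
      using hyp_nonzero[OF assms(1)] coeff_gauss_mult[of s f "degree f"] by auto
  qed
qed

text \<open>Away from zeros the expression is \<open>- f^2 \<theta>(\<theta> f / f)\<close>, and a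
  factor contributes \<open>\<theta>(x / (x + r)) = r x / (x + r)^2\<close>, which is nonpositive
  for \<open>x \<le> 0\<close>. The induction works with cleared denominators, so zeros of
  \<open>f\<close> are covered.\<close>

lemma hyp_Laguerre:
  fixes f :: "real poly"
  defines "\<theta> \<equiv> \<lambda>f. pCons 0 (pderiv f) :: real poly"
  assumes "hyp f" "x \<le> 0"
  shows "(poly (\<theta> f) x)\<^sup>2 - poly f x * poly (\<theta> (\<theta> f)) x \<ge> 0"
  using assms(2)
proof (induction rule: hyp_induct)
  case (const c) then show ?case by (simp add: \<theta>_def)
next
  case (linear r f)
  define a b c where "a = poly f x" and "b = poly (\<theta> f) x" and "c = poly (\<theta> (\<theta> f)) x"
  have \<theta>m: "\<theta> ([:r, 1:] * f) = [:0, 1:] * f + [:r, 1:] * \<theta> f"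
    unfolding \<theta>_def by (subst pderiv_mult) (simp add: pderiv_pCons algebra_simps)
  have \<theta>\<theta>m: "\<theta> (\<theta> ([:r, 1:] * f)) = [:0, 1:] * f + ([:0, 1:] * \<theta> f + [:0, 1:] * \<theta> f) + [:r, 1:] * \<theta> (\<theta> f)"
    unfolding \<theta>m unfolding \<theta>_def pderiv_add pderiv_mult by (simp add: pderiv_pCons algebra_simps)
  have 1: "poly ([:r, 1:] * f) x = (r + x) * a" by (simp add: a_def algebra_simps)
  have 2: "poly (\<theta> ([:r, 1:] * f)) x = x * a + (r + x) * b" unfolding \<theta>m by (simp add: a_def b_def algebra_simps)
  have 3: "poly (\<theta> (\<theta> ([:r, 1:] * f))) x = x * a + 2 * (x * b) + (r + x) * c"
    unfolding \<theta>\<theta>m by (simp add: a_def b_def c_def algebra_simps)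
  have "(poly (\<theta> ([:r, 1:] * f)) x)\<^sup>2 - poly ([:r, 1:] * f) x * poly (\<theta> (\<theta> ([:r, 1:] * f))) x
    = (r + x)\<^sup>2 * (b\<^sup>2 - a * c) + a\<^sup>2 * (r * (- x))"
    unfolding 1 2 3 by (simp add: power2_eq_square algebra_simps)
  also have "\<dots> \<ge> 0" using linear assms(3) by (intro add_nonneg_nonneg mult_nonneg_nonneg) (auto simp: a_def b_def c_def)
  finally show ?case .
qed

lemma poly_gauss_mult: "poly (gauss_mult s f) x = (\<Sum>k\<le>degree f. exp (- s * (real k * (real k + 1))) * coeff f k * x ^ k)"
  by (subst poly_altdef) (simp add: coeff_gauss_mult)

lemma pCons_pderiv_gauss_mult: "pCons 0 (pderiv (gauss_mult s f)) = gauss_mult s (pCons 0 (pderiv f))"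
  by (rule poly_eqI) (auto simp: coeff_pCons coeff_pderiv coeff_gauss_mult split: nat.splits)

lemma gauss_mult_has_derivative:
  "((\<lambda>s. poly (gauss_mult s f) x) has_real_derivative
     - (poly (pCons 0 (pderiv (pCons 0 (pderiv (gauss_mult s f))))) x + poly (pCons 0 (pderiv (gauss_mult s f))) x)) (at s)"
proof -
  let ?g = "gauss_mult s f"
  have eq: "pCons 0 (pderiv (pCons 0 (pderiv ?g))) + pCons 0 (pderiv ?g)
       = coeff_mult (\<lambda>k. real k * (real k + 1)) ?g"
    by (rule poly_eqI) (auto simp: coeff_pCons coeff_pderiv algebra_simps split: nat.splits)
  have deg: "degree (coeff_mult (\<lambda>k. real k * (real k + 1)) ?g) \<le> degree f"
    using degree_coeff_mult_le[of _ ?g] by simp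
  have "poly (coeff_mult (\<lambda>k. real k * (real k + 1)) ?g) x
     = (\<Sum>k\<le>degree f. real k * (real k + 1) * (exp (- s * (real k * (real k + 1))) * coeff f k) * x ^ k)"
    by (subst poly_eq_sum[OF deg]) (simp add: coeff_gauss_mult)
  then have "- (poly (pCons 0 (pderiv (pCons 0 (pderiv ?g)))) x + poly (pCons 0 (pderiv ?g)) x)
     = (\<Sum>k\<le>degree f. - (real k * (real k + 1)) * (exp (- s * (real k * (real k + 1))) * coeff f k * x ^ k))"
    unfolding poly_add[symmetric] eq by (simp add: sum_negf mult.assoc)
  then show ?thesis unfolding poly_gauss_mult
    by (auto intro!: derivative_eq_intros sum.cong simp: algebra_simps)
qed

text \<open>At a double zero the flow \<open>\<partial>\<^sub>s u = - (\<theta>\<^sup>2 + \<theta>) u\<close> would violate Laguerre's inequality just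
  before time \<open>s\<close>; higher multiplicities reduce to this case by applying \<open>\<theta>\<close>.\<close>
lemma order_gauss_mult_le_1:
  assumes "hyp f" "s > 0" "x \<noteq> 0" shows "order x (gauss_mult s f) \<le> 1"
proof -
  have "order x (gauss_mult s f) \<noteq> Suc (Suc m)" if "hyp f" for m
    using that
  proof (induction m arbitrary: f)
    case (Suc m)
    define g where "g = gauss_mult s f"
    have g: "hyp g" unfolding g_def by (rule hyp_gauss_mult) (use Suc.prems assms in auto)
    show ?case
    proof
      assume "order x (gauss_mult s f) = Suc (Suc (Suc m))"
      then have o: "order x g = Suc (Suc (Suc m))" by (simp add: g_def)
      have "pderiv g \<noteq> 0"
        using o g order_root[of g x] hyp_nonzero[OF g]
        by (metis degree_eq_zeroE lead_coeff_pCons(2) Zero_not_Suc order_0I pderiv_eq_0_iff poly_pCons mult_zero_right add.right_neutral poly_0 pCons_0_0)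
      \<comment> \<open>Differentiation lowers the multiplicity by one and the extra factor
        \<open>x\<close> does not vanish at this point. As \<open>\<theta>\<close> commutes with the
        flow, the induction hypothesis applies to \<open>\<theta> f\<close>.\<close>
      then have "order x (pderiv g) = Suc (Suc m)" using order_pderiv[of g x] order_root[of g x] o hyp_nonzero[OF g] by simp
      then have "order x (pCons 0 (pderiv g)) = Suc (Suc m)"
        using order_mult[of "[:0,1:]" "pderiv g" x] \<open>pderiv g \<noteq> 0\<close> order_0I[of "[:0,1:]" x] assms(3) by simp
      moreover have "degree f > 0"
        using \<open>pderiv g \<noteq> 0\<close> pderiv_eq_0_iff[of g] by (auto simp: g_def)
      ultimately show False using Suc.IH[OF hyp_theta[OF Suc.prems]]
        by (simp add: g_def pCons_pderiv_gauss_mult)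
    qed
  next
    case 0
    define g where "g = gauss_mult s f"
    define \<theta> where "\<theta> = (\<lambda>f. pCons 0 (pderiv f) :: real poly)"
    have g: "hyp g" unfolding g_def by (rule hyp_gauss_mult) (use 0 assms in auto)
    show ?case
    proof
      assume "order x (gauss_mult s f) = Suc (Suc 0)"
      then have o: "order x g = 2" by (simp add: g_def)
      then have g0: "poly g x = 0" using order_root[of g x] by simp
      have x: "x < 0" using hyp_root_nonpos[OF g g0] assms(3) by simp
      have "pderiv g \<noteq> 0"
        using g0 hyp_nonzero[OF g] by (metis degree_eq_zeroE pderiv_eq_0_iff poly_pCons mult_zero_right add.right_neutral poly_0 pCons_0_0)
      then have o1: "order x (pderiv g) = 1" using order_pderiv[of g x] order_root[of g x] o hyp_nonzero[OF g] by simp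
      then have g1: "poly (pderiv g) x = 0" using order_root[of "pderiv g" x] by simp
      have "pderiv (pderiv g) \<noteq> 0"
        using g1 \<open>pderiv g \<noteq> 0\<close> by (metis degree_eq_zeroE pderiv_eq_0_iff poly_pCons mult_zero_right add.right_neutral poly_0 pCons_0_0)
      then have "order x (pderiv (pderiv g)) = 0" using order_pderiv[of "pderiv g" x] order_root[of "pderiv g" x] o1 \<open>pderiv g \<noteq> 0\<close> by simp
      then have g2: "poly (pderiv (pderiv g)) x \<noteq> 0" using order_root[of "pderiv (pderiv g)" x] \<open>pderiv (pderiv g) \<noteq> 0\<close> by simp
      define u where "u = (\<lambda>h t. poly (gauss_mult t h) x)"
      define C where "C = u (\<theta> (\<theta> f)) s"
      have th: "poly (\<theta> (gauss_mult t h)) x = u (\<theta> h) t" for t h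
        by (simp add: u_def \<theta>_def pCons_pderiv_gauss_mult)
      have th2: "poly (\<theta> (\<theta> (gauss_mult t h))) x = u (\<theta> (\<theta> h)) t" for t h
        by (simp add: u_def \<theta>_def pCons_pderiv_gauss_mult)
      have C: "C \<noteq> 0" unfolding C_def th2[symmetric] using g1 g2 assms(3) by (simp add: \<theta>_def g_def pderiv_pCons)
      have z: "u f s = 0" "u (\<theta> f) s = 0" using g0 g1 by (auto simp: u_def g_def th[symmetric] \<theta>_def) (simp add: pCons_pderiv_gauss_mult[symmetric])
      have du: "((\<lambda>t. u h t) has_real_derivative - (u (\<theta> (\<theta> h)) s + u (\<theta> h) s)) (at s)" for h
        using gauss_mult_has_derivative[of h x s] unfolding u_def \<theta>_def by (simp add: pCons_pderiv_gauss_mult)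
      \<comment> \<open>At time \<open>s\<close> both \<open>u f\<close> and
        \<open>u (\<theta> f)\<close> vanish, so \<open>G\<close> vanishes and its derivative
        reduces to \<open>- (u f)' C = C^2\<close>. This positive derivative makes the Laguerre
        expression negative slightly earlier.\<close>
      define G where "G = (\<lambda>t. (u (\<theta> f) t)\<^sup>2 - u f t * u (\<theta> (\<theta> f)) t)"
      have "(G has_real_derivative C\<^sup>2) (at s)"
        unfolding G_def by (rule derivative_eq_intros du refl)+ (simp add: z C_def power2_eq_square)
      moreover have "C\<^sup>2 > 0" using C by simp
      ultimately obtain d where d: "d > 0" "\<And>h. h > 0 \<Longrightarrow> h < d \<Longrightarrow> G (s - h) < G s"
        using DERIV_pos_inc_left by blast
      define h where "h = min (d / 2) (s / 2)"
      have h: "h > 0" "h < d" "s - h \<ge> 0" using d assms(2) by (auto simp: h_def)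
      have "G s = 0" by (simp add: G_def z)
      then have "G (s - h) < 0" using d(2)[OF h(1,2)] by simp
      moreover have "G (s - h) \<ge> 0"
      proof -
        have "0 \<le> (poly (\<theta> (gauss_mult (s - h) f)) x)\<^sup>2 - poly (gauss_mult (s - h) f) x * poly (\<theta> (\<theta> (gauss_mult (s - h) f))) x"
          unfolding \<theta>_def by (rule hyp_Laguerre[OF hyp_gauss_mult[OF 0 h(3)]]) (use x in simp)
        then show ?thesis unfolding th th2 G_def by (simp add: u_def)
      qed
      ultimately show False by simp
    qed
  qed
  then show ?thesis using assms(1) by (metis One_nat_def Suc_le_eq Suc_leI not_less_eq_eq old.nat.exhaust le_SucI le0)
qed

section \<open>Jensen multipliers\<close>

definition jensen_mult :: "nat \<Rightarrow> real poly \<Rightarrow> real poly" where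
  "jensen_mult n = coeff_mult (\<lambda>k. if k \<le> n then fact n / fact (n - k) else 0)"

text \<open>A new factor \<open>r + x\<close> turns the image \<open>f\<close> into
  \<open>r f + x (n - \<theta>) f\<close>. A zero in the upper half-plane would force
  \<open>\<theta> f / f = n + r / z\<close>, of negative imaginary part because
  \<open>r > 0\<close>, while \<open>hyp_logderiv\<close> allows only positive imaginary part or a
  real value.\<close>

lemma hyp_jensen_mult:
  assumes "\<forall>r\<in>set rs. r > 0" "c > 0" shows "hyp (jensen_mult n (smult c (\<Prod>r\<leftarrow>rs. [:r, 1:])))"
  using assms(1)
proof (induction rs)
  case Nil
  have "jensen_mult n (smult c (\<Prod>r\<leftarrow>[]. [:r, 1:])) = [:c:]"
    by (rule poly_eqI) (auto simp: jensen_mult_def coeff_pCons split: nat.splits)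
  then show ?case using hyp_const[OF assms(2)] by simp
next
  case (Cons r rs)
  define p where "p = smult c (\<Prod>r\<leftarrow>rs. [:r, 1:])"
  define f where "f = jensen_mult n p"
  have r: "r > 0" and f: "hyp f" using Cons by (auto simp: f_def p_def)
  have p: "hyp p" unfolding p_def hyp_def using Cons.prems assms(2) by (auto intro!: exI[of _ c] exI[of _ rs] less_imp_le)
  have degf: "degree f \<le> n" unfolding f_def jensen_mult_def by (rule degree_le) auto
  have eq: "smult c (\<Prod>r\<leftarrow>r # rs. [:r, 1:]) = [:r, 1:] * p"
    by (simp only: p_def list.map prod_list.Cons mult_smult_right)
  have J: "jensen_mult n ([:r, 1:] * p) = smult r f + pCons 0 (smult (real n) f - pCons 0 (pderiv f))"
  proof (rule poly_eqI)
    fix k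
    show "coeff (jensen_mult n ([:r, 1:] * p)) k = coeff (smult r f + pCons 0 (smult (real n) f - pCons 0 (pderiv f))) k"
    proof (cases k)
      case (Suc j)
      define w where "w = (\<lambda>k. if k \<le> n then fact n / fact (n - k) else 0 :: real)"
      have "(fact n :: real) / fact (n - Suc j) = (real n - real j) * (fact n / fact (n - j))" if "Suc j \<le> n"
      proof -
        have "n - j = Suc (n - Suc j)" using that by simp
        then have "(fact (n - j) :: real) = (real n - real j) * fact (n - Suc j)"
          using that by (simp add: of_nat_diff)
        moreover have "real n - real j \<noteq> 0" using that by simp
        ultimately show ?thesis by simp
      qed
      \<comment> \<open>At the cut-off \<open>j = n\<close> the factor \<open>n - j\<close>
        vanishes, so the recursion for the multipliers holds across the truncation.\<close>
      moreover have "j = n" if "j \<le> n" "\<not> Suc j \<le> n" using that by simp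
      ultimately have w: "w (Suc j) = (real n - real j) * w j" by (auto simp: w_def)
      have cf: "coeff f k = w k * coeff p k" for k by (simp add: f_def jensen_mult_def w_def)
      have "coeff (smult (real n) f - pCons 0 (pderiv f)) j = (real n - real j) * coeff f j"
        by (cases j) (auto simp: coeff_pderiv algebra_simps)
      then have "coeff (smult r f + pCons 0 (smult (real n) f - pCons 0 (pderiv f))) (Suc j)
          = r * coeff f (Suc j) + (real n - real j) * coeff f j" by simp
      also have "\<dots> = w (Suc j) * (r * coeff p (Suc j) + coeff p j)"
        unfolding cf w by (simp add: algebra_simps)
      also have "\<dots> = coeff (jensen_mult n ([:r, 1:] * p)) (Suc j)"
        by (simp add: jensen_mult_def w_def)
      finally show ?thesis unfolding Suc by simp
    qed (auto simp: f_def jensen_mult_def)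
  qed
  have "hyp (jensen_mult n ([:r, 1:] * p))"
  proof (rule hypI)
    show "coeff (jensen_mult n ([:r, 1:] * p)) k \<ge> 0" for k
      using hyp_coeff_nonneg[OF hyp_linear_mult[OF less_imp_le[OF r] p], of k] by (simp add: jensen_mult_def)
    show nz: "cpoly (jensen_mult n ([:r, 1:] * p)) z \<noteq> 0" if z: "Im z > 0" for z
    proof
      assume a: "cpoly (jensen_mult n ([:r, 1:] * p)) z = 0"
      have fz: "cpoly f z \<noteq> 0" using hyp_upper[OF f] z by auto
      have z0: "z \<noteq> 0" using z by auto
      have Jz: "cpoly (jensen_mult n ([:r, 1:] * p)) z = of_real r * cpoly f z + z * (of_nat n * cpoly f z - z * cpoly (pderiv f) z)"
        unfolding J by simp
      have "z * cpoly (pderiv f) z / cpoly f z = of_real r / z + of_nat n"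
      proof -
        define c d where "c = cpoly f z" and "d = cpoly (pderiv f) z"
        have "of_real r * c + z * (of_nat n * c - z * d) = 0"
          using a Jz by (simp only: c_def d_def)
        then have "z * (z * d) = of_real r * c + z * (of_nat n * c)"
          by (simp only: right_diff_distrib) (simp add: algebra_simps)
        also have "\<dots> = z * ((of_real r / z + of_nat n) * c)"
          using z0 by (simp add: distrib_left distrib_right)
        finally have "z * d = (of_real r / z + of_nat n) * c" using z0 by (simp only: mult_cancel_left) simp
        then show ?thesis unfolding c_def d_def nonzero_divide_eq_eq[OF fz] .
      qed
      moreover have "Im (of_real r / z + of_nat n) < 0"
      proof -
        have "Im (of_real r / z + of_nat n) = - (r * Im z / ((Re z)\<^sup>2 + (Im z)\<^sup>2))" by (simp add: Im_divide)
        moreover have "r * Im z / ((Re z)\<^sup>2 + (Im z)\<^sup>2) > 0"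
          using r z by (intro divide_pos_pos mult_pos_pos add_nonneg_pos) auto
        ultimately show ?thesis by simp
      qed
      ultimately have "Im (z * cpoly (pderiv f) z / cpoly f z) < 0" by simp
      with hyp_logderiv[OF f z] show False by (metis complex_Im_of_nat less_asym less_irrefl)
    qed
    show "jensen_mult n ([:r, 1:] * p) \<noteq> 0" using nz[of \<i>] by auto
  qed
  then show ?case unfolding eq .
qed

subsection \<open>Discriminants, the criterion of Kurtz and log-concave sequences\<close>

lemma poly_discriminant_eq_0I:
  fixes p :: "real poly"
  assumes "p \<noteq> 0" "poly p x = 0" "poly (pderiv p) x = 0" shows "poly_discriminant p = 0"
proof -
  have "[:- x, 1:] dvd gcd p (pderiv p)" using assms by (auto simp: poly_eq_0_iff_dvd)
  moreover have "gcd p (pderiv p) \<noteq> 0" using assms(1) by simp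
  ultimately have "degree [:- x, 1:] \<le> degree (gcd p (pderiv p))" by (rule dvd_imp_degree_le)
  then have "degree (gcd p (pderiv p)) \<noteq> 0" by (metis degree_pCons_eq_if degree_0 not_one_le_zero one_neq_zero One_nat_def pCons_eq_0_iff)
  then have "resultant p (pderiv p) = 0" using resultant_0_gcd[of p "pderiv p"] by simp
  then show ?thesis by (simp add: poly_discriminant_def)
qed

text \<open>A vanishing resultant yields a nonconstant common factor with the derivative;
  hyperbolicity makes its complex zeros real, and such a zero has order at least two.\<close>

lemma hyp_poly_discriminant_nonzero:
  assumes "hyp p" "\<And>x. order x p \<le> 1" "degree p > 0" shows "poly_discriminant p \<noteq> 0"
proof
  assume "poly_discriminant p = 0"
  then have "resultant p (pderiv p) = 0" using hyp_nonzero[OF assms(1)] by (simp add: poly_discriminant_def)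
  then have dg: "degree (gcd p (pderiv p)) \<noteq> 0" using resultant_0_gcd[of p "pderiv p"] by simp
  define g where "g = gcd p (pderiv p)"
  have "degree (map_poly complex_of_real g) > 0" using dg unfolding g_def by (metis of_real_hom.degree_map_poly_hom neq0_conv)
  then obtain w where w: "cpoly g w = 0" using alg_closed_imp_poly_has_root unfolding cpoly_def by blast
  have d: "g dvd p" "g dvd pderiv p" by (auto simp: g_def)
  then have "cpoly p w = 0" "cpoly (pderiv p) w = 0" using w by (auto simp: cpoly_mult elim!: dvdE)
  moreover from this(1) have "Im w = 0" using hyp_upper[OF assms(1)] by blast
  then have "w = of_real (Re w)" by (simp add: complex_eq_iff)
  ultimately have r: "poly p (Re w) = 0" "poly (pderiv p) (Re w) = 0" by (metis cpoly_of_real of_real_eq_0_iff)+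
  have "pderiv p \<noteq> 0" using assms(3) pderiv_eq_0_iff[of p] by auto
  then have "order (Re w) (pderiv p) \<noteq> 0" using r(2) order_root by blast
  moreover have "order (Re w) p = Suc (order (Re w) (pderiv p))"
    using order_pderiv[of p "Re w"] r(1) hyp_nonzero[OF assms(1)] by simp
  ultimately show False using assms(2)[of "Re w"] by simp
qed

section \<open>Alternating sums and the criterion of Kurtz\<close>

lemma alternating_sum_bounds:
  fixes c :: "nat \<Rightarrow> real"
  assumes "\<And>i. i < m \<Longrightarrow> c i \<ge> 0" "\<And>i. Suc i < m \<Longrightarrow> c (Suc i) \<le> c i" "c 0 \<ge> 0"
  shows "0 \<le> (\<Sum>i<m. (-1) ^ i * c i) \<and> (\<Sum>i<m. (-1) ^ i * c i) \<le> c 0"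
  using assms
proof (induction m arbitrary: c)
  case (Suc m)
  have eq: "(\<Sum>i<Suc m. (-1) ^ i * c i) = c 0 - (\<Sum>i<m. (-1) ^ i * c (Suc i))"
    by (subst sum.lessThan_Suc_shift) (simp add: sum_negf)
  show ?case
  proof (cases m)
    case 0 then show ?thesis using Suc.prems by simp
  next
    case (Suc k)
    have "0 \<le> (\<Sum>i<m. (-1) ^ i * c (Suc i)) \<and> (\<Sum>i<m. (-1) ^ i * c (Suc i)) \<le> c (Suc 0)"
      by (rule Suc.IH) (use Suc.prems Suc in auto)
    moreover have "c (Suc 0) \<le> c 0" using Suc.prems(2)[of 0] Suc by simp
    ultimately show ?thesis unfolding eq by linarith
  qed
qed simp

text \<open>Domination at \<open>k\<close> together with log-concavity makes \<open>b\<close>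
  increase up to \<open>k\<close> and decrease afterwards. Both tails then alternate with monotone
  terms, so the neighbours \<open>b (k - 1)\<close> and \<open>b (k + 1)\<close> bound them. The
  value \<open>b (Suc n)\<close> lies outside the sum and serves as right neighbour when
  \<open>k = n\<close>.\<close>

lemma unimodal_alternating_sum_pos:
  fixes b :: "nat \<Rightarrow> real"
  assumes pos: "\<And>k. k \<le> Suc n \<Longrightarrow> b k > 0"
    and lc: "\<And>k. 1 \<le> k \<Longrightarrow> k \<le> n \<Longrightarrow> b (k - 1) * b (Suc k) \<le> b k * b k"
    and k: "1 \<le> k" "k \<le> n" "b k > b (k - 1) + b (Suc k)"
  shows "(-1) ^ k * (\<Sum>j\<le>n. (-1) ^ j * b j) > 0"
proof -
  have right: "b (Suc j) \<le> b j" if "k \<le> j" "j \<le> n" for j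
    using that
  proof (induction j rule: dec_induct)
    case base
    have "b (k - 1) > 0" using k by (intro pos) simp
    then show ?case using k by linarith
  next
    case (step j)
    have "b j * b (Suc (Suc j)) \<le> b (Suc j) * b (Suc j)" using lc[of "Suc j"] step by simp
    also have "\<dots> \<le> b j * b (Suc j)" using step pos[of "Suc j"] by (intro mult_right_mono) auto
    finally show ?case using pos[of j] step by simp
  qed
  have left: "b j \<le> b (Suc j)" if "j < k" for j
    using that
  proof (induction "k - Suc j" arbitrary: j)
    case 0
    then have "j = k - 1" by simp
    moreover have "b (Suc k) > 0" using k by (intro pos) simp
    ultimately show ?case using k by simp
  next
    case (Suc d)
    have IH: "b (Suc j) \<le> b (Suc (Suc j))" using Suc(1)[of "Suc j"] Suc by simp
    have "b j * b (Suc (Suc j)) \<le> b (Suc j) * b (Suc j)" using lc[of "Suc j"] Suc k by simp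
    also have "\<dots> \<le> b (Suc j) * b (Suc (Suc j))" using IH pos[of "Suc j"] Suc k by (intro mult_left_mono) auto
    finally show ?case using pos[of "Suc (Suc j)"] Suc k by simp
  qed
  define g where "g = (\<lambda>j. (-1) ^ k * ((-1) ^ j * b j))"
  have sq: "(-1::real) ^ k * (-1) ^ k = 1" by (simp add: power_mult_distrib[symmetric])
  have "(-1) ^ k * (\<Sum>j\<le>n. (-1) ^ j * b j) = (\<Sum>j\<le>n. g j)" by (simp add: g_def sum_distrib_left)
  also have "\<dots> = (\<Sum>j<k. g j) + (\<Sum>j=k..n. g j)"
    using k by (subst sum.union_disjoint[symmetric]) (auto intro!: sum.cong)
  also have "(\<Sum>j<k. g j) = (\<Sum>i<k. g (k - Suc i))" by (rule sum.nat_diff_reindex[symmetric])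
  also have "\<dots> = - (\<Sum>i<k. (-1) ^ i * b (k - Suc i))"
    unfolding sum_negf[symmetric]
  proof (rule sum.cong)
    fix i assume i: "i \<in> {..<k}"
    then have "k = Suc i + (k - Suc i)" by simp
    then have "(-1::real) ^ k * (-1) ^ (k - Suc i) = (-1) ^ Suc i * ((-1) ^ (k - Suc i) * (-1) ^ (k - Suc i))"
      by (metis mult.assoc power_add)
    also have "\<dots> = - ((-1) ^ i)" by (simp add: power_mult_distrib[symmetric])
    finally show "g (k - Suc i) = - ((-1) ^ i * b (k - Suc i))" by (simp add: g_def mult.assoc[symmetric])
  qed simp
  also have "(\<Sum>j=k..n. g j) = (\<Sum>i<Suc (n - k). g (k + i))"
    using k by (intro sum.reindex_bij_witness[of _ "\<lambda>i. k + i" "\<lambda>j. j - k"]) auto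
  also have "\<dots> = b k - (\<Sum>i<n - k. (-1) ^ i * b (Suc k + i))"
    unfolding g_def by (subst sum.lessThan_Suc_shift) (simp add: sum_negf sq power_add mult.assoc[symmetric])
  finally have eq: "(-1) ^ k * (\<Sum>j\<le>n. (-1) ^ j * b j)
     = - (\<Sum>i<k. (-1) ^ i * b (k - Suc i)) + (b k - (\<Sum>i<n - k. (-1) ^ i * b (Suc k + i)))" .
  have "(\<Sum>i<k. (-1) ^ i * b (k - Suc i)) \<le> b (k - Suc 0)"
  proof (rule conjunct2[OF alternating_sum_bounds])
    show "b (k - Suc (Suc i)) \<le> b (k - Suc i)" if "Suc i < k" for i
      using left[of "k - Suc (Suc i)"] that by (simp add: Suc_diff_Suc)
  qed (use pos k in \<open>auto intro!: less_imp_le\<close>)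
  moreover have "(\<Sum>i<n - k. (-1) ^ i * b (Suc k + i)) \<le> b (Suc k + 0)"
  proof (rule conjunct2[OF alternating_sum_bounds])
    show "b (Suc k + Suc i) \<le> b (Suc k + i)" if "Suc i < n - k" for i
      using right[of "Suc k + i"] that by simp
  qed (use pos k in \<open>auto intro!: less_imp_le\<close>)
  ultimately show ?thesis unfolding eq using k by simp
qed

text \<open>The condition of Hutchinson and Kurtz: at \<open>x = - sqrt (a (k-1) / a (k+1))\<close> the \<open>k\<close>-th term dominates.\<close>
lemma hyp_Kurtz:
  fixes a :: "nat \<Rightarrow> real"
  assumes pos: "\<And>k. k \<le> n \<Longrightarrow> a k > 0"
    and kurtz: "\<And>k. 1 \<le> k \<Longrightarrow> k < n \<Longrightarrow> 4 * (a (k - 1) * a (Suc k)) < a k * a k"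
    and p: "\<And>k. coeff p k = (if k \<le> n then a k else 0)"
  shows "hyp p"
proof (rule hypI)
  show "p \<noteq> 0" using p[of 0] pos[of 0] by auto
  show "coeff p k \<ge> 0" for k using p[of k] pos[of k] by auto
  have degp: "degree p = n"
  proof (rule antisym)
    show "degree p \<le> n" by (rule degree_le) (simp add: p)
    show "n \<le> degree p" by (rule le_degree) (use p[of n] pos[of n] in auto)
  qed
  fix z :: complex assume z: "Im z > 0"
  \<comment> \<open>The sequence is continued beyond \<open>n\<close> so that the strict inequality,
    and with it a point \<open>t n\<close> of controlled sign, is also available at
    \<open>k = n\<close>. Any constant above 4 would do in place of 5.\<close>
  define A where "A k = (if k \<le> n then a k else a n * a n / (5 * a (n - 1)))" for k
  have Apos: "A k > 0" for k using pos[of k] pos[of n] pos[of "n - 1"] by (auto simp: A_def)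
  have Ak: "4 * (A (k - 1) * A (Suc k)) < A k * A k" if "1 \<le> k" "k \<le> n" for k
  proof (cases "k = n")
    case True
    then show ?thesis using that pos[of n] pos[of "n - 1"] by (simp add: A_def)
  next
    case False
    then have "k < n" "k - 1 \<le> n" "Suc k \<le> n" using that by auto
    then show ?thesis using that kurtz[of k] by (simp add: A_def)
  qed
  \<comment> \<open>This point equalizes the terms of index \<open>k - 1\<close> and
    \<open>k + 1\<close>; the inequality then says that the middle term exceeds twice their common
    value. At \<open>t 0 = 0\<close> only the constant term is left.\<close>
  define t where "t k = (if k = 0 then 0 else sqrt (A (k - 1) / A (Suc k)))" for k
  define P where "P x = poly p (- x)" for x
  have P: "P x = (\<Sum>j\<le>n. (-1) ^ j * (A j * x ^ j))" for x
    unfolding P_def poly_altdef degp by (rule sum.cong) (auto simp: p A_def power_minus[of x])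
  have tpos: "t k > 0" if "k \<ge> 1" for k using that Apos by (simp add: t_def)
  have sgn: "(-1) ^ k * P (t k) > 0" if "k \<le> n" for k
  proof (cases "k = 0")
    case True
    then show ?thesis using Apos[of 0] by (simp add: P t_def power_0_left if_distrib[of "\<lambda>x. _ * x"] sum.delta cong: if_cong)
  next
    case False
    then have k: "1 \<le> k" "k \<le> n" using that by auto
    define x where "x = t k"
    have x: "x > 0" using tpos k by (simp add: x_def)
    have x2: "x * x = A (k - 1) / A (Suc k)" unfolding x_def t_def using k Apos by (simp add: less_imp_le)
    define b where "b j = A j * x ^ j" for j
    have e: "A (Suc k) * (x * x) = A (k - 1)" unfolding x2 using Apos[of "Suc k"] by simp
    have pk: "x ^ k = x * x ^ (k - 1)" using k by (cases k) auto
    have b1: "b (Suc k) = A (k - 1) * x ^ (k - 1)" unfolding b_def power_Suc pk using e by (simp add: mult_ac)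
    have bb: "b (k - 1) * b (Suc k) * 4 < b k * b k" 
    proof -
      have "b (k - 1) * b (Suc k) * 4 = (4 * (A (k - 1) * A (Suc k))) * (x ^ k * x ^ k)"
        unfolding b_def power_Suc pk by (simp add: mult_ac)
      also have "\<dots> < A k * A k * (x ^ k * x ^ k)" using Ak[OF k] x by (intro mult_strict_right_mono) auto
      finally show ?thesis by (simp add: b_def mult_ac)
    qed
    have "b (k - 1) = b (Suc k)" using b1 by (simp add: b_def)
    then have "(2 * b (Suc k))\<^sup>2 < (b k)\<^sup>2" using bb by (simp add: power2_eq_square)
    then have "2 * b (Suc k) < b k" by (rule power_less_imp_less_base) (use Apos x in \<open>simp add: b_def less_imp_le\<close>)
    have "(-1) ^ k * (\<Sum>j\<le>n. (-1) ^ j * b j) > 0"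
    proof (rule unimodal_alternating_sum_pos)
      show "b j > 0" for j using Apos x by (simp add: b_def)
      show "b (j - 1) * b (Suc j) \<le> b j * b j" if "1 \<le> j" "j \<le> n" for j
      proof -
        have pj: "x ^ j = x * x ^ (j - 1)" using that by (cases j) auto
        have "b (j - 1) * b (Suc j) = (A (j - 1) * A (Suc j)) * (x ^ j * x ^ j)"
          unfolding b_def power_Suc pj by (simp add: mult_ac)
        also have "\<dots> \<le> A j * A j * (x ^ j * x ^ j)"
          using Ak[OF that] x mult_pos_pos[OF Apos[of "j - 1"] Apos[of "Suc j"]] by (intro mult_right_mono) (linarith | simp)+
        finally show ?thesis by (simp add: b_def mult_ac)
      qed
      show "b (k - 1) + b (Suc k) < b k" using \<open>b (k - 1) = b (Suc k)\<close> \<open>2 * b (Suc k) < b k\<close> by simp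
    qed (use k in auto)
    then show ?thesis by (simp add: P b_def x_def)
  qed
  have tmono: "t k < t (Suc k)" if "k < n" for k
  proof (cases "k = 0")
    case True then show ?thesis using tpos[of 1] by (simp add: t_def)
  next
    case False
    have 1: "A (k - 1) * A (Suc k) < A k * A k" 
      using Ak[of k] that False mult_pos_pos[OF Apos[of "k - 1"] Apos[of "Suc k"]] by linarith
    have 2: "A k * A (Suc (Suc k)) < A (Suc k) * A (Suc k)"
      using Ak[of "Suc k"] that mult_pos_pos[OF Apos[of k] Apos[of "Suc (Suc k)"]] by auto
    have "(A (k - 1) * A (Suc k)) * (A k * A (Suc (Suc k))) < (A k * A k) * (A (Suc k) * A (Suc k))"
      by (rule mult_strict_mono[OF 1 2]) (auto intro!: mult_pos_pos Apos less_imp_le)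
    then have "(A (k - 1) * A (Suc (Suc k))) * (A k * A (Suc k)) < (A k * A (Suc k)) * (A k * A (Suc k))"
      by (simp add: mult_ac)
    then have "A (k - 1) * A (Suc (Suc k)) < A k * A (Suc k)"
      using mult_pos_pos[OF Apos[of k] Apos[of "Suc k"]] by (simp add: mult_less_cancel_right)
    then have "A (k - 1) / A (Suc k) < A k / A (Suc (Suc k))" using Apos by (simp add: field_simps)
    then show ?thesis using False by (simp add: t_def)
  qed
  \<comment> \<open>The signs alternate along the \<open>n + 1\<close> increasing points
    \<open>t 0, ..., t n\<close>, which gives \<open>n\<close> real zeros; a further nonreal one
    would exceed the degree.\<close>
  have "\<exists>r. t k < r \<and> r < t (Suc k) \<and> P r = 0" if "k < n" for k
  proof -
    have cont: "continuous_on {t k..t (Suc k)} (\<lambda>x. (-1) ^ k * P x)"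
      unfolding P_def by (intro continuous_intros)
    have "(-1) ^ k * P (t k) > 0" "(-1) ^ k * P (t (Suc k)) < 0" using sgn[of k] sgn[of "Suc k"] that by auto
    then have "\<exists>r\<ge>t k. r \<le> t (Suc k) \<and> (-1) ^ k * P r = 0"
      using tmono[OF that] by (intro IVT2'[OF _ _ _ cont]) auto
    then obtain r where "t k \<le> r" "r \<le> t (Suc k)" "(-1) ^ k * P r = 0" by blast
    moreover from this have "r \<noteq> t k" "r \<noteq> t (Suc k)" using sgn[of k] sgn[of "Suc k"] that by auto
    ultimately show ?thesis by (intro exI[of _ r]) auto
  qed
  then obtain r where r: "\<And>k. k < n \<Longrightarrow> t k < r k \<and> r k < t (Suc k) \<and> P (r k) = 0" by metis
  have tle: "t i \<le> t j" if "i \<le> j" "j \<le> n" for i j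
    using that by (induction j rule: dec_induct) (auto intro: order_trans[OF _ less_imp_le[OF tmono]])
  have inj: "inj_on r {..<n}"
  proof (rule linorder_inj_onI)
    fix i j assume "i < j" "i \<in> {..<n}" "j \<in> {..<n}"
    then show "r i \<noteq> r j" using r[of i] r[of j] tle[of "Suc i" j] by auto
  qed auto
  show "cpoly p z \<noteq> 0"
  proof
    assume a: "cpoly p z = 0"
    let ?q = "map_poly complex_of_real p"
    let ?Z = "(\<lambda>k. of_real (- r k)) ` {..<n} :: complex set"
    have q: "?q \<noteq> 0" "degree ?q = n" using \<open>p \<noteq> 0\<close> degp by (auto simp: of_real_hom.degree_map_poly_hom)
    have "inj_on (\<lambda>k. complex_of_real (- r k)) {..<n}" using inj by (auto simp: inj_on_def)
    then have "card ?Z = n" by (simp add: card_image)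
    moreover have "z \<notin> ?Z" using z by (auto simp: complex_eq_iff)
    ultimately have "card (insert z ?Z) = Suc n" by simp
    moreover have "insert z ?Z \<subseteq> {x. poly ?q x = 0}"
    proof -
      have "cpoly p (of_real (- r k)) = 0" if "k < n" for k unfolding cpoly_of_real using r[OF that] by (simp add: P_def)
      then show ?thesis using a by (auto simp: cpoly_def)
    qed
    then have "card (insert z ?Z) \<le> card {x. poly ?q x = 0}" by (rule card_mono[OF poly_roots_finite[OF q(1)]])
    ultimately show False using card_poly_roots_bound[OF q(1)] q(2) by linarith
  qed
qed

section \<open>Dependence of the zeros on a parameter\<close>

lemma cpoly_root_norm_le:
  assumes "cpoly f z = 0" "degree f = n" "n > 0"
  shows "cmod z \<le> 1 + (\<Sum>k\<le>n. \<bar>coeff f k\<bar> / \<bar>coeff f n\<bar>)"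
proof (cases "cmod z \<le> 1")
  case True
  then show ?thesis by (simp add: add_increasing2 sum_nonneg)
next
  case False
  have c: "coeff f n \<noteq> 0" using assms by (metis leading_coeff_0_iff degree_0 less_irrefl)
  obtain m where m: "n = Suc m" using assms(3) by (cases n) auto
  have "0 = (\<Sum>k\<le>n. of_real (coeff f k) * z ^ k)" using cpoly_eq_sum[of f n z] assms by simp
  then have "of_real (coeff f n) * z ^ n = - (\<Sum>k\<le>m. of_real (coeff f k) * z ^ k)"
    unfolding m by (simp add: eq_neg_iff_add_eq_0 add.commute)
  then have "\<bar>coeff f n\<bar> * cmod z ^ n = cmod (\<Sum>k\<le>m. of_real (coeff f k) * z ^ k)"
    by (metis norm_minus_cancel norm_mult norm_of_real norm_power)
  also have "\<dots> \<le> (\<Sum>k\<le>m. \<bar>coeff f k\<bar> * cmod z ^ m)"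
    using False by (intro sum_norm_le) (auto simp: norm_mult norm_power intro!: mult_left_mono power_increasing)
  also have "\<dots> = (\<Sum>k\<le>m. \<bar>coeff f k\<bar>) * cmod z ^ m" by (simp add: sum_distrib_right)
  finally have "(\<bar>coeff f n\<bar> * cmod z) * cmod z ^ m \<le> (\<Sum>k\<le>m. \<bar>coeff f k\<bar>) * cmod z ^ m"
    by (simp add: m mult_ac)
  then have "\<bar>coeff f n\<bar> * cmod z \<le> (\<Sum>k\<le>m. \<bar>coeff f k\<bar>)"
    using False by (simp add: mult_le_cancel_right) (smt (verit) zero_less_power)
  also have "\<dots> \<le> (\<Sum>k\<le>n. \<bar>coeff f k\<bar>)" unfolding m by simp
  finally have "cmod z \<le> (\<Sum>k\<le>n. \<bar>coeff f k\<bar>) / \<bar>coeff f n\<bar>" using c by (simp add: field_simps)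
  then show ?thesis by (simp add: sum_divide_distrib)
qed

text \<open>A limit of a pair of non-real conjugate zeros is non-real or a double zero.\<close>
lemma nonreal_root_limit:
  assumes deg: "\<And>j. degree (f j) = degree g" "degree g > 0"
    and lim: "\<And>k. (\<lambda>j. coeff (f j) k) \<longlonglongrightarrow> coeff g k"
    and roots: "\<And>j::nat. \<exists>z. Im z > 0 \<and> cpoly (f j) z = 0"
  shows "(\<exists>z. Im z > 0 \<and> cpoly g z = 0) \<or> (\<exists>x. poly g x = 0 \<and> poly (pderiv g) x = 0)"
proof -
  define n where "n = degree g"
  have cn: "coeff g n \<noteq> 0" using deg(2) unfolding n_def by (metis leading_coeff_0_iff degree_0 less_irrefl)
  from roots obtain z where z: "\<And>j. Im (z j) > 0" "\<And>j. cpoly (f j) (z j) = 0" by metis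
  \<comment> \<open>This root bound is continuous in the coefficients where the leading one is
    nonzero, so all \<open>z j\<close> lie in one compact ball.\<close>
  have "(\<lambda>j. 1 + (\<Sum>k\<le>n. \<bar>coeff (f j) k\<bar> / \<bar>coeff (f j) n\<bar>)) \<longlonglongrightarrow> 1 + (\<Sum>k\<le>n. \<bar>coeff g k\<bar> / \<bar>coeff g n\<bar>)"
    using cn by (intro tendsto_intros lim) auto
  then have "Bseq (\<lambda>j. 1 + (\<Sum>k\<le>n. \<bar>coeff (f j) k\<bar> / \<bar>coeff (f j) n\<bar>))"
    by (intro convergent_imp_Bseq convergentI)
  then obtain B where B: "\<And>j. \<bar>1 + (\<Sum>k\<le>n. \<bar>coeff (f j) k\<bar> / \<bar>coeff (f j) n\<bar>)\<bar> \<le> B"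
    unfolding Bseq_def by auto
  have "z j \<in> cball 0 B" for j
    using cpoly_root_norm_le[OF z(2)[of j], of n] B[of j] deg by (simp add: n_def)
  then obtain w r where w: "strict_mono r" "(z \<circ> r) \<longlonglongrightarrow> w"
    using compact_cball[of "0::complex" B] unfolding compact_def by meson
  have lim': "(\<lambda>j. coeff (f (r j)) k) \<longlonglongrightarrow> coeff g k" for k
    using LIMSEQ_subseq_LIMSEQ[OF lim w(1)] by (simp add: o_def)
  have zw: "(\<lambda>j. z (r j)) \<longlonglongrightarrow> w" using w(2) by (simp add: o_def)
  have "(\<lambda>j. \<Sum>k\<le>n. of_real (coeff (f (r j)) k) * z (r j) ^ k) \<longlonglongrightarrow> (\<Sum>k\<le>n. of_real (coeff g k) * w ^ k)"
    by (intro tendsto_intros lim' zw)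
  moreover have "(\<Sum>k\<le>n. of_real (coeff (f (r j)) k) * z (r j) ^ k) = 0" for j
    using cpoly_eq_sum[of "f (r j)" n "z (r j)"] z(2)[of "r j"] deg by (simp add: n_def)
  ultimately have gw: "cpoly g w = 0"
    using LIMSEQ_unique[OF _ tendsto_const] cpoly_eq_sum[of g n w] by (simp add: n_def)
  have "Im w \<ge> 0"
    by (rule tendsto_lowerbound[OF tendsto_Im[OF zw]]) (use z(1) in \<open>auto intro!: always_eventually less_imp_le\<close>)
  show ?thesis
  proof (cases "Im w = 0")
    case False
    then show ?thesis using gw \<open>Im w \<ge> 0\<close> by (intro disjI1 exI[of _ w]) auto
  next
    case True
    then have wr: "w = of_real (Re w)" "cnj w = w" by (auto simp: complex_eq_iff)
    \<comment> \<open>\<open>Q\<close> is the quotient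
      \<open>(f u - f (cnj u)) / (u - cnj u)\<close> written as a polynomial in \<open>u\<close> and
      its conjugate. It vanishes at every nonreal zero of \<open>f\<close>, is continuous up to the
      real axis and equals \<open>f'\<close> there.\<close>
    define Q where "Q = (\<lambda>f u. \<Sum>k\<le>n. of_real (coeff f k) * (\<Sum>i<k. cnj u ^ (k - Suc i) * u ^ i) :: complex)"
    have "Q (f (r j)) (z (r j)) = 0" for j
    proof -
      let ?u = "z (r j)"
      have "(?u - cnj ?u) * Q (f (r j)) ?u = (\<Sum>k\<le>n. of_real (coeff (f (r j)) k) * (?u ^ k - cnj ?u ^ k))"
        unfolding Q_def sum_distrib_left by (rule sum.cong) (auto simp: power_diff_sumr2 sum_distrib_left mult_ac)
      also have "\<dots> = cpoly (f (r j)) ?u - cpoly (f (r j)) (cnj ?u)"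
        using deg cpoly_eq_sum[of "f (r j)" n] by (simp add: n_def sum_subtractf right_diff_distrib)
      also have "\<dots> = 0" using z(2)[of "r j"] by (simp add: cpoly_cnj)
      finally show ?thesis using z(1)[of "r j"] by (auto simp: complex_eq_iff)
    qed
    moreover have "(\<lambda>j. Q (f (r j)) (z (r j))) \<longlonglongrightarrow> Q g w"
      unfolding Q_def by (intro tendsto_intros lim' zw)
    ultimately have "Q g w = 0" using LIMSEQ_unique[OF _ tendsto_const] by simp
    moreover have "Q g w = (\<Sum>k\<le>n. of_real (coeff g k) * (of_nat k * w ^ (k - 1)))"
      unfolding Q_def wr(2)
    proof (rule sum.cong)
      fix k
      have "(\<Sum>i<k. w ^ (k - Suc i) * w ^ i) = (\<Sum>i<k. w ^ (k - 1))"
        by (rule sum.cong) (auto simp: power_add[symmetric])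
      then show "of_real (coeff g k) * (\<Sum>i<k. w ^ (k - Suc i) * w ^ i) = of_real (coeff g k) * (of_nat k * w ^ (k - 1))"
        by simp
    qed simp
    moreover have "\<dots> = cpoly (pderiv g) w"
    proof -
      have "cpoly (pderiv g) w = (\<Sum>k\<le>n. of_real (coeff (pderiv g) k) * w ^ k)"
        by (rule cpoly_eq_sum) (simp add: n_def degree_pderiv)
      also have "\<dots> = (\<Sum>k\<le>n. of_real (real (Suc k) * coeff g (Suc k)) * w ^ k)"
        by (simp add: coeff_pderiv)
      also have "\<dots> = (\<Sum>k<n. of_real (real (Suc k) * coeff g (Suc k)) * w ^ k)"
        by (rule sum.mono_neutral_right) (auto simp: n_def coeff_eq_0 not_less)
      finally show ?thesis
        by (subst sum.atMost_shift) (simp add: mult_ac)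
    qed
    ultimately have "cpoly (pderiv g) w = 0" by simp
    then have "poly g (Re w) = 0" "poly (pderiv g) (Re w) = 0"
      using gw wr(1) by (metis cpoly_of_real of_real_eq_0_iff)+
    then show ?thesis by blast
  qed
qed

text \<open>Connectedness of \<open>[\<alpha>, y]\<close>: the parameters with a hyperbolic
  polynomial and those with a nonreal zero form two disjoint closed sets covering it. Closedness of
  the second is where the discriminant enters, since a conjugate pair can become real only by
  colliding.\<close>

lemma hyp_continuation:
  fixes p :: "real \<Rightarrow> real poly"
  assumes deg: "\<And>y. y \<in> {\<alpha>..<\<beta>} \<Longrightarrow> degree (p y) = n" "n > 0"
    and nonneg: "\<And>y k. y \<in> {\<alpha>..<\<beta>} \<Longrightarrow> coeff (p y) k \<ge> 0"
    and cont: "\<And>k. continuous_on {\<alpha>..<\<beta>} (\<lambda>y. coeff (p y) k)"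
    and start: "hyp (p \<alpha>)"
    and disc: "\<And>y. y \<in> {\<alpha>..<\<beta>} \<Longrightarrow> poly_discriminant (p y) \<noteq> 0"
    and y: "y \<in> {\<alpha>..<\<beta>}"
  shows "hyp (p y)"
proof -
  have nz: "p y \<noteq> 0" if "y \<in> {\<alpha>..<\<beta>}" for y using deg(1)[OF that] deg(2) by auto
  define I where "I = {\<alpha>..y}"
  have I: "y' \<in> {\<alpha>..<\<beta>}" if "y' \<in> I" for y' using that y by (auto simp: I_def)
  define S where "S = {y' \<in> I. hyp (p y')}"
  define T where "T = {y' \<in> I. \<exists>z. Im z > 0 \<and> cpoly (p y') z = 0}"
  have lim: "(\<lambda>j. coeff (p (x j)) k) \<longlonglongrightarrow> coeff (p l) k" if "x \<longlonglongrightarrow> l" "\<And>j. x j \<in> I" "l \<in> I" for x l k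
    using continuous_on_tendsto_compose[OF cont that(1)] I that by (auto intro!: always_eventually)
  have "closed S" unfolding closed_sequential_limits
  proof (intro allI impI, elim conjE)
    fix x l assume x: "\<forall>j. x j \<in> S" "x \<longlonglongrightarrow> l"
    have l: "l \<in> I" using x closed_sequentially[of I x l] by (auto simp: S_def I_def)
    have "hyp (p l)"
      by (rule hyp_limit[of sequentially "\<lambda>j. p (x j)"]) (use x l I deg nz lim[OF x(2) _ l] in \<open>auto simp: S_def\<close>)
    then show "l \<in> S" using l by (simp add: S_def)
  qed
  moreover have "closed T" unfolding closed_sequential_limits
  proof (intro allI impI, elim conjE)
    fix x l assume x: "\<forall>j. x j \<in> T" "x \<longlonglongrightarrow> l"
    have l: "l \<in> I" using x closed_sequentially[of I x l] by (auto simp: T_def I_def)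
    have "(\<exists>z. Im z > 0 \<and> cpoly (p l) z = 0) \<or> (\<exists>u. poly (p l) u = 0 \<and> poly (pderiv (p l)) u = 0)"
      by (rule nonreal_root_limit[of "\<lambda>j. p (x j)"]) (use x l I deg lim[OF x(2) _ l] in \<open>auto simp: T_def\<close>)
    then have "\<exists>z. Im z > 0 \<and> cpoly (p l) z = 0"
      using poly_discriminant_eq_0I[OF nz[OF I[OF l]]] disc[OF I[OF l]] by blast
    then show "l \<in> T" using l by (simp add: T_def)
  qed
  moreover have "I \<subseteq> S \<union> T"
    using hypI[OF nz[OF I] nonneg[OF I]] by (auto simp: S_def T_def)
  moreover have "S \<inter> T \<inter> I = {}"
    using hyp_upper by (force simp: S_def T_def)
  moreover have "\<alpha> \<in> S \<inter> I" using start y by (auto simp: S_def I_def)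
  moreover have "connected I" by (simp add: I_def)
  ultimately have "T \<inter> I = {}" using connected_closed[of I] by (metis empty_iff)
  then have "y \<notin> T" using y by (auto simp: I_def)
  then show ?thesis using \<open>I \<subseteq> S \<union> T\<close> y by (auto simp: I_def S_def)
qed

section \<open>Log-concave coefficient sequences\<close>

definition log_concave :: "(nat \<Rightarrow> real) \<Rightarrow> bool" where
  "log_concave a \<longleftrightarrow> (\<forall>k. a k \<ge> 0 \<and> (a k = 0 \<longrightarrow> a (Suc k) = 0) \<and> a k * a (Suc (Suc k)) \<le> (a (Suc k))\<^sup>2)"

text \<open>Inequalities for terms further apart follow from consecutive ones by
  cross-multiplication and cancellation. Cancelling is legitimate because \<open>log_concave\<close>
  forbids a nonzero term after a zero.\<close>

lemma log_concave_PF2: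
  assumes "log_concave a" "i \<le> j" shows "a i * a (Suc (Suc j)) \<le> a (Suc i) * a (Suc j)"
  using assms(2)
proof (induction j rule: dec_induct)
  case base then show ?case using assms(1) by (simp add: log_concave_def power2_eq_square)
next
  case (step j)
  have nn: "a k \<ge> 0" for k using assms(1) by (simp add: log_concave_def)
  have z: "a k = 0 \<Longrightarrow> a (Suc k) = 0" for k using assms(1) by (simp add: log_concave_def)
  show ?case
  proof (cases "a (Suc (Suc j)) = 0")
    case True then show ?thesis using z[OF True] by simp
  next
    case False
    then have p: "a (Suc (Suc j)) > 0" "a (Suc j) > 0" using nn[of "Suc (Suc j)"] nn[of "Suc j"] z[of "Suc j"]
      by (auto simp: less_le)
    have 1: "a (Suc j) * a (Suc (Suc (Suc j))) \<le> a (Suc (Suc j)) * a (Suc (Suc j))"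
      using assms(1) by (simp add: log_concave_def power2_eq_square)
    have "(a i * a (Suc (Suc (Suc j)))) * (a (Suc j) * a (Suc (Suc j)))
       = (a i * a (Suc (Suc j))) * (a (Suc j) * a (Suc (Suc (Suc j))))" by (simp add: mult_ac)
    also have "\<dots> \<le> (a (Suc i) * a (Suc j)) * (a (Suc (Suc j)) * a (Suc (Suc j)))"
      by (rule mult_mono[OF step.IH 1]) (auto intro!: mult_nonneg_nonneg nn)
    also have "\<dots> = (a (Suc i) * a (Suc (Suc j))) * (a (Suc j) * a (Suc (Suc j)))" by (simp add: mult_ac)
    finally show ?thesis using p by (simp add: mult_le_cancel_right)
  qed
qed

text \<open>The condition on \<open>b\<close> and \<open>c\<close> is log-concavity of
  \<open>1, b, c\<close>; this is an instance of the stability of log-concave sequences under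
  convolution.\<close>

lemma log_concave_quadratic_mult:
  assumes "log_concave (coeff p)" "b > 0" "0 \<le> c" "c \<le> b\<^sup>2"
  shows "log_concave (coeff ([:1, b, c:] * p))"
proof -
  \<comment> \<open>Padding by zeros lets \<open>coeff p (k - 1)\<close> and
    \<open>coeff p (k - 2)\<close> be written without case distinctions at the left end.\<close>
  define A where "A k = (if k < 3 then 0 else coeff p (k - 3))" for k :: nat
  have A3: "A (Suc (Suc (Suc k))) = coeff p k" for k by (simp add: A_def)
  have nn: "A k \<ge> 0" for k using assms(1) by (auto simp: A_def log_concave_def)
  have pf: "A i * A (Suc (Suc j)) \<le> A (Suc i) * A (Suc j)" if "i \<le> j" for i j
  proof (cases "i < 3")
    case True
    then show ?thesis using nn[of "Suc i"] nn[of "Suc j"] by (simp add: A_def[of i])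
  next
    case False
    define i' j' where "i' = i - 3" and "j' = j - 3"
    have ij: "i = Suc (Suc (Suc i'))" "j = Suc (Suc (Suc j'))" "i' \<le> j'" using False that by (auto simp: i'_def j'_def)
    show ?thesis using log_concave_PF2[OF assms(1) ij(3)] unfolding ij(1,2) A3 .
  qed
  have d: "coeff ([:1, b, c:] * p) k = A (Suc (Suc (Suc k))) + b * A (Suc (Suc k)) + c * A (Suc k)" for k
    by (cases k; cases "k - 1") (auto simp: A_def coeff_pCons numeral_eq_Suc split: nat.splits)
  show ?thesis unfolding log_concave_def d
  proof (intro allI conjI impI)
    fix k
    show "0 \<le> A (Suc (Suc (Suc k))) + b * A (Suc (Suc k)) + c * A (Suc k)"
      using nn assms by (intro add_nonneg_nonneg mult_nonneg_nonneg) auto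
    define u v w x y where uvw: "u = A (Suc k)" "v = A (Suc (Suc k))" "w = A (Suc (Suc (Suc k)))"
      "x = A (Suc (Suc (Suc (Suc k))))" "y = A (Suc (Suc (Suc (Suc (Suc k)))))"
    have n: "u \<ge> 0" "v \<ge> 0" "w \<ge> 0" "x \<ge> 0" "y \<ge> 0" using nn by (auto simp: uvw)
    have i: "w * y \<le> x * x" "v * y \<le> w * x" "v * x \<le> w * w" "u * x \<le> v * w" "u * w \<le> v * v" "u * y \<le> v * x"
      unfolding uvw by (auto intro!: pf)
    \<comment> \<open>The defect is a combination of nonnegative minors with weights
      \<open>1, b, b^2 - c, c, b c, c^2\<close>; the hypothesis \<open>c \<le> b^2\<close> is the
      sign of the third weight.\<close>
    have "(x + b * w + c * v)\<^sup>2 - (w + b * v + c * u) * (y + b * x + c * w)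
      = (x * x - w * y) + b * (w * x - v * y) + (b\<^sup>2 - c) * (w * w - v * x) + c * (v * x - u * y)
        + (b * c) * (v * w - u * x) + c\<^sup>2 * (v * v - u * w)"
      by (simp add: power2_eq_square algebra_simps)
    also have "\<dots> \<ge> 0" using i assms by (intro add_nonneg_nonneg mult_nonneg_nonneg) auto
    finally show "(A (Suc (Suc (Suc k))) + b * A (Suc (Suc k)) + c * A (Suc k)) *
       (A (Suc (Suc (Suc (Suc (Suc k))))) + b * A (Suc (Suc (Suc (Suc k)))) + c * A (Suc (Suc (Suc k))))
       \<le> (A (Suc (Suc (Suc (Suc k)))) + b * A (Suc (Suc (Suc k))) + c * A (Suc (Suc k)))\<^sup>2"
      by (simp add: uvw)
    assume z: "A (Suc (Suc (Suc k))) + b * A (Suc (Suc k)) + c * A (Suc k) = 0"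
    have "w + b * v + c * u = 0" using z by (simp add: uvw)
    moreover have "b * v \<ge> 0" "c * u \<ge> 0" using n assms by auto
    ultimately have w: "w = 0" "b * v = 0" using n by linarith+
    then have "v = 0" using assms(2) by simp
    have "coeff p k = 0" using w by (simp add: uvw A3)
    then have "x = 0" using assms(1) by (simp add: log_concave_def uvw A3)
    then show "A (Suc (Suc (Suc (Suc k)))) + b * A (Suc (Suc (Suc k))) + c * A (Suc (Suc k)) = 0"
      using w \<open>v = 0\<close> by (simp add: uvw)
  qed
qed

text \<open>A conjugate pair contributes the factor \<open>1 + b x + c x^2\<close> with
  \<open>c = 1/|w|^2\<close> and \<open>b = - 2 Re w / |w|^2\<close>, and \<open>c \<le> b^2\<close>
  reads \<open>|w| \<le> 2 |Re w|\<close>: the sector is exactly what the convolution lemma asks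
  for. A real zero is the case \<open>c = 0\<close>.\<close>

lemma log_concave_sector:
  assumes "poly p 0 > 0" "\<And>w. cpoly p w = 0 \<Longrightarrow> cmod w / 2 \<le> - Re w"
  shows "log_concave (coeff p)"
  using assms
proof (induction "degree p" arbitrary: p rule: less_induct)
  case less
  show ?case
  proof (cases "degree p = 0")
    case True
    then obtain c where c: "p = [:c:]" by (metis degree_eq_zeroE)
    then show ?thesis using less.prems(1) by (auto simp: log_concave_def coeff_pCons split: nat.splits)
  next
    case False
    then have "degree (map_poly complex_of_real p) > 0" by (metis of_real_hom.degree_map_poly_hom neq0_conv)
    then obtain w where w: "cpoly p w = 0" using alg_closed_imp_poly_has_root unfolding cpoly_def by blast
    have p0: "p \<noteq> 0" using less.prems(1) by auto
    have "cpoly p 0 \<noteq> 0" using less.prems(1) cpoly_of_real[of p 0] by simp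
    then have w0: "w \<noteq> 0" using w by auto
    have sector: "cmod w / 2 \<le> - Re w" using less.prems(2)[OF w] .
    then have rw: "Re w < 0" using w0 by (smt (verit) zero_less_norm_iff half_gt_zero)
    define N where "N = (cmod w)\<^sup>2"
    have N: "N > 0" using w0 by (simp add: N_def)
    have step: "log_concave (coeff p)"
      if q: "p = [:1, b, c:] * q" and bc: "b > 0" "0 \<le> c" "c \<le> b\<^sup>2" for q b c
    proof -
      have "q \<noteq> 0" using q p0 by auto
      moreover have "degree [:1, b, c:] > 0" using bc by simp
      ultimately have "degree q < degree p" using q p0 by (subst q, subst degree_mult_eq) auto
      moreover have "poly q 0 > 0" using less.prems(1) q by simp
      moreover have "cmod w / 2 \<le> - Re w" if "cpoly q w = 0" for w
        using less.prems(2)[of w] that unfolding q cpoly_mult by simp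
      ultimately have "log_concave (coeff q)" by (rule less.hyps)
      then show ?thesis unfolding q by (rule log_concave_quadratic_mult) (use bc in auto)
    qed
    show ?thesis
    proof (cases "Im w = 0")
      case True
      then have "w = of_real (Re w)" by (simp add: complex_eq_iff)
      then have "poly p (Re w) = 0" using w by (metis cpoly_of_real of_real_eq_0_iff)
      then obtain g where g: "p = [:- Re w, 1:] * g" by (auto simp: poly_eq_0_iff_dvd)
      have "[:- Re w, 1:] * g = [:1, - 1 / Re w, 0:] * smult (- Re w) g"
        using rw by (simp add: smult_add_right)
      then have "p = [:1, - 1 / Re w, 0:] * smult (- Re w) g" using g by simp
      then show ?thesis by (rule step) (use rw in \<open>auto simp: divide_pos_neg\<close>)
    next
      case False
      define d where "d = [:N, - 2 * Re w, 1:]"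
      have NN: "N = Re w * Re w + Im w * Im w" unfolding N_def cmod_power2 by (simp add: power2_eq_square)
      have dw: "cpoly d w = 0" by (simp add: d_def NN complex_eq_iff algebra_simps)
      \<comment> \<open>The remainder is real of degree at most one and vanishes at the nonreal
        \<open>w\<close>, so it is zero.\<close>
      define r where "r = p mod d"
      have "degree d = 2" by (simp add: d_def)
      then have "d \<noteq> 0" by auto
      have "r = 0 \<or> degree r < degree d" unfolding r_def by (rule degree_mod_less[OF \<open>d \<noteq> 0\<close>])
      then have "degree r \<le> 1" using \<open>degree d = 2\<close> by auto
      moreover have "p = d * (p div d) + r" by (simp add: r_def)
      then have "cpoly r w = 0" using w dw by (metis add.left_neutral cpoly_add cpoly_mult mult_zero_left)
      ultimately have rr: "of_real (coeff r 0) + of_real (coeff r 1) * w = 0"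
        using cpoly_eq_sum[of r 1 w] by simp
      then have "coeff r 1 * Im w = 0" by (simp add: complex_eq_iff)
      then have "coeff r 1 = 0" "coeff r 0 = 0" using False rr by auto
      then have "r = 0" using \<open>degree r \<le> 1\<close> by (metis One_nat_def le_Suc_eq leading_coeff_0_iff le_zero_eq)
      then have p: "p = d * (p div d)" using \<open>p = d * (p div d) + r\<close> by simp
      have "d = smult N [:1, - 2 * Re w / N, 1 / N:]" using N by (simp add: d_def)
      then have "d * (p div d) = [:1, - 2 * Re w / N, 1 / N:] * smult N (p div d)"
        by (simp only: mult_smult_left mult_smult_right)
      moreover have "1 / N \<le> (- 2 * Re w / N)\<^sup>2"
      proof -
        have "(cmod w)\<^sup>2 \<le> (- 2 * Re w)\<^sup>2" using sector by (intro power_mono) auto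
        then have "N \<le> (- 2 * Re w)\<^sup>2" by (simp add: N_def)
        then have "N / N\<^sup>2 \<le> (- 2 * Re w)\<^sup>2 / N\<^sup>2" by (rule divide_right_mono) simp
        then show ?thesis using N by (simp add: power_divide power2_eq_square)
      qed
      moreover have "- 2 * Re w / N > 0" using rw N by (simp add: divide_neg_pos)
      ultimately show ?thesis using step[of "- 2 * Re w / N" "1 / N" "smult N (p div d)"] p N
        by simp
    qed
  qed
qed

subsection \<open>The theta transformation\<close>

definition gauss :: "real \<Rightarrow> complex \<Rightarrow> complex" where
  "gauss a u = exp (- of_real (pi * a) * u\<^sup>2)"

text \<open>Translates by \<open>n\<close> and \<open>- n\<close> are grouped so that a sum over all
  integers becomes a series over the naturals. The argument is complex because quasi-periodicity in
  the imaginary direction will compute the Fourier coefficients.\<close>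

definition gauss_pair :: "real \<Rightarrow> nat \<Rightarrow> complex \<Rightarrow> complex" where
  "gauss_pair a n u = (if n = 0 then gauss a u else gauss a (u + of_nat n) + gauss a (u - of_nat n))"

definition periodized_gauss :: "real \<Rightarrow> complex \<Rightarrow> complex" where
  "periodized_gauss a u = (\<Sum>n. gauss_pair a n u)"

lemma holomorphic_gauss [holomorphic_intros]: "f holomorphic_on S \<Longrightarrow> (\<lambda>u. gauss a (f u)) holomorphic_on S"
  unfolding gauss_def by (intro holomorphic_intros)

lemma holomorphic_gauss_pair: "gauss_pair a n holomorphic_on S"
proof -
  have "gauss_pair a n = (if n = 0 then gauss a else (\<lambda>u. gauss a (u + of_nat n) + gauss a (u - of_nat n)))"
    by (auto simp: gauss_pair_def)
  then show ?thesis by (auto intro!: holomorphic_intros holomorphic_gauss[of "\<lambda>u. u", simplified])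
qed

text \<open>The inequality \<open>m^2 \<le> 2 (x + m)^2 + 2 x^2\<close> gives up half of the decay
  in \<open>m\<close> and in return makes the bound uniform on discs.\<close>

lemma norm_gauss_le:
  assumes "a > 0" "norm u \<le> R" shows "norm (gauss a (u + of_int m)) \<le> exp (pi * a * R\<^sup>2) * exp (- (pi * a / 2) * (real_of_int m)\<^sup>2)"
proof -
  define x y where "x = Re u" and "y = Im u"
  have "x\<^sup>2 + y\<^sup>2 = (norm u)\<^sup>2" by (simp add: x_def y_def cmod_power2)
  also have "\<dots> \<le> R\<^sup>2" using assms by (intro power_mono) auto
  finally have R: "x\<^sup>2 + y\<^sup>2 \<le> R\<^sup>2" .
  have "(real_of_int m)\<^sup>2 \<le> 2 * (x + m)\<^sup>2 + 2 * x\<^sup>2"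
  proof -
    have "2 * (x + m)\<^sup>2 + 2 * x\<^sup>2 - (real_of_int m)\<^sup>2 = (2 * x + m)\<^sup>2" by (simp add: power2_eq_square algebra_simps)
    then show ?thesis by (metis diff_ge_0_iff_ge zero_le_power2)
  qed
  then have "y\<^sup>2 - (x + m)\<^sup>2 \<le> R\<^sup>2 - (real_of_int m)\<^sup>2 / 2" using R by linarith
  then have "pi * a * (y\<^sup>2 - (x + m)\<^sup>2) \<le> pi * a * (R\<^sup>2 - (real_of_int m)\<^sup>2 / 2)"
    using assms by (intro mult_left_mono) auto
  moreover have "norm (gauss a (u + of_int m)) = exp (pi * a * (y\<^sup>2 - (x + m)\<^sup>2))"
    by (simp add: gauss_def x_def y_def power2_eq_square algebra_simps)
  moreover have "exp (pi * a * R\<^sup>2) * exp (- (pi * a / 2) * (real_of_int m)\<^sup>2) = exp (pi * a * (R\<^sup>2 - (real_of_int m)\<^sup>2 / 2))"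
    by (simp add: exp_add[symmetric] algebra_simps)
  ultimately show ?thesis by simp
qed

lemma summable_exp_square: assumes "c > 0" shows "summable (\<lambda>n. exp (- c * (real n)\<^sup>2))"
proof (rule summable_comparison_test')
  have "norm (exp (- c)) < 1" using assms by simp
  then show "summable (\<lambda>n. exp (- c) ^ n)" by (rule summable_geometric)
  fix n :: nat
  have "n \<le> n\<^sup>2" by (cases n) (auto simp: power2_eq_square)
  then have "real n \<le> (real n)\<^sup>2" by (metis of_nat_le_iff of_nat_power)
  then have "exp (- c * (real n)\<^sup>2) \<le> exp (real n * (- c))" using assms by simp
  then show "norm (exp (- c * (real n)\<^sup>2)) \<le> exp (- c) ^ n" by (simp only: exp_of_nat_mult) simp
qed

lemma gauss_pair_bound:
  assumes "a > 0" "norm u \<le> R" shows "norm (gauss_pair a n u) \<le> 2 * exp (pi * a * R\<^sup>2) * exp (- (pi * a / 2) * (real n)\<^sup>2)"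
proof (cases "n = 0")
  case True
  then show ?thesis using norm_gauss_le[OF assms, of 0] exp_gt_zero[of "pi * a * R\<^sup>2"]
    by (simp add: gauss_pair_def del: exp_gt_zero)
next
  case False
  have "norm (gauss_pair a n u) \<le> norm (gauss a (u + of_nat n)) + norm (gauss a (u - of_nat n))"
    using False by (simp add: gauss_pair_def norm_triangle_ineq)
  then show ?thesis using norm_gauss_le[OF assms, of "int n"] norm_gauss_le[OF assms, of "- int n"] by simp
qed

lemma summable_gauss_pair: assumes "a > 0" shows "summable (\<lambda>n. gauss_pair a n u)"
proof (rule summable_comparison_test')
  show "summable (\<lambda>n. 2 * exp (pi * a * (norm u)\<^sup>2) * exp (- (pi * a / 2) * (real n)\<^sup>2))"
    using summable_exp_square[of "pi * a / 2"] assms by (intro summable_mult) auto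
  show "norm (gauss_pair a n u) \<le> 2 * exp (pi * a * (norm u)\<^sup>2) * exp (- (pi * a / 2) * (real n)\<^sup>2)" for n
    by (rule gauss_pair_bound[OF assms]) simp
qed

lemma uniform_limit_periodized_gauss:
  assumes "a > 0" shows "uniform_limit (cball 0 R) (\<lambda>N u. \<Sum>n<N. gauss_pair a n u) (periodized_gauss a) sequentially"
  unfolding periodized_gauss_def
proof (rule Weierstrass_m_test)
  show "norm (gauss_pair a n u) \<le> 2 * exp (pi * a * R\<^sup>2) * exp (- (pi * a / 2) * (real n)\<^sup>2)" if "u \<in> cball 0 R" for n u
    by (rule gauss_pair_bound[OF assms]) (use that in simp)
  show "summable (\<lambda>n. 2 * exp (pi * a * R\<^sup>2) * exp (- (pi * a / 2) * (real n)\<^sup>2))"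
    using summable_exp_square[of "pi * a / 2"] assms by (intro summable_mult) auto
qed

lemma holomorphic_periodized_gauss: assumes "a > 0" shows "periodized_gauss a holomorphic_on UNIV"
proof (rule holomorphic_uniform_sequence)
  show "(\<lambda>u. \<Sum>n<N. gauss_pair a n u) holomorphic_on UNIV" for N
    by (intro holomorphic_intros holomorphic_gauss_pair)
  show "\<exists>d>0. cball u d \<subseteq> UNIV \<and> uniform_limit (cball u d) (\<lambda>N u. \<Sum>n<N. gauss_pair a n u) (periodized_gauss a) sequentially" for u
  proof (intro exI[of _ 1] conjI)
    have "cball u 1 \<subseteq> cball 0 (norm u + 1)"
      by (auto simp: dist_norm) (metis add.commute norm_minus_commute norm_triangle_sub order_trans add_left_mono)
    then show "uniform_limit (cball u 1) (\<lambda>N u. \<Sum>n<N. gauss_pair a n u) (periodized_gauss a) sequentially"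
      by (rule uniform_limit_on_subset[OF uniform_limit_periodized_gauss[OF assms]])
  qed auto
qed auto

text \<open>Moving by 1 shifts the symmetric window of summation, so only two edge terms change;
  these tend to 0, which yields periodicity.\<close>

lemma gauss_pair_partial_sum_shift:
  "(\<Sum>n<Suc N. gauss_pair a n (u + 1)) = (\<Sum>n<Suc N. gauss_pair a n u) + gauss a (u + of_nat (Suc N)) - gauss a (u - of_nat N)"
proof (induction N)
  case (Suc N)
  have "(\<Sum>n<Suc (Suc N). gauss_pair a n (u + 1)) = (\<Sum>n<Suc N. gauss_pair a n (u + 1)) + gauss_pair a (Suc N) (u + 1)" by simp
  also have "\<dots> = (\<Sum>n<Suc N. gauss_pair a n u) + gauss a (u + of_nat (Suc N)) - gauss a (u - of_nat N) + gauss_pair a (Suc N) (u + 1)"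
    unfolding Suc.IH ..
  also have "gauss_pair a (Suc N) (u + 1) = gauss a (u + of_nat (Suc (Suc N))) + gauss a (u - of_nat N)"
    by (simp add: gauss_pair_def algebra_simps)
  also have "(\<Sum>n<Suc N. gauss_pair a n u) + gauss a (u + of_nat (Suc N)) - gauss a (u - of_nat N) + (gauss a (u + of_nat (Suc (Suc N))) + gauss a (u - of_nat N))
    = ((\<Sum>n<Suc N. gauss_pair a n u) + (gauss a (u + of_nat (Suc N)) + gauss a (u - of_nat (Suc N)))) + gauss a (u + of_nat (Suc (Suc N))) - gauss a (u - of_nat (Suc N))"
    by (simp only: algebra_simps)
  also have "gauss a (u + of_nat (Suc N)) + gauss a (u - of_nat (Suc N)) = gauss_pair a (Suc N) u"
    by (simp add: gauss_pair_def)
  finally show ?case by simp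
qed (simp add: gauss_pair_def)

lemma gauss_shift_tendsto_0:
  assumes "a > 0" shows "(\<lambda>n. gauss a (u + of_nat n)) \<longlonglongrightarrow> 0" "(\<lambda>n. gauss a (u - of_nat n)) \<longlonglongrightarrow> 0"
proof -
  have "summable (\<lambda>n. exp (pi * a * (norm u)\<^sup>2) * exp (- (pi * a / 2) * (real n)\<^sup>2))"
    using summable_exp_square[of "pi * a / 2"] assms by (intro summable_mult) auto
  then have lim: "(\<lambda>n. exp (pi * a * (norm u)\<^sup>2) * exp (- (pi * a / 2) * (real n)\<^sup>2)) \<longlonglongrightarrow> 0"
    by (rule summable_LIMSEQ_zero)
  show "(\<lambda>n. gauss a (u + of_nat n)) \<longlonglongrightarrow> 0"
    by (rule Lim_null_comparison[OF _ lim])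
       (use norm_gauss_le[OF assms order_refl, of u "int n" for n] in \<open>simp add: always_eventually\<close>)
  show "(\<lambda>n. gauss a (u - of_nat n)) \<longlonglongrightarrow> 0"
    by (rule Lim_null_comparison[OF _ lim])
       (use norm_gauss_le[OF assms order_refl, of u "- int n" for n] in \<open>simp add: always_eventually\<close>)
qed

lemma periodized_gauss_periodic: assumes "a > 0" shows "periodized_gauss a (u + 1) = periodized_gauss a u"
proof -
  have s: "(\<lambda>N. \<Sum>n<Suc N. gauss_pair a n v) \<longlonglongrightarrow> periodized_gauss a v" for v
    using summable_LIMSEQ[OF summable_gauss_pair[OF assms]] unfolding periodized_gauss_def by (rule LIMSEQ_Suc)
  have "(\<lambda>N. (\<Sum>n<Suc N. gauss_pair a n u) + gauss a (u + of_nat (Suc N)) - gauss a (u - of_nat N)) \<longlonglongrightarrow> periodized_gauss a u + 0 - 0"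
    by (intro tendsto_intros s gauss_shift_tendsto_0[OF assms] LIMSEQ_Suc[OF gauss_shift_tendsto_0(1)[OF assms]])
  then have "(\<lambda>N. \<Sum>n<Suc N. gauss_pair a n (u + 1)) \<longlonglongrightarrow> periodized_gauss a u"
    unfolding gauss_pair_partial_sum_shift by simp
  then show ?thesis using LIMSEQ_unique[OF s] by blast
qed

lemma exp_2pi_int: "exp (2 * of_real pi * \<i> * of_int n) = (1::complex)"
  using exp_integer_2pi[of "of_int n :: real"] by (simp add: mult_ac)

definition expi :: "int \<Rightarrow> complex \<Rightarrow> complex" where
  "expi n u = exp (2 * of_real pi * \<i> * of_int n * u)"

text \<open>Completing the square, the translation by \<open>i n / a\<close> multiplies a Gaussian
  by \<open>exp (\<pi> n^2 / a)\<close> and a character. The character has period 1, so the factor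
  is common to all terms of the sum.\<close>

lemma periodized_gauss_quasi_shift:
  assumes "a > 0"
  shows "periodized_gauss a (u + \<i> * of_real (of_int n / a)) = of_real (exp (pi * (of_int n)\<^sup>2 / a)) * expi (- n) u * periodized_gauss a u"
proof -
  define C where "C = of_real (exp (pi * (of_int n)\<^sup>2 / a)) * expi (- n) u"
  have g: "gauss a (u + \<i> * of_real (of_int n / a) + of_int m) = C * gauss a (u + of_int m)" for m
  proof -
    have e: "expi (- n) u = expi (- n) (u + of_int m)"
    proof -
      have "expi (- n) (u + of_int m) = expi (- n) u * exp (2 * of_real pi * \<i> * of_int (- n * m))"
        unfolding expi_def exp_add[symmetric] by (simp add: algebra_simps)
      moreover have "exp (2 * of_real pi * \<i> * of_int (- n * m)) = 1"
        by (rule exp_2pi_int)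
      ultimately show ?thesis by simp
    qed
    have "gauss a (v + \<i> * of_real (of_int n / a)) = of_real (exp (pi * (of_int n)\<^sup>2 / a)) * expi (- n) v * gauss a v" for v
    proof -
      define P \<alpha> b where "P = complex_of_real pi" and "\<alpha> = complex_of_real a" and "b = complex_of_real (of_int n / a)"
      have n: "complex_of_int (- n) = - (\<alpha> * b)" using assms by (simp add: \<alpha>_def b_def)
      have q: "complex_of_real (pi * (of_int n)\<^sup>2 / a) = P * (\<alpha> * b) * b"
        using assms by (simp add: P_def \<alpha>_def b_def power2_eq_square)
      have pa: "complex_of_real (pi * a) = P * \<alpha>" by (simp add: P_def \<alpha>_def)
      show ?thesis
        unfolding gauss_def expi_def exp_of_real[symmetric] exp_add[symmetric] n q pa P_def[symmetric] b_def[symmetric]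
        by (rule arg_cong[where f = exp]) (simp add: power2_eq_square algebra_simps)
    qed
    from this[of "u + of_int m"] show ?thesis unfolding C_def e by (simp add: add_ac)
  qed
  have "gauss_pair a k (u + \<i> * of_real (of_int n / a)) = C * gauss_pair a k u" for k
    using g[of 0] g[of "int k"] g[of "- int k"] by (auto simp: gauss_pair_def distrib_left)
  then show ?thesis unfolding periodized_gauss_def C_def[symmetric]
    by (simp add: suminf_mult[OF summable_gauss_pair[OF assms]])
qed

section \<open>Fourier series of periodic entire functions\<close>

lemma norm_expi_real: "norm (expi n (of_real x)) = 1"
proof -
  have "expi n (of_real x) = exp (\<i> * of_real (2 * pi * of_int n * x))" by (simp add: expi_def mult_ac)
  then show ?thesis by (simp only: norm_exp_i_times)
qed

lemma holomorphic_expi [holomorphic_intros]: "expi n holomorphic_on S"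
  unfolding expi_def by (intro holomorphic_intros)

lemma expi_mult: "expi m u * expi n u = expi (m + n) u"
  by (simp add: expi_def exp_add[symmetric] algebra_simps)

lemma expi_has_derivative: "(expi n has_field_derivative 2 * of_real pi * \<i> * of_int n * expi n u) (at u)"
  unfolding expi_def by (auto intro!: derivative_eq_intros)

lemma expi_half: "expi n (1 / 2) = expi n (- 1 / 2)"
proof -
  have "expi n (1 / 2) = expi n (- 1 / 2) * exp (2 * of_real pi * \<i> * of_int n)"
    unfolding expi_def exp_add[symmetric] by (simp add: algebra_simps)
  moreover have "exp (2 * of_real pi * \<i> * of_int n) = 1" by (rule exp_2pi_int)
  ultimately show ?thesis by simp
qed

text \<open>The period is centred at 0 so that it contains exactly one zero of
  \<open>expi 1 u - 1\<close>, away from the endpoints.\<close>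

abbreviation unit_path :: "real \<Rightarrow> complex" where "unit_path \<equiv> linepath (- 1 / 2) (1 / 2)"

lemma path_image_unit: "u \<in> path_image unit_path \<Longrightarrow> \<exists>x. u = of_real x \<and> \<bar>x\<bar> \<le> 1 / 2"
proof -
  assume "u \<in> path_image unit_path"
  then obtain t where t: "0 \<le> t" "t \<le> 1" "u = (1 - t) *\<^sub>R (- 1 / 2) + t *\<^sub>R (1 / 2)"
    by (auto simp: in_segment)
  then have "u = of_real (t - 1 / 2)" by (simp add: scaleR_conv_of_real field_simps)
  moreover have "\<bar>t - 1 / 2\<bar> \<le> 1 / 2" using t by linarith
  ultimately show ?thesis by blast
qed

lemma contour_integral_expi: "contour_integral unit_path (expi n) = (if n = 0 then 1 else 0)"
proof (cases "n = 0")
  case True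
  have "expi 0 = (\<lambda>u. 1)" by (auto simp: expi_def)
  then show ?thesis using True contour_integral_unique[OF has_contour_integral_const_linepath[of 1 "- 1 / 2" "1 / 2"]] by simp
next
  case False
  have "((expi n) has_contour_integral (expi n (1/2) / (2 * of_real pi * \<i> * of_int n) - expi n (-1/2) / (2 * of_real pi * \<i> * of_int n))) unit_path"
    using contour_integral_primitive[of UNIV "\<lambda>u. expi n u / (2 * of_real pi * \<i> * of_int n)" "expi n" unit_path]
      DERIV_cdivide[OF expi_has_derivative[of n], of "2 * of_real pi * \<i> * of_int n"] False by simp
  then show ?thesis using contour_integral_unique False expi_half by fastforce
qed

text \<open>Integration by parts: equal values at the two ends cancel the boundary terms, and the
  derivative of \<open>expi n\<close> supplies the factor \<open>1 / n\<close>.\<close>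

lemma fourier_coeff_tendsto_0:
  fixes g :: "complex \<Rightarrow> complex"
  assumes "open S" "g holomorphic_on S" "path_image unit_path \<subseteq> S" "g (1 / 2) = g (- 1 / 2)"
  obtains B where "\<And>n. n \<noteq> 0 \<Longrightarrow> norm (contour_integral unit_path (\<lambda>u. g u * expi n u)) \<le> B / \<bar>of_int n\<bar>"
proof -
  have dg: "deriv g holomorphic_on S" using assms by (intro holomorphic_deriv)
  have "compact (path_image unit_path)" by (intro compact_path_image) auto
  then have "bounded (deriv g ` path_image unit_path)"
    using holomorphic_on_imp_continuous_on[OF dg] assms(3) by (intro compact_imp_bounded compact_continuous_image) (auto intro: continuous_on_subset)
  then obtain B where B: "B > 0" "\<And>u. u \<in> path_image unit_path \<Longrightarrow> norm (deriv g u) \<le> B"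
    by (metis bounded_pos imageI)
  show ?thesis
  proof (rule that[of "B / (2 * pi)"])
    fix n :: int assume n: "n \<noteq> 0"
    define c where "c = 2 * of_real pi * \<i> * of_int n"
    have c: "c \<noteq> 0" "norm c = 2 * pi * \<bar>of_int n\<bar>" using n by (auto simp: c_def norm_mult)
    have hd: "((\<lambda>u. g u * expi n u) has_field_derivative deriv g u * expi n u + c * (g u * expi n u)) (at u within S)" if "u \<in> S" for u
      unfolding c_def using that assms(1,2)
      by (auto intro!: derivative_eq_intros holomorphic_derivI has_field_derivative_at_within[OF expi_has_derivative])
    have "((\<lambda>u. deriv g u * expi n u + c * (g u * expi n u)) has_contour_integral (g (1/2) * expi n (1/2) - g (-1/2) * expi n (-1/2))) unit_path"
      using contour_integral_primitive[OF hd, of unit_path] assms(3) by simp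
    then have z: "contour_integral unit_path (\<lambda>u. deriv g u * expi n u + c * (g u * expi n u)) = 0"
      using assms(4) expi_half contour_integral_unique by fastforce
    have i1: "(\<lambda>u. deriv g u * expi n u) contour_integrable_on unit_path"
      and i2: "(\<lambda>u. g u * expi n u) contour_integrable_on unit_path"
      using assms dg by (intro contour_integrable_continuous_linepath continuous_on_subset[OF holomorphic_on_imp_continuous_on, of _ S] holomorphic_intros; force)+
    have "contour_integral unit_path (\<lambda>u. deriv g u * expi n u) + c * contour_integral unit_path (\<lambda>u. g u * expi n u) = 0"
      using z i1 i2 by (simp add: contour_integral_add contour_integral_lmul contour_integrable_lmul)
    then have "contour_integral unit_path (\<lambda>u. g u * expi n u) = - contour_integral unit_path (\<lambda>u. deriv g u * expi n u) / c"
      using c by (simp add: field_simps eq_neg_iff_add_eq_0 add.commute)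
    moreover have "norm (contour_integral unit_path (\<lambda>u. deriv g u * expi n u)) \<le> B * norm (1 / 2 - (- 1 / 2) :: complex)"
    proof (rule contour_integral_bound_linepath[OF i1])
      show "norm (deriv g u * expi n u) \<le> B" if "u \<in> closed_segment (- 1 / 2) (1 / 2)" for u
        using B(2)[of u] path_image_unit[of u] norm_expi_real[of n] that by (auto simp: norm_mult)
    qed (use B in auto)
    moreover have "norm (1 / 2 - (- 1 / 2) :: complex) = 1" by simp
    ultimately have "norm (contour_integral unit_path (\<lambda>u. g u * expi n u)) \<le> B / norm c"
      by (simp only: norm_divide norm_minus_cancel) (simp add: divide_right_mono)
    then show "norm (contour_integral unit_path (\<lambda>u. g u * expi n u)) \<le> B / (2 * pi) / \<bar>of_int n\<bar>"
      unfolding c(2) by simp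
  qed
qed

text \<open>Chernoff's argument: dividing \<open>f - f 0\<close> by \<open>e(u) - 1\<close> makes the partial sums of the Fourier series telescope.\<close>
lemma fourier_series_at_0:
  fixes f :: "complex \<Rightarrow> complex"
  assumes f: "f holomorphic_on UNIV" "\<And>u. f (u + 1) = f u"
  shows "(\<lambda>N. \<Sum>n\<in>{- int N..int N}. contour_integral unit_path (\<lambda>u. f u * expi (- n) u)) \<longlonglongrightarrow> f 0"
proof -
  define k where "k u = (if u = 0 then deriv f 0 else (f u - f 0) / (u - 0))" for u
  define l where "l u = (if u = 0 then deriv (expi 1) 0 else (expi 1 u - expi 1 0) / (u - 0))" for u
  have hk: "k holomorphic_on UNIV" unfolding k_def[abs_def] using f by (intro pole_lemma) auto
  have hl: "l holomorphic_on UNIV" unfolding l_def[abs_def] by (intro pole_lemma holomorphic_intros) auto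
  \<comment> \<open>The zeros of \<open>expi 1 u - 1\<close> are the integers, so 0 is the only one
    in this strip; the difference quotients \<open>k\<close> and \<open>l\<close> remove the
    singularity of \<open>g\<close> there.\<close>
  define S where "S = {u :: complex. \<bar>Re u\<bar> < 1}"
  have oS: "open S" unfolding S_def by (intro open_Collect_less continuous_intros)
  have lS: "l u \<noteq> 0" if "u \<in> S" for u
  proof (cases "u = 0")
    case True
    then show ?thesis using DERIV_imp_deriv[OF expi_has_derivative[of 1 0]] by (simp add: l_def expi_def)
  next
    case False
    have "expi 1 u \<noteq> 1"
    proof
      assume "expi 1 u = 1"
      then obtain m :: int where m: "Im (2 * of_real pi * \<i> * u) = of_int (2 * m) * pi" "Re (2 * of_real pi * \<i> * u) = 0"
        unfolding expi_def using exp_eq_1[of "2 * of_real pi * \<i> * u"] by auto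
      then have "Re u = of_int m" "Im u = 0" by auto
      moreover from this have "m = 0" using that by (simp add: S_def)
      ultimately show False using False by (simp add: complex_eq_iff)
    qed
    then show ?thesis using False by (simp add: l_def expi_def)
  qed
  define g where "g u = k u / l u" for u
  have hg: "g holomorphic_on S" unfolding g_def
    using lS by (intro holomorphic_intros holomorphic_on_subset[OF hk] holomorphic_on_subset[OF hl]) auto
  have uS: "path_image unit_path \<subseteq> S" using path_image_unit by (force simp: S_def)
  have key: "f u - f 0 = g u * (expi 1 u - 1)" if "u \<in> S" for u
    using lS[OF that] by (auto simp: g_def k_def l_def expi_def)
  have gp: "g (1 / 2) = g (- 1 / 2)"
  proof -
    have "f (1 / 2) = f (- 1 / 2)" using f(2)[of "- 1 / 2"] by simp
    moreover have h: "expi 1 (1 / 2) = - 1" by (simp add: expi_def mult.commute)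
    moreover have "expi 1 (- 1 / 2) = - 1" using expi_half[of 1] h by metis
    ultimately show ?thesis using key[of "1 / 2"] key[of "- 1 / 2"] by (simp add: S_def)
  qed
  define G where "G n = contour_integral unit_path (\<lambda>u. g u * expi n u)" for n
  have int: "(\<lambda>u. g u * expi n u) contour_integrable_on unit_path" "expi n contour_integrable_on unit_path" for n
    using hg uS by (intro contour_integrable_continuous_linepath continuous_on_subset[OF holomorphic_on_imp_continuous_on, of _ S] holomorphic_intros; force)+
  define ci where "ci n = contour_integral unit_path (\<lambda>u. f u * expi (- n) u)" for n
  have c: "ci n = f 0 * (if n = 0 then 1 else 0) + G (1 - n) - G (- n)" for n
  proof -
    have "contour_integral unit_path (\<lambda>u. f u * expi (- n) u)
        = contour_integral unit_path (\<lambda>u. f 0 * expi (- n) u + g u * expi (1 - n) u - g u * expi (- n) u)"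
    proof (rule contour_integral_eq)
      fix u assume "u \<in> path_image unit_path"
      then have "f u = f 0 + g u * (expi 1 u - 1)" using key uS by (metis add_diff_cancel_left' diff_add_cancel add.commute subsetD)
      then show "f u * expi (- n) u = f 0 * expi (- n) u + g u * expi (1 - n) u - g u * expi (- n) u"
        using expi_mult[of 1 u "- n"] by (simp add: distrib_right left_diff_distrib right_diff_distrib mult.assoc)
    qed
    also have "\<dots> = f 0 * contour_integral unit_path (expi (- n)) + G (1 - n) - G (- n)"
      unfolding G_def using int by (simp add: contour_integral_add contour_integral_diff contour_integral_lmul contour_integrable_lmul contour_integrable_add)
    finally show ?thesis unfolding contour_integral_expi ci_def by simp
  qed
  have sum: "(\<Sum>n\<in>{- int N..int N}. ci n) = f 0 + G (int N + 1) - G (- int N)" for N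
  proof (induction N)
    case 0 then show ?case using c[of 0] by simp
  next
    case (Suc N)
    have "{- int (Suc N)..int (Suc N)} = insert (int (Suc N)) (insert (- int (Suc N)) {- int N..int N})" by auto
    then have "(\<Sum>n\<in>{- int (Suc N)..int (Suc N)}. ci n)
       = ci (int (Suc N)) + (ci (- int (Suc N)) + (f 0 + G (int N + 1) - G (- int N)))"
      by (simp add: Suc.IH)
    then show ?case unfolding c by (simp add: algebra_simps)
  qed
  obtain B where B: "\<And>n. n \<noteq> 0 \<Longrightarrow> norm (G n) \<le> B / \<bar>of_int n\<bar>"
    using fourier_coeff_tendsto_0[OF oS hg uS gp] unfolding G_def by metis
  have l1: "(\<lambda>N. B / real N) \<longlonglongrightarrow> 0" by (rule lim_const_over_n)
  have "(\<lambda>N. G (- int N)) \<longlonglongrightarrow> 0"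
    by (rule Lim_null_comparison[OF _ l1], rule eventually_mono[OF eventually_gt_at_top[of 0]]) (use B[of "- int N" for N] in simp)
  moreover have "(\<lambda>N. G (int N)) \<longlonglongrightarrow> 0"
    by (rule Lim_null_comparison[OF _ l1], rule eventually_mono[OF eventually_gt_at_top[of 0]]) (use B[of "int N" for N] in simp)
  then have "(\<lambda>N. G (int N + 1)) \<longlonglongrightarrow> 0" by (drule_tac LIMSEQ_Suc) (simp add: add.commute)
  ultimately have "(\<lambda>N. f 0 + G (int N + 1) - G (- int N)) \<longlonglongrightarrow> f 0 + 0 - 0" by (intro tendsto_intros)
  then show ?thesis unfolding sum ci_def[symmetric] by simp
qed

section \<open>Fourier coefficients of the periodized Gaussian\<close>

lemma gaussian_integral_limit:
  assumes "a > 0" shows "(\<lambda>N. integral {- real N - 1 / 2..real N + 1 / 2} (\<lambda>x. exp (- pi * a * x\<^sup>2))) \<longlonglongrightarrow> 1 / sqrt a"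
proof -
  \<comment> \<open>The standard deviation for which \<open>exp (- \<pi> a x^2)\<close> is a
    multiple of the normal density.\<close>
  define \<sigma> where "\<sigma> = 1 / sqrt (2 * pi * a)"
  have s: "\<sigma> > 0" "2 * \<sigma>\<^sup>2 = 1 / (pi * a)" using assms by (auto simp: \<sigma>_def power_divide)
  have d: "normal_density 0 \<sigma> x = sqrt a * exp (- pi * a * x\<^sup>2)" for x
  proof -
    have "sqrt (2 * pi * \<sigma>\<^sup>2) = 1 / sqrt a" using assms by (simp add: \<sigma>_def power_divide real_sqrt_divide)
    moreover have "- (x - 0)\<^sup>2 / (2 * \<sigma>\<^sup>2) = - pi * a * x\<^sup>2" unfolding s(2) by simp
    ultimately show ?thesis unfolding normal_density_def by simp
  qed
  have hb: "has_bochner_integral lborel (\<lambda>x. exp (- pi * a * x\<^sup>2)) (1 / sqrt a)"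
  proof -
    have "has_bochner_integral lborel (normal_density 0 \<sigma>) 1" using integral_normal_density[OF s(1)] integrable_normal_density[OF s(1)]
      by (simp add: has_bochner_integral_iff)
    then have "has_bochner_integral lborel (\<lambda>x. (1 / sqrt a) * normal_density 0 \<sigma> x) ((1 / sqrt a) * 1)"
      by (intro has_bochner_integral_mult_right) auto
    then show ?thesis using assms by (simp add: d)
  qed
  then have int: "integrable lborel (\<lambda>x. exp (- pi * a * x\<^sup>2))" and val: "integral\<^sup>L lborel (\<lambda>x. exp (- pi * a * x\<^sup>2)) = 1 / sqrt a"
    by (auto simp: has_bochner_integral_iff)
  have "(\<lambda>N. LINT x|lborel. indicator {- real N - 1 / 2..real N + 1 / 2} x *\<^sub>R exp (- pi * a * x\<^sup>2)) \<longlonglongrightarrow> (LINT x|lborel. exp (- pi * a * x\<^sup>2))"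
  proof (rule integral_dominated_convergence[OF _ _ int])
    show "AE x in lborel. (\<lambda>N. indicator {- real N - 1 / 2..real N + 1 / 2} x *\<^sub>R exp (- pi * a * x\<^sup>2)) \<longlonglongrightarrow> exp (- pi * a * x\<^sup>2)"
    proof (rule AE_I2, rule tendsto_eventually)
      fix x :: real
      have "eventually (\<lambda>N. real N > \<bar>x\<bar>) sequentially"
        by (rule eventually_compose_filterlim[OF eventually_gt_at_top filterlim_real_sequentially])
      then show "eventually (\<lambda>N. indicator {- real N - 1 / 2..real N + 1 / 2} x *\<^sub>R exp (- pi * a * x\<^sup>2) = exp (- pi * a * x\<^sup>2)) sequentially"
        by eventually_elim (auto simp: indicator_def)
    qed
  qed (auto simp: indicator_def)
  moreover have "(LINT x|lborel. indicator {- real N - 1 / 2..real N + 1 / 2} x *\<^sub>R exp (- pi * a * x\<^sup>2)) = integral {- real N - 1 / 2..real N + 1 / 2} (\<lambda>x. exp (- pi * a * x\<^sup>2))" for N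
  proof -
    have "set_integrable lborel {- real N - 1 / 2..real N + 1 / 2} (\<lambda>x. exp (- pi * a * x\<^sup>2))"
      unfolding set_integrable_def by (rule integrable_mult_indicator[OF _ int]) auto
    from set_borel_integral_eq_integral(2)[OF this] show ?thesis by (simp add: set_lebesgue_integral_def)
  qed
  ultimately show ?thesis unfolding val by simp
qed

text \<open>Unfolding: over one period, the translates by \<open>- N, ..., N\<close> integrate to
  the Gaussian over \<open>[- N - 1/2, N + 1/2]\<close>, because the values of a primitive at shared
  endpoints cancel.\<close>

lemma periodized_gauss_integral:
  assumes "a > 0" shows "contour_integral unit_path (periodized_gauss a) = of_real (1 / sqrt a)"
proof -
  obtain \<Phi> where \<Phi>: "\<And>u. (\<Phi> has_field_derivative gauss a u) (at u)"
    using holomorphic_convex_primitive'[of UNIV "gauss a"] holomorphic_gauss[of "\<lambda>u. u" UNIV a] by auto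
  have prim: "((\<lambda>u. gauss a (u + c)) has_contour_integral \<Phi> (1 / 2 + c) - \<Phi> (- 1 / 2 + c)) unit_path" for c
    using contour_integral_primitive[of UNIV "\<lambda>u. \<Phi> (u + c)" "\<lambda>u. gauss a (u + c)" unit_path]
      DERIV_shift[of \<Phi> _ _ c] \<Phi> by auto
  have part: "((\<lambda>u. \<Sum>n<Suc N. gauss_pair a n u) has_contour_integral (\<Phi> (of_nat N + 1 / 2) - \<Phi> (- of_nat N - 1 / 2))) unit_path" for N
  proof (induction N)
    case 0
    then show ?case using prim[of 0] by (simp add: gauss_pair_def)
  next
    case (Suc N)
    have "((\<lambda>u. (\<Sum>n<Suc N. gauss_pair a n u) + (gauss a (u + of_nat (Suc N)) + gauss a (u + - of_nat (Suc N)))) has_contour_integral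
       (\<Phi> (of_nat N + 1 / 2) - \<Phi> (- of_nat N - 1 / 2)) + ((\<Phi> (1 / 2 + of_nat (Suc N)) - \<Phi> (- 1 / 2 + of_nat (Suc N)))
        + (\<Phi> (1 / 2 + - of_nat (Suc N)) - \<Phi> (- 1 / 2 + - of_nat (Suc N))))) unit_path"
      by (intro has_contour_integral_add Suc.IH prim)
    moreover have "1 / 2 + complex_of_nat (Suc N) = of_nat (Suc N) + 1 / 2" "- 1 / 2 + complex_of_nat (Suc N) = of_nat N + 1 / 2"
      "1 / 2 + - complex_of_nat (Suc N) = - of_nat N - 1 / 2" "- 1 / 2 + - complex_of_nat (Suc N) = - of_nat (Suc N) - 1 / 2"
      by simp_all
    moreover have "(\<lambda>u. \<Sum>n<Suc (Suc N). gauss_pair a n u) = (\<lambda>u. (\<Sum>n<Suc N. gauss_pair a n u) + (gauss a (u + of_nat (Suc N)) + gauss a (u + - of_nat (Suc N))))"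
      by (auto simp: gauss_pair_def diff_conv_add_uminus simp del: add_uminus_conv_diff of_nat_Suc)
    ultimately show ?case by (simp only:) (simp add: algebra_simps)
  qed
  have val: "\<Phi> (of_nat N + 1 / 2) - \<Phi> (- of_nat N - 1 / 2) = of_real (integral {- real N - 1 / 2..real N + 1 / 2} (\<lambda>x. exp (- pi * a * x\<^sup>2)))" for N
  proof -
    let ?f = "\<lambda>x. exp (- pi * a * x\<^sup>2)"
    have "(gauss a has_contour_integral (\<Phi> (of_nat N + 1 / 2) - \<Phi> (- of_nat N - 1 / 2))) (linepath (- of_nat N - 1 / 2) (of_nat N + 1 / 2))"
      using contour_integral_primitive[of UNIV \<Phi> "gauss a" "linepath (- of_nat N - 1 / 2) (of_nat N + 1 / 2)"] \<Phi> by auto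
    then have "((\<lambda>x. gauss a (of_real x)) has_integral (\<Phi> (of_nat N + 1 / 2) - \<Phi> (- of_nat N - 1 / 2))) {- real N - 1 / 2..real N + 1 / 2}"
      by (subst (asm) has_contour_integral_linepath_Reals_iff) auto
    moreover have "((\<lambda>x. gauss a (of_real x)) has_integral of_real (integral {- real N - 1 / 2..real N + 1 / 2} ?f)) {- real N - 1 / 2..real N + 1 / 2}"
    proof -
      have "(?f has_integral integral {- real N - 1 / 2..real N + 1 / 2} ?f) {- real N - 1 / 2..real N + 1 / 2}"
        by (intro integrable_integral integrable_continuous_interval continuous_intros)
      then have "((\<lambda>x. of_real (?f x) :: complex) has_integral of_real (integral {- real N - 1 / 2..real N + 1 / 2} ?f)) {- real N - 1 / 2..real N + 1 / 2}"
        by (rule has_integral_of_real)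
      then show ?thesis by (simp add: gauss_def exp_of_real[symmetric])
    qed
    ultimately show ?thesis by (rule has_integral_unique)
  qed
  have "(\<lambda>N. contour_integral unit_path (\<lambda>u. \<Sum>n<N. gauss_pair a n u)) \<longlonglongrightarrow> contour_integral unit_path (periodized_gauss a)"
  proof (rule contour_integral_uniform_limit(2)[of _ _ _ _ 1])
    have "path_image unit_path \<subseteq> cball 0 1" using path_image_unit by force
    then show "uniform_limit (path_image unit_path) (\<lambda>N u. \<Sum>n<N. gauss_pair a n u) (periodized_gauss a) sequentially"
      by (rule uniform_limit_on_subset[OF uniform_limit_periodized_gauss[OF assms]])
    show "\<forall>\<^sub>F N in sequentially. (\<lambda>u. \<Sum>n<N. gauss_pair a n u) contour_integrable_on unit_path"
      by (intro always_eventually allI contour_integrable_continuous_linepath holomorphic_on_imp_continuous_on holomorphic_intros holomorphic_gauss_pair)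
    show "norm (vector_derivative unit_path (at t)) \<le> 1" for t by simp
  qed auto
  then have "(\<lambda>N. contour_integral unit_path (\<lambda>u. \<Sum>n<Suc N. gauss_pair a n u)) \<longlonglongrightarrow> contour_integral unit_path (periodized_gauss a)"
    by (rule LIMSEQ_Suc)
  then have "(\<lambda>N. complex_of_real (integral {- real N - 1 / 2..real N + 1 / 2} (\<lambda>x. exp (- pi * a * x\<^sup>2)))) \<longlonglongrightarrow> contour_integral unit_path (periodized_gauss a)"
    unfolding contour_integral_unique[OF part] val .
  moreover have "(\<lambda>N. complex_of_real (integral {- real N - 1 / 2..real N + 1 / 2} (\<lambda>x. exp (- pi * a * x\<^sup>2)))) \<longlonglongrightarrow> of_real (1 / sqrt a)"
    by (intro tendsto_of_real gaussian_integral_limit assms)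
  ultimately show ?thesis by (rule LIMSEQ_unique)
qed

text \<open>The integral over a translated period does not depend on the translation, even a complex
  one, since its derivative is a difference of equal values. Translating by \<open>i n / a\<close>
  and using the quasi-period obtains the \<open>n\<close>-th coefficient from the zeroth.\<close>

lemma periodized_gauss_fourier:
  assumes "a > 0"
  shows "contour_integral unit_path (\<lambda>u. periodized_gauss a u * expi (- n) u) = of_real (exp (- pi * (of_int n)\<^sup>2 / a) / sqrt a)"
proof -
  let ?f = "periodized_gauss a"
  obtain F where F: "\<And>u. (F has_field_derivative ?f u) (at u)"
    using holomorphic_convex_primitive'[of UNIV ?f] holomorphic_periodized_gauss[OF assms] by auto
  have shift: "((\<lambda>u. ?f (u + c)) has_contour_integral F (1 / 2 + c) - F (- 1 / 2 + c)) unit_path" for c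
    using contour_integral_primitive[of UNIV "\<lambda>u. F (u + c)" "\<lambda>u. ?f (u + c)" unit_path]
      DERIV_shift[of F _ _ c] F by auto
  have "((\<lambda>c. F (1 / 2 + c) - F (- 1 / 2 + c)) has_field_derivative 0) (at c within UNIV)" for c
  proof -
    have "((\<lambda>c. F (1 / 2 + c)) has_field_derivative ?f (1 / 2 + c)) (at c)" "((\<lambda>c. F (- 1 / 2 + c)) has_field_derivative ?f (- 1 / 2 + c)) (at c)"
      using DERIV_chain2[OF F, of "\<lambda>c. 1 / 2 + c" 1 c UNIV] DERIV_chain2[OF F, of "\<lambda>c. - 1 / 2 + c" 1 c UNIV]
        DERIV_add[OF DERIV_const DERIV_ident, of "1 / 2" c UNIV] DERIV_add[OF DERIV_const DERIV_ident, of "- 1 / 2" c UNIV]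
      by simp_all
    from DERIV_diff[OF this] show ?thesis using periodized_gauss_periodic[OF assms, of "- 1 / 2 + c"] by (simp add: add.commute)
  qed
  then have "\<exists>k. \<forall>c\<in>UNIV. F (1 / 2 + c) - F (- 1 / 2 + c) = k"
    by (intro has_field_derivative_zero_constant) auto
  then have const: "F (1 / 2 + c) - F (- 1 / 2 + c) = F (1 / 2 + 0) - F (- 1 / 2 + 0)" for c by (metis UNIV_I)
  let ?c = "\<i> * of_real (of_int n / a)"
  let ?q = "of_real (exp (pi * (of_int n)\<^sup>2 / a)) :: complex"
  have "contour_integral unit_path (\<lambda>u. ?f (u + ?c)) = contour_integral unit_path ?f"
    using contour_integral_unique[OF shift] const[of ?c] contour_integral_unique[OF shift[of 0]] by simp
  also have "\<dots> = of_real (1 / sqrt a)" by (rule periodized_gauss_integral[OF assms])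
  finally have "contour_integral unit_path (\<lambda>u. ?q * (?f u * expi (- n) u)) = of_real (1 / sqrt a)"
    unfolding periodized_gauss_quasi_shift[OF assms] by (simp add: mult_ac)
  moreover have "(\<lambda>u. ?f u * expi (- n) u) contour_integrable_on unit_path"
    by (intro contour_integrable_continuous_linepath holomorphic_on_imp_continuous_on holomorphic_intros
        holomorphic_on_subset[OF holomorphic_periodized_gauss[OF assms]]) auto
  ultimately have "?q * contour_integral unit_path (\<lambda>u. ?f u * expi (- n) u) = of_real (1 / sqrt a)"
    by (simp add: contour_integral_lmul)
  moreover have "?q \<noteq> 0" by simp
  ultimately have "contour_integral unit_path (\<lambda>u. ?f u * expi (- n) u) = of_real (1 / sqrt a) / ?q"
    by (metis nonzero_mult_div_cancel_left)
  also have "\<dots> = of_real ((1 / sqrt a) / exp (pi * (of_int n)\<^sup>2 / a))" by simp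
  also have "(1 / sqrt a) / exp (pi * (of_int n)\<^sup>2 / a) = exp (- pi * (of_int n)\<^sup>2 / a) / sqrt a"
    by (simp add: exp_minus field_simps)
  finally show ?thesis .
qed

section \<open>The transformation of Jacobi's theta function\<close>

definition theta :: "real \<Rightarrow> real" where
  "theta x = 1 + 2 * (\<Sum>n. exp (- pi * (real (Suc n))\<^sup>2 * x))"

lemma summable_theta: "x > 0 \<Longrightarrow> summable (\<lambda>n. exp (- pi * (real (Suc n))\<^sup>2 * x))"
  using summable_exp_square[of "pi * x"] by (subst summable_Suc_iff[of "\<lambda>n. exp (- pi * (real n)\<^sup>2 * x)"]) (simp add: mult_ac)

text \<open>Poisson summation for the Gaussian: the value of the periodization at 0 is the sum of
  its Fourier coefficients.\<close>

lemma theta_transformation: assumes "x > 0" shows "theta x = theta (1 / x) / sqrt x"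
proof -
  have sums: "(\<lambda>N. \<Sum>n<N. exp (- pi * (real (Suc n))\<^sup>2 * y)) \<longlonglongrightarrow> (\<Sum>n. exp (- pi * (real (Suc n))\<^sup>2 * y))" if "y > 0" for y
    using summable_LIMSEQ[OF summable_theta[OF that]] .
  have f0: "periodized_gauss x 0 = of_real (theta x)"
  proof -
    have gp: "gauss_pair x (Suc n) 0 = of_real (2 * exp (- pi * (real (Suc n))\<^sup>2 * x))" for n
      by (simp add: gauss_pair_def gauss_def exp_of_real[symmetric] power2_eq_square algebra_simps)
    have "periodized_gauss x 0 = gauss_pair x 0 0 + (\<Sum>n. gauss_pair x (Suc n) 0)"
      unfolding periodized_gauss_def using suminf_split_head[OF summable_gauss_pair[OF assms]] by simp
    also have "(\<Sum>n. gauss_pair x (Suc n) 0) = of_real (\<Sum>n. 2 * exp (- pi * (real (Suc n))\<^sup>2 * x))"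
      unfolding gp using summable_theta[OF assms] by (intro suminf_of_real[symmetric] summable_mult)
    also have "(\<Sum>n. 2 * exp (- pi * (real (Suc n))\<^sup>2 * x)) = 2 * (\<Sum>n. exp (- pi * (real (Suc n))\<^sup>2 * x))"
      by (rule suminf_mult[OF summable_theta[OF assms]])
    finally show ?thesis by (simp add: theta_def gauss_pair_def gauss_def)
  qed
  have sum: "(\<Sum>n\<in>{- int N..int N}. exp (- pi * (of_int n)\<^sup>2 / x) / sqrt x) = (1 + 2 * (\<Sum>n<N. exp (- pi * (real (Suc n))\<^sup>2 * (1 / x)))) / sqrt x" for N
  proof (induction N)
    case (Suc N)
    have "{- int (Suc N)..int (Suc N)} = insert (int (Suc N)) (insert (- int (Suc N)) {- int N..int N})" by auto
    then have "(\<Sum>n\<in>{- int (Suc N)..int (Suc N)}. exp (- pi * (of_int n)\<^sup>2 / x) / sqrt x)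
       = exp (- pi * (of_int (int (Suc N)))\<^sup>2 / x) / sqrt x + (exp (- pi * (of_int (- int (Suc N)))\<^sup>2 / x) / sqrt x + (\<Sum>n\<in>{- int N..int N}. exp (- pi * (of_int n)\<^sup>2 / x) / sqrt x))"
      by simp
    also have "\<dots> = 2 * exp (- pi * (real (Suc N))\<^sup>2 * (1 / x)) / sqrt x + (\<Sum>n\<in>{- int N..int N}. exp (- pi * (of_int n)\<^sup>2 / x) / sqrt x)"
    proof -
      have "(of_int (int (Suc N)) :: real) = real (Suc N)" "(of_int (- int (Suc N)))\<^sup>2 = (real (Suc N))\<^sup>2" by (simp_all add: power2_eq_square algebra_simps)
      then show ?thesis by simp
    qed
    finally show ?case unfolding Suc.IH by (simp add: add_divide_distrib distrib_left)
  qed simp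
  have "(\<lambda>N. \<Sum>n\<in>{- int N..int N}. complex_of_real (exp (- pi * (of_int n)\<^sup>2 / x) / sqrt x)) \<longlonglongrightarrow> of_real (theta x)"
    using fourier_series_at_0[OF holomorphic_periodized_gauss[OF assms] periodized_gauss_periodic[OF assms]]
    unfolding periodized_gauss_fourier[OF assms] f0 .
  then have "(\<lambda>N. complex_of_real (\<Sum>n\<in>{- int N..int N}. exp (- pi * (of_int n)\<^sup>2 / x) / sqrt x)) \<longlonglongrightarrow> of_real (theta x)" by simp
  then have "(\<lambda>N. (1 + 2 * (\<Sum>n<N. exp (- pi * (real (Suc n))\<^sup>2 * (1 / x)))) / sqrt x) \<longlonglongrightarrow> theta x"
    unfolding sum tendsto_of_real_iff .
  moreover have "(\<lambda>N. (1 + 2 * (\<Sum>n<N. exp (- pi * (real (Suc n))\<^sup>2 * (1 / x)))) / sqrt x) \<longlonglongrightarrow> theta (1 / x) / sqrt x"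
    unfolding theta_def by (intro tendsto_intros sums) (use assms in auto)
  ultimately show ?thesis by (rule LIMSEQ_unique)
qed

subsection \<open>The kernel of the Xi function\<close>

text \<open>Up to the factor \<open>(- \<pi>)^p\<close>, the \<open>p\<close>-th derivative of the
  sum that occurs in \<open>theta\<close>.\<close>

definition theta_moment :: "nat \<Rightarrow> real \<Rightarrow> real" where
  "theta_moment p x = (\<Sum>n. ((real (Suc n))\<^sup>2) ^ p * exp (- pi * (real (Suc n))\<^sup>2 * x))"

lemma power_div_fact_le_exp:
  fixes y :: real assumes "y \<ge> 0" shows "y ^ k / fact k \<le> exp y"
proof -
  have "(\<Sum>n\<in>{k}. y ^ n /\<^sub>R fact n) \<le> (\<Sum>n. y ^ n /\<^sub>R fact n)"
    using assms by (intro sum_le_suminf summable_exp_generic) auto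
  then show ?thesis by (simp add: exp_def divide_inverse mult.commute)
qed

lemma summable_inverse_Suc_squares: "summable (\<lambda>n. 1 / (real (Suc n))\<^sup>2)"
  using inverse_squares_sums by (simp add: sums_iff add.commute)

lemma summable_theta_moment:
  assumes "x > 0" shows "summable (\<lambda>n. ((real (Suc n))\<^sup>2) ^ p * exp (- pi * (real (Suc n))\<^sup>2 * x))"
proof (rule summable_comparison_test')
  show "summable (\<lambda>n. fact (Suc p) / (pi * x) ^ Suc p * (1 / (real (Suc n))\<^sup>2))"
    by (intro summable_mult summable_inverse_Suc_squares)
  fix n :: nat
  define m where "m = (real (Suc n))\<^sup>2"
  have m: "m > 0" by (simp add: m_def)
  define y where "y = pi * x * m"
  have y: "y > 0" using m assms by (simp add: y_def)
  have "y ^ Suc p / fact (Suc p) \<le> exp y" using y by (intro power_div_fact_le_exp) simp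
  then have "exp (- y) \<le> fact (Suc p) / y ^ Suc p"
    using y by (simp add: exp_minus field_simps del: power_Suc fact_Suc)
  then have "m ^ p * exp (- y) \<le> m ^ p * (fact (Suc p) / y ^ Suc p)" using m by (intro mult_left_mono) auto
  also have "\<dots> = fact (Suc p) / (pi * x) ^ Suc p * (1 / m)"
    using m assms by (simp add: y_def power_mult_distrib field_simps del: fact_Suc)
  finally show "norm (((real (Suc n))\<^sup>2) ^ p * exp (- pi * (real (Suc n))\<^sup>2 * x)) \<le> fact (Suc p) / (pi * x) ^ Suc p * (1 / (real (Suc n))\<^sup>2)"
    using m unfolding y_def m_def[symmetric] by (simp add: mult_ac abs_mult del: fact_Suc power_Suc)
qed

lemma theta_moment_has_derivative:
  assumes "x > 0" shows "(theta_moment p has_real_derivative - pi * theta_moment (Suc p) x) (at x)"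
proof -
  define m where "m n = (real (Suc n))\<^sup>2" for n
  have m: "m n > 0" for n by (simp add: m_def)
  define f where "f n x = m n ^ p * exp (- pi * m n * x)" for n x
  define f' where "f' n x = - pi * (m n ^ Suc p * exp (- pi * m n * x))" for n x
  have d: "(f n has_field_derivative f' n x) (at x within {x0<..})" for n x x0
    unfolding f_def f'_def by (auto intro!: derivative_eq_intros)
  have uc: "uniformly_convergent_on {x/2<..} (\<lambda>n x. \<Sum>i<n. f' i x)"
  proof (rule Weierstrass_m_test')
    show "summable (\<lambda>n. pi * (m n ^ Suc p * exp (- pi * m n * (x / 2))))"
      unfolding m_def using summable_theta_moment[of "x / 2" "Suc p"] assms by (intro summable_mult) auto
    fix n y assume y: "y \<in> {x/2<..}"
    have "exp (- pi * m n * y) \<le> exp (- pi * m n * (x / 2))"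
      using m[of n] y by (simp add: mult_le_cancel_left)
    then have "pi * (m n ^ Suc p * exp (- pi * m n * y)) \<le> pi * (m n ^ Suc p * exp (- pi * m n * (x / 2)))"
      using m[of n] by (intro mult_left_mono) (auto intro: less_imp_le)
    then show "norm (f' n y) \<le> pi * (m n ^ Suc p * exp (- pi * m n * (x / 2)))"
      using m[of n] by (simp add: f'_def abs_mult)
  qed
  have s: "summable (\<lambda>n. f n x)" unfolding f_def m_def by (rule summable_theta_moment[OF assms])
  have "((\<lambda>x. \<Sum>n. f n x) has_field_derivative (\<Sum>n. f' n x)) (at x)"
    by (rule has_field_derivative_series'(2)[OF _ d uc _ s]) (use assms in \<open>auto simp: interior_open\<close>)
  moreover have "(\<lambda>x. \<Sum>n. f n x) = theta_moment p" by (simp add: f_def m_def theta_moment_def fun_eq_iff)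
  moreover have "(\<Sum>n. f' n x) = - pi * theta_moment (Suc p) x"
    unfolding f'_def theta_moment_def m_def using summable_theta_moment[OF assms, of "Suc p"] by (rule suminf_mult)
  ultimately show ?thesis by simp
qed

lemma theta_eq_moment: "theta x = 1 + 2 * theta_moment 0 x"
  by (simp add: theta_def theta_moment_def)

text \<open>\<open>2 K = 4 x\<^sup>2 \<theta>'' + 6 x \<theta>'\<close>: the operator corresponds to the factor \<open>s (s - 1)\<close> under the Mellin transform.\<close>
definition xi_kernel :: "real \<Rightarrow> real" where
  "xi_kernel x = 4 * pi\<^sup>2 * x\<^sup>2 * theta_moment 2 x - 6 * pi * x * theta_moment 1 x"

text \<open>The operator \<open>4 x^2 D^2 + 6 x D\<close> annihilates \<open>x^(- 1/2)\<close>.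
  Hence in the twice differentiated relation \<open>theta x = x^(- 1/2) theta (1 / x)\<close> the
  undifferentiated \<open>theta\<close> drops out, and what remains is the same operator at
  \<open>1 / x\<close>.\<close>

lemma xi_kernel_inverse:
  assumes "x > 0" shows "xi_kernel (1 / x) = sqrt x * xi_kernel x"
proof -
  define T1 where "T1 x = - 2 * pi * theta_moment 1 x" for x
  define T2 where "T2 x = 2 * pi\<^sup>2 * theta_moment 2 x" for x
  have d1: "(theta has_real_derivative T1 x) (at x)" if "x > 0" for x
    unfolding theta_eq_moment[abs_def] T1_def using that
    by (auto intro!: derivative_eq_intros theta_moment_has_derivative)
  have d2: "(T1 has_real_derivative T2 x) (at x)" if "x > 0" for x
  proof -
    have "((\<lambda>x. - 2 * pi * theta_moment 1 x) has_real_derivative (- 2 * pi) * (- pi * theta_moment (Suc 1) x)) (at x)"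
      by (intro DERIV_cmult theta_moment_has_derivative that)
    moreover have "(- 2 * pi) * (- pi * theta_moment (Suc 1) x) = T2 x" by (simp add: T2_def power2_eq_square numeral_2_eq_2)
    ultimately show ?thesis unfolding T1_def[abs_def] by simp
  qed
  \<comment> \<open>With \<open>r' = - r i / 2\<close> and \<open>i' = - i^2\<close> all derivatives
    stay polynomial in \<open>r\<close> and \<open>i\<close>, and the final comparison needs only
    \<open>x i = 1\<close>.\<close>
  define r where "r x = 1 / sqrt x" for x :: real
  define i where "i x = 1 / x" for x :: real
  have dr: "(r has_real_derivative - (1 / 2) * (r x * i x)) (at x)" if "x > 0" for x
  proof -
    have "(r has_real_derivative - (inverse (sqrt x) / 2) / (sqrt x * sqrt x)) (at x)"
      unfolding r_def using that by (auto intro!: derivative_eq_intros)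
    also have "- (inverse (sqrt x) / 2) / (sqrt x * sqrt x) = - (1 / 2) * (r x * i x)"
      using that by (simp add: r_def i_def inverse_eq_divide)
    finally show ?thesis .
  qed
  have di: "(i has_real_derivative - (i x)\<^sup>2) (at x)" if "x > 0" for x
    unfolding i_def using that by (auto intro!: derivative_eq_intros simp: power2_eq_square)
  have i0: "i x > 0" if "x > 0" for x using that by (simp add: i_def)
  have dc: "((\<lambda>x. f (i x)) has_real_derivative f' (i x) * - (i x)\<^sup>2) (at x)"
    if "x > 0" "\<And>y. y > 0 \<Longrightarrow> (f has_real_derivative f' y) (at y)" for f f' x
    by (rule DERIV_chain2[OF that(2)[OF i0[OF that(1)]] di[OF that(1)]])
  have e0: "theta x = r x * theta (i x)" if "x > 0" for x
    using theta_transformation[OF that] by (simp add: r_def i_def)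
  have e1: "T1 x = - (1 / 2) * (r x * i x * theta (i x)) - r x * (i x)\<^sup>2 * T1 (i x)" if "x > 0" for x
  proof (rule DERIV_unique[OF d1[OF that]])
    have "((\<lambda>x. r x * theta (i x)) has_real_derivative - (1 / 2) * (r x * i x) * theta (i x) + T1 (i x) * - (i x)\<^sup>2 * r x) (at x)"
      by (rule DERIV_mult[OF dr[OF that] dc[OF that d1]])
    also have "- (1 / 2) * (r x * i x) * theta (i x) + T1 (i x) * - (i x)\<^sup>2 * r x = - (1 / 2) * (r x * i x * theta (i x)) - r x * (i x)\<^sup>2 * T1 (i x)"
      by (simp add: algebra_simps)
    finally show "(theta has_real_derivative - (1 / 2) * (r x * i x * theta (i x)) - r x * (i x)\<^sup>2 * T1 (i x)) (at x)"
      by (rule has_field_derivative_transform_within_open[OF _ open_greaterThan[of 0]]) (use that in simp, rule e0[symmetric], simp)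
  qed
  have e2: "T2 x = 3 / 4 * (r x * (i x)\<^sup>2 * theta (i x)) + 3 * (r x * (i x) ^ 3 * T1 (i x)) + r x * (i x) ^ 4 * T2 (i x)" if "x > 0" for x
  proof (rule DERIV_unique[OF d2[OF that]])
    have "((\<lambda>x. - (1 / 2) * (r x * i x * theta (i x)) - r x * (i x)\<^sup>2 * T1 (i x)) has_real_derivative
        3 / 4 * (r x * (i x)\<^sup>2 * theta (i x)) + 3 * (r x * (i x) ^ 3 * T1 (i x)) + r x * (i x) ^ 4 * T2 (i x)) (at x)"
      by (rule derivative_eq_intros dr[OF that] di[OF that] dc[OF that d1] dc[OF that d2] refl | assumption)+
         (simp add: algebra_simps power2_eq_square power3_eq_cube power4_eq_xxxx)
    then show "(T1 has_real_derivative 3 / 4 * (r x * (i x)\<^sup>2 * theta (i x)) + 3 * (r x * (i x) ^ 3 * T1 (i x)) + r x * (i x) ^ 4 * T2 (i x)) (at x)"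
      by (rule has_field_derivative_transform_within_open[OF _ open_greaterThan[of 0]]) (use that in simp, rule e1[symmetric], simp)
  qed
  have K: "2 * xi_kernel x = 4 * x\<^sup>2 * T2 x + 6 * x * T1 x" for x
    by (simp add: xi_kernel_def T1_def T2_def power2_eq_square)
  define \<Theta> U V j \<rho> where "\<Theta> = theta (i x)" and "U = T1 (i x)" and "V = T2 (i x)" and "j = i x" and "\<rho> = r x"
  have xj: "x * j = 1" using assms by (simp add: j_def i_def)
  have s: "x * j\<^sup>2 = j" "x\<^sup>2 * j\<^sup>2 = 1" "x\<^sup>2 * j ^ 3 = j" "x\<^sup>2 * j ^ 4 = j\<^sup>2"
  proof -
    have "x * j\<^sup>2 = (x * j) * j" "x\<^sup>2 * j\<^sup>2 = (x * j) * (x * j)" "x\<^sup>2 * j ^ 3 = (x * j) * (x * j) * j" "x\<^sup>2 * j ^ 4 = (x * j) * (x * j) * (j * j)"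
      by (simp_all add: power2_eq_square power3_eq_cube power4_eq_xxxx)
    then show "x * j\<^sup>2 = j" "x\<^sup>2 * j\<^sup>2 = 1" "x\<^sup>2 * j ^ 3 = j" "x\<^sup>2 * j ^ 4 = j\<^sup>2"
      unfolding xj by (simp_all add: power2_eq_square)
  qed
  have "4 * x\<^sup>2 * T2 x + 6 * x * T1 x = 4 * x\<^sup>2 * (3 / 4 * (\<rho> * j\<^sup>2 * \<Theta>) + 3 * (\<rho> * j ^ 3 * U) + \<rho> * j ^ 4 * V)
      + 6 * x * (- (1 / 2) * (\<rho> * j * \<Theta>) - \<rho> * j\<^sup>2 * U)"
    unfolding e2[OF assms] e1[OF assms] \<Theta>_def U_def V_def j_def \<rho>_def ..
  also have "\<dots> = 3 * \<rho> * \<Theta> * (x\<^sup>2 * j\<^sup>2) + 12 * \<rho> * U * (x\<^sup>2 * j ^ 3) + 4 * \<rho> * V * (x\<^sup>2 * j ^ 4)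
      - 3 * \<rho> * \<Theta> * (x * j) - 6 * \<rho> * U * (x * j\<^sup>2)"
    by (simp add: algebra_simps)
  also have "\<dots> = \<rho> * (4 * j\<^sup>2 * V + 6 * j * U)" unfolding s xj by (simp add: algebra_simps)
  also have "\<dots> = r x * (4 * (1 / x)\<^sup>2 * T2 (1 / x) + 6 * (1 / x) * T1 (1 / x))"
    by (simp add: \<rho>_def j_def U_def V_def i_def)
  finally have "4 * x\<^sup>2 * T2 x + 6 * x * T1 x = r x * (4 * (1 / x)\<^sup>2 * T2 (1 / x) + 6 * (1 / x) * T1 (1 / x))" .
  then have "xi_kernel x = r x * xi_kernel (1 / x)" unfolding K[symmetric] by simp
  then show ?thesis using assms by (simp add: r_def)
qed

lemma xi_kernel_sums:
  assumes "x > 0"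
  shows "(\<lambda>n. (4 * pi\<^sup>2 * x\<^sup>2 * ((real (Suc n))\<^sup>2)\<^sup>2 - 6 * pi * x * (real (Suc n))\<^sup>2) * exp (- pi * (real (Suc n))\<^sup>2 * x)) sums xi_kernel x"
proof -
  have "(\<lambda>n. 4 * pi\<^sup>2 * x\<^sup>2 * (((real (Suc n))\<^sup>2) ^ 2 * exp (- pi * (real (Suc n))\<^sup>2 * x)) - 6 * pi * x * (((real (Suc n))\<^sup>2) ^ 1 * exp (- pi * (real (Suc n))\<^sup>2 * x))) sums xi_kernel x"
    unfolding xi_kernel_def theta_moment_def
    by (intro sums_diff sums_mult summable_sums summable_theta_moment assms)
  then show ?thesis by (simp add: algebra_simps)
qed

text \<open>With \<open>m = (n + 1)^2\<close> the coefficient of a term is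
  \<open>2 \<pi> m x (2 \<pi> m x - 3)\<close>, positive as soon as \<open>m x \<ge> 1\<close>. For
  small \<open>x\<close> single terms are negative, which is one reason to fold the integral onto
  \<open>[1, \<infinity>)\<close>.\<close>

lemma xi_kernel_pos: assumes "x \<ge> 1" shows "xi_kernel x > 0"
proof -
  let ?f = "\<lambda>n. (4 * pi\<^sup>2 * x\<^sup>2 * ((real (Suc n))\<^sup>2)\<^sup>2 - 6 * pi * x * (real (Suc n))\<^sup>2) * exp (- pi * (real (Suc n))\<^sup>2 * x)"
  have "?f n > 0" for n
  proof -
    define m where "m = (real (Suc n))\<^sup>2"
    have m: "m \<ge> 1" by (simp add: m_def)
    have "3 < 2 * pi * (m * x)"
    proof -
      have "1 * 1 \<le> m * x" using m assms by (intro mult_mono) auto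
      then have "2 * pi * 1 \<le> 2 * pi * (m * x)" by (intro mult_left_mono) auto
      then show ?thesis using pi_gt3 by linarith
    qed
    then have "0 < 2 * pi * x * m * (2 * pi * (m * x) - 3)" using m assms by (intro mult_pos_pos) auto
    also have "\<dots> = 4 * pi\<^sup>2 * x\<^sup>2 * m\<^sup>2 - 6 * pi * x * m" by (simp add: power2_eq_square algebra_simps)
    finally show ?thesis unfolding m_def by simp
  qed
  then have "0 < suminf ?f" using xi_kernel_sums[of x] assms by (intro suminf_pos) (auto simp: sums_iff)
  then show ?thesis using xi_kernel_sums[of x] assms by (simp add: sums_iff)
qed

lemma theta_moment_nonneg: "x > 0 \<Longrightarrow> theta_moment p x \<ge> 0"
  unfolding theta_moment_def by (intro suminf_nonneg summable_theta_moment) auto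

text \<open>From \<open>(\<pi> m - 1) (x - 1) \<ge> 0\<close> and \<open>\<pi> > 3\<close> one gets
  \<open>\<pi> m x \<ge> x + 2 m\<close>; this splits off \<open>exp (- x)\<close> and leaves the
  convergent constant \<open>theta_moment 2 (2 / pi)\<close>.\<close>

lemma xi_kernel_le:
  assumes "x \<ge> 1" shows "xi_kernel x \<le> 4 * pi\<^sup>2 * theta_moment 2 (2 / pi) * (x powr 2 / exp x)"
proof -
  have "theta_moment 2 x \<le> exp (- x) * theta_moment 2 (2 / pi)"
  proof -
    have s: "summable (\<lambda>n. ((real (Suc n))\<^sup>2) ^ 2 * exp (- pi * (real (Suc n))\<^sup>2 * (2 / pi)))" by (rule summable_theta_moment) simp
    have "theta_moment 2 x \<le> (\<Sum>n. exp (- x) * (((real (Suc n))\<^sup>2) ^ 2 * exp (- pi * (real (Suc n))\<^sup>2 * (2 / pi))))"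
      unfolding theta_moment_def
    proof (rule suminf_le[OF _ summable_theta_moment summable_mult[OF s]])
      fix n
      define m where "m = (real (Suc n))\<^sup>2"
      have m: "m \<ge> 1" by (simp add: m_def)
      have "0 \<le> (pi * m - 1) * (x - 1)"
        using m assms pi_gt3 mult_mono[of 1 pi 1 m] by (intro mult_nonneg_nonneg) auto
      moreover have "pi * m \<ge> 3 * m" using m pi_gt3 by (intro mult_right_mono) auto
      moreover have "(pi * m - 1) * (x - 1) = pi * m * x - pi * m - x + 1" by (simp add: algebra_simps)
      ultimately have "x + 2 * m \<le> pi * m * x" using m by linarith
      then have "exp (- pi * m * x) \<le> exp (- x) * exp (- pi * m * (2 / pi))"
        unfolding exp_add[symmetric] by simp
      then have "m ^ 2 * exp (- pi * m * x) \<le> m ^ 2 * (exp (- x) * exp (- pi * m * (2 / pi)))" by (intro mult_left_mono) auto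
      then show "((real (Suc n))\<^sup>2) ^ 2 * exp (- pi * (real (Suc n))\<^sup>2 * x) \<le> exp (- x) * (((real (Suc n))\<^sup>2) ^ 2 * exp (- pi * (real (Suc n))\<^sup>2 * (2 / pi)))"
        unfolding m_def by (simp add: mult_ac)
    qed (use assms in auto)
    also have "\<dots> = exp (- x) * theta_moment 2 (2 / pi)"
      unfolding theta_moment_def by (rule suminf_mult[OF s])
    finally show ?thesis .
  qed
  then have "4 * pi\<^sup>2 * x\<^sup>2 * theta_moment 2 x \<le> 4 * pi\<^sup>2 * x\<^sup>2 * (exp (- x) * theta_moment 2 (2 / pi))"
    by (intro mult_left_mono) auto
  moreover have "xi_kernel x \<le> 4 * pi\<^sup>2 * x\<^sup>2 * theta_moment 2 x"
    unfolding xi_kernel_def using theta_moment_nonneg[of x 1] assms by simp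
  moreover have "4 * pi\<^sup>2 * x\<^sup>2 * (exp (- x) * theta_moment 2 (2 / pi)) = 4 * pi\<^sup>2 * theta_moment 2 (2 / pi) * (x powr 2 / exp x)"
    using assms by (simp add: exp_minus divide_inverse mult_ac)
  ultimately show ?thesis by linarith
qed

lemma continuous_on_xi_kernel: "continuous_on {0<..} xi_kernel"
proof -
  have "continuous_on {0<..} (theta_moment p)" for p
    by (rule DERIV_continuous_on, rule has_field_derivative_at_within, rule theta_moment_has_derivative) simp
  then show ?thesis unfolding xi_kernel_def by (intro continuous_intros)
qed

section \<open>The Mellin transform of the kernel\<close>

lemma absolutely_integrable_suminf:
  fixes f :: "nat \<Rightarrow> real \<Rightarrow> complex"
  assumes f: "\<And>n. f n absolutely_integrable_on S" and S: "S \<in> sets lebesgue"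
    and sx: "\<And>x. x \<in> S \<Longrightarrow> summable (\<lambda>n. norm (f n x))"
    and si: "summable (\<lambda>n. integral S (\<lambda>x. norm (f n x)))"
  shows "(\<lambda>x. \<Sum>n. f n x) absolutely_integrable_on S"
    and "(\<lambda>n. integral S (f n)) sums integral S (\<lambda>x. \<Sum>n. f n x)"
proof -
  define g where "g n x = indicator S x *\<^sub>R f n x" for n x
  have int: "integrable lebesgue (g n)" for n using f[of n] by (simp add: g_def[abs_def] set_integrable_def)
  have "summable (\<lambda>n. norm (g n x))" for x by (cases "x \<in> S") (use sx in \<open>auto simp: g_def\<close>)
  then have ae: "AE x in lebesgue. summable (\<lambda>n. norm (g n x))" by simp
  have "integral\<^sup>L lebesgue (\<lambda>x. norm (g n x)) = integral S (\<lambda>x. norm (f n x))" for n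
  proof -
    have "(\<lambda>x. norm (f n x)) absolutely_integrable_on S" using absolutely_integrable_norm[OF f[of n]] by (simp add: o_def)
    from set_lebesgue_integral_eq_integral(2)[OF this] show ?thesis
      by (simp add: set_lebesgue_integral_def g_def)
  qed
  then have si': "summable (\<lambda>n. integral\<^sup>L lebesgue (\<lambda>x. norm (g n x)))" using si by simp
  have g: "(\<Sum>n. g n x) = indicator S x *\<^sub>R (\<Sum>n. f n x)" for x by (cases "x \<in> S") (auto simp: g_def)
  show ai: "(\<lambda>x. \<Sum>n. f n x) absolutely_integrable_on S"
    using integrable_suminf[OF int ae si'] unfolding g set_integrable_def .
  have 1: "integral\<^sup>L lebesgue (g n) = integral S (f n)" for n
    using set_lebesgue_integral_eq_integral(2)[OF f[of n]] by (simp add: set_lebesgue_integral_def g_def[abs_def])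
  have 2: "integral\<^sup>L lebesgue (\<lambda>x. \<Sum>n. g n x) = integral S (\<lambda>x. \<Sum>n. f n x)"
    unfolding g using set_lebesgue_integral_eq_integral(2)[OF ai] by (simp add: set_lebesgue_integral_def)
  show "(\<lambda>n. integral S (f n)) sums integral S (\<lambda>x. \<Sum>n. f n x)"
    using sums_integral[OF int ae si'] unfolding 1 2 .
qed

lemma Gamma_integral_scaled:
  assumes "Re z > 0" "a > 0"
  shows "(\<lambda>t. of_real t powr (z - 1) / of_real (exp (a * t))) absolutely_integrable_on {0<..}"
    and "integral {0<..} (\<lambda>t. of_real t powr (z - 1) / of_real (exp (a * t))) = of_real a powr (- z) * Gamma z"
proof -
  let ?f = "\<lambda>t. of_real t powr (z - 1) / of_real (exp t) :: complex"
  let ?g = "\<lambda>t. of_real t powr (z - 1) / of_real (exp (a * t)) :: complex"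
  show ai: "?g absolutely_integrable_on {0<..}" by (rule absolutely_integrable_Gamma_integral[OF assms])
  have img: "(\<lambda>t. a * t) ` {0<..} = {0<..}"
  proof -
    have "x \<in> (\<lambda>t. a * t) ` {0<..}" if "x > 0" for x
      using that assms by (intro image_eqI[of _ _ "x / a"]) auto
    then show ?thesis using assms by auto
  qed
  have "?f absolutely_integrable_on {0<..} \<and> integral {0<..} ?f = Gamma z"
    using absolutely_integrable_Gamma_integral'[OF assms(1)] integral_unique[OF Gamma_integral_complex'[OF assms(1)]] by simp
  moreover have "inj_on (\<lambda>t. a * t) {0<..}" using assms by (auto intro!: inj_onI)
  moreover have "((\<lambda>t. a * t) has_field_derivative a) (at x within {0<..})" for x by (auto intro!: derivative_eq_intros)
  ultimately have "(\<lambda>x. \<bar>a\<bar> *\<^sub>R ?f (a * x)) absolutely_integrable_on {0<..} \<and> integral {0<..} (\<lambda>x. \<bar>a\<bar> *\<^sub>R ?f (a * x)) = Gamma z"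
    by (subst has_absolute_integral_change_of_variables_real[of "{0<..}" "\<lambda>t. a * t" "\<lambda>_. a" ?f "Gamma z"])
       (simp_all only: img, auto)
  then have "integral {0<..} (\<lambda>x. \<bar>a\<bar> *\<^sub>R ?f (a * x)) = Gamma z" by simp
  also have "integral {0<..} (\<lambda>x. \<bar>a\<bar> *\<^sub>R ?f (a * x)) = integral {0<..} (\<lambda>x. of_real a powr z * ?g x)"
  proof (rule integral_cong)
    fix x :: real assume x: "x \<in> {0<..}"
    have "of_real (a * x) powr (z - 1) = of_real a powr (z - 1) * of_real x powr (z - 1)"
      using assms x by (simp add: powr_times_real)
    moreover have "of_real a powr z = of_real a powr (z - 1) * of_real a" using assms by (simp add: powr_diff)
    ultimately show "\<bar>a\<bar> *\<^sub>R ?f (a * x) = of_real a powr z * ?g x" using assms by (simp add: scaleR_conv_of_real)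
  qed
  also have "\<dots> = of_real a powr z * integral {0<..} ?g" by (rule integral_mult_right)
  finally show "integral {0<..} ?g = of_real a powr (- z) * Gamma z"
    using assms by (simp add: powr_minus field_simps)
qed

definition xi_mellin :: "complex \<Rightarrow> complex" where
  "xi_mellin s = integral {0<..} (\<lambda>x. of_real (xi_kernel x) * of_real x powr (s / 2 - 1))"

text \<open>Term by term the kernel gives \<open>4 Gamma (s/2 + 2) - 6 Gamma (s/2 + 1) = s (s - 1)
  Gamma (s/2)\<close> times \<open>(\<pi> (n + 1)^2)^(- s/2)\<close>, a term of the Dirichlet
  series. For \<open>Re s > 1\<close> the integrals of the absolute values are summable, which
  permits the interchange.\<close>

lemma xi_mellin_dirichlet:
  assumes "Re s > 1"
  shows "(\<lambda>x. of_real (xi_kernel x) * of_real x powr (s / 2 - 1)) absolutely_integrable_on {0<..}"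
    and "(\<lambda>n. s * (s - 1) * of_real pi powr (- s / 2) * Gamma (s / 2) * (1 / of_nat (Suc n) powr s)) sums xi_mellin s"
proof -
  define m where "m n = (real (Suc n))\<^sup>2" for n
  have m: "m n > 0" for n by (simp add: m_def)
  define G where "G z n x = of_real x powr (z - 1) / of_real (exp (pi * m n * x))" for z :: complex and n x
  define f where "f n x = of_real (4 * (pi * m n)\<^sup>2) * G (s / 2 + 2) n x - of_real (6 * (pi * m n)) * G (s / 2 + 1) n x" for n x
  have rz: "Re (s / 2 + 2) > 0" "Re (s / 2 + 1) > 0" using assms by auto
  have pm: "pi * m n > 0" for n using m by simp
  have Gai: "G z n absolutely_integrable_on {0<..}" "integral {0<..} (G z n) = of_real (pi * m n) powr (- z) * Gamma z" if "Re z > 0" for z n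
    using Gamma_integral_scaled[OF that pm[of n]] by (simp_all add: G_def[abs_def])
  have fai: "f n absolutely_integrable_on {0<..}" for n
    unfolding f_def by (intro set_integral_diff(1) set_integrable_mult_right Gai rz)
  have fint: "integral {0<..} (f n) = s * (s - 1) * Gamma (s / 2) * of_real (pi * m n) powr (- s / 2)" for n
  proof -
    have "integral {0<..} (f n) = of_real (4 * (pi * m n)\<^sup>2) * integral {0<..} (G (s / 2 + 2) n) - of_real (6 * (pi * m n)) * integral {0<..} (G (s / 2 + 1) n)"
      unfolding f_def using Gai(1)[OF rz(1)] Gai(1)[OF rz(2)]
      by (subst Henstock_Kurzweil_Integration.integral_diff) (auto intro!: integrable_on_mult_right set_lebesgue_integral_eq_integral(1))
    also have "\<dots> = of_real (4 * (pi * m n)\<^sup>2) * (of_real (pi * m n) powr (- (s / 2 + 2)) * Gamma (s / 2 + 2)) - of_real (6 * (pi * m n)) * (of_real (pi * m n) powr (- (s / 2 + 1)) * Gamma (s / 2 + 1))"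
      unfolding Gai(2)[OF rz(1)] Gai(2)[OF rz(2)] ..
    also have "of_real (pi * m n) powr (- (s / 2 + 2)) = of_real (pi * m n) powr (- s / 2) / (of_real (pi * m n))\<^sup>2"
    proof -
      have "- (s / 2 + 2) = - s / 2 - of_nat 2" by simp
      then show ?thesis using pm[of n] by (simp add: powr_diff powr_numeral)
    qed
    also have "of_real (pi * m n) powr (- (s / 2 + 1)) = of_real (pi * m n) powr (- s / 2) / of_real (pi * m n)"
    proof -
      have "- (s / 2 + 1) = - s / 2 - 1" by simp
      then show ?thesis using pm[of n] by (simp add: powr_diff)
    qed
    also have "Gamma (s / 2 + 1) = s / 2 * Gamma (s / 2)"
      by (rule Gamma_plus1) (use assms in \<open>auto elim!: nonpos_Ints_cases simp: complex_eq_iff\<close>)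
    also have "Gamma (s / 2 + 2) = (s / 2 + 1) * (s / 2 * Gamma (s / 2))"
    proof -
      have "Gamma (s / 2 + 1 + 1) = (s / 2 + 1) * Gamma (s / 2 + 1)"
        by (rule Gamma_plus1) (use rz(2) in \<open>auto elim!: nonpos_Ints_cases simp: complex_eq_iff\<close>)
      also have "Gamma (s / 2 + 1) = s / 2 * Gamma (s / 2)"
        by (rule Gamma_plus1) (use assms in \<open>auto elim!: nonpos_Ints_cases simp: complex_eq_iff\<close>)
      finally show ?thesis by (simp add: add.assoc)
    qed
    also have "of_real (4 * (pi * m n)\<^sup>2) * (of_real (pi * m n) powr (- s / 2) / (of_real (pi * m n))\<^sup>2 * ((s / 2 + 1) * (s / 2 * Gamma (s / 2)))) -
        of_real (6 * (pi * m n)) * (of_real (pi * m n) powr (- s / 2) / of_real (pi * m n) * (s / 2 * Gamma (s / 2)))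
        = (4 * (s / 2 + 1) * (s / 2) - 6 * (s / 2)) * Gamma (s / 2) * of_real (pi * m n) powr (- s / 2)"
    proof -
      have p0: "complex_of_real (pi * m n) \<noteq> 0" using pm[of n] by (metis of_real_eq_0_iff less_irrefl)
      define q where "q = complex_of_real (pi * m n)"
      have "complex_of_real (4 * (pi * m n)\<^sup>2) = 4 * q\<^sup>2" "complex_of_real (6 * (pi * m n)) = 6 * q" by (simp_all add: q_def)
      then show ?thesis using p0 unfolding q_def[symmetric] by (simp add: field_simps)
    qed
    also have "4 * (s / 2 + 1) * (s / 2) - 6 * (s / 2) = s * (s - 1)" by (simp add: field_simps)
    finally show ?thesis .
  qed
  have pw: "of_real (pi * m n) powr (- s / 2) = of_real pi powr (- s / 2) * (1 / of_nat (Suc n) powr s)" for n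
  proof -
    define L where "L = complex_of_real (ln (real (Suc n)))"
    have 1: "of_real (pi * m n) powr (- s / 2) = of_real pi powr (- s / 2) * of_real (m n) powr (- s / 2)"
      unfolding of_real_mult by (rule powr_times_real) (use m[of n] in auto)
    have l: "ln (m n) = 2 * ln (real (Suc n))" unfolding m_def by (subst ln_realpow) auto
    have "complex_of_real (m n) \<noteq> 0" using m[of n] by simp
    then have "of_real (m n) powr (- s / 2) = exp (- s / 2 * of_real (ln (m n)))"
      unfolding powr_def using Ln_of_real[OF m[of n]] by simp
    also have "- s / 2 * of_real (ln (m n)) = - (s * L)" unfolding l L_def by simp
    finally have 2: "of_real (m n) powr (- s / 2) = exp (- (s * L))" .
    have "of_nat (Suc n) = complex_of_real (real (Suc n))" by simp
    then have 3: "of_nat (Suc n) powr s = exp (s * L)"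
      unfolding L_def powr_def using Ln_of_real[of "real (Suc n)"] by (simp del: of_nat_Suc of_real_of_nat_eq)
    show ?thesis unfolding 1 2 3 by (simp only: exp_minus inverse_eq_divide)
  qed
  have f_eq: "f n x = of_real ((4 * pi\<^sup>2 * x\<^sup>2 * ((real (Suc n))\<^sup>2)\<^sup>2 - 6 * pi * x * (real (Suc n))\<^sup>2) * exp (- pi * (real (Suc n))\<^sup>2 * x)) * of_real x powr (s / 2 - 1)" if "x > 0" for n x
  proof -
    have s: "s / 2 + 2 - 1 = (s / 2 - 1) + 1 + 1" "s / 2 + 1 - 1 = (s / 2 - 1) + 1" by simp_all
    have "complex_of_real x powr 1 = of_real x" using that by simp
    then have p: "of_real x powr (s / 2 + 2 - 1) = of_real x powr (s / 2 - 1) * of_real x * of_real x" "of_real x powr (s / 2 + 1 - 1) = of_real x powr (s / 2 - 1) * of_real x"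
      unfolding s by (simp_all only: powr_add)
    define E X P M Y where "E = complex_of_real (exp (- pi * m n * x))" and "X = complex_of_real x"
      and "P = complex_of_real pi" and "M = complex_of_real (m n)" and "Y = of_real x powr (s / 2 - 1)"
    have e: "complex_of_real (exp (pi * m n * x)) = inverse E" by (simp add: E_def exp_minus)
    have dE: "a / inverse E = a * E" for a by (simp add: divide_inverse)
    have "f n x = 4 * (P * M)\<^sup>2 * ((Y * X * X) * E) - 6 * (P * M) * ((Y * X) * E)"
      unfolding f_def G_def p e dE by (simp add: X_def P_def M_def Y_def)
    also have "\<dots> = (4 * P\<^sup>2 * X\<^sup>2 * M\<^sup>2 - 6 * P * X * M) * E * Y" by (simp add: power2_eq_square algebra_simps)
    also have "\<dots> = of_real ((4 * pi\<^sup>2 * x\<^sup>2 * (m n)\<^sup>2 - 6 * pi * x * m n) * exp (- pi * m n * x)) * of_real x powr (s / 2 - 1)"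
      unfolding E_def X_def P_def M_def Y_def by simp
    finally show ?thesis unfolding m_def .
  qed
  have f_norm: "norm (f n x) \<le> 4 * pi\<^sup>2 * x\<^sup>2 * x powr (Re s / 2 - 1) * (((real (Suc n))\<^sup>2) ^ 2 * exp (- pi * (real (Suc n))\<^sup>2 * x))
      + 6 * pi * x * x powr (Re s / 2 - 1) * (((real (Suc n))\<^sup>2) ^ 1 * exp (- pi * (real (Suc n))\<^sup>2 * x))" if "x > 0" for n x
  proof -
    define P where "P = x powr (Re s / 2 - 1)"
    define c1 where "c1 = 4 * pi\<^sup>2 * x\<^sup>2 * (m n)\<^sup>2"
    define c2 where "c2 = 6 * pi * x * m n"
    define E where "E = exp (- pi * m n * x)"
    have P: "norm (of_real x powr (s / 2 - 1)) = P" using that by (simp add: norm_powr_real_powr P_def)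
    have nn: "P \<ge> 0" "E \<ge> 0" "c1 \<ge> 0" "c2 \<ge> 0" using that m[of n] by (auto simp: P_def E_def c1_def c2_def)
    have "f n x = of_real ((c1 - c2) * E) * of_real x powr (s / 2 - 1)"
      unfolding f_eq[OF that] c1_def c2_def E_def m_def ..
    then have "norm (f n x) = norm (complex_of_real ((c1 - c2) * E)) * norm (of_real x powr (s / 2 - 1))"
      by (simp only: norm_mult)
    also have "\<dots> = \<bar>c1 - c2\<bar> * E * P"
      unfolding P norm_of_real abs_mult using nn by simp
    also have "\<dots> \<le> (c1 + c2) * E * P" using nn by (intro mult_right_mono) auto
    also have "\<dots> = 4 * pi\<^sup>2 * x\<^sup>2 * P * ((m n) ^ 2 * E) + 6 * pi * x * P * ((m n) ^ 1 * E)"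
      unfolding c1_def c2_def by (simp add: algebra_simps)
    finally show ?thesis unfolding P_def E_def m_def .
  qed
  \<comment> \<open>Absolute values lose the cancellation between the two Gamma integrals, so their
    bounds add up.\<close>
  define C where "C = 4 * Gamma (Re s / 2 + 2) + 6 * Gamma (Re s / 2 + 1)"
  have f_int_norm: "integral {0<..} (\<lambda>x. norm (f n x)) \<le> C * (pi * m n) powr (- Re s / 2)" for n
  proof -
    define q where "q = pi * m n"
    have q: "q > 0" using pm by (simp add: q_def)
    have GG: "((\<lambda>t. norm (G z n t)) has_integral q powr (- Re z) * Gamma (Re z)) {0<..}" if "Re z > 0" for z
    proof -
      have rr: "Re (complex_of_real (Re z)) > 0" using that by simp
      have "((G (of_real (Re z)) n) has_integral of_real q powr (- of_real (Re z)) * Gamma (of_real (Re z))) {0<..}"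
        using Gai[OF rr, of n] set_lebesgue_integral_eq_integral(1)[OF Gai(1)[OF rr, of n]] integrable_integral q_def by metis
      then have "((\<lambda>t. Re (G (of_real (Re z)) n t)) has_integral Re (of_real q powr (- of_real (Re z)) * Gamma (of_real (Re z)))) {0<..}"
        by (rule has_integral_Re)
      moreover have "Re (of_real q powr (- of_real (Re z)) * Gamma (of_real (Re z))) = q powr (- Re z) * Gamma (Re z)"
        using q powr_of_real[of q "- Re z"] by (simp add: Gamma_complex_of_real)
      moreover have "Re (G (of_real (Re z)) n t) = norm (G z n t)" if "t \<in> {0<..}" for t
        using that powr_of_real[of t "Re z - 1"] by (simp add: G_def norm_divide norm_powr_real_powr)
      ultimately show ?thesis by (metis (no_types, lifting) has_integral_eq)
    qed
    have "((\<lambda>x. 4 * q\<^sup>2 * norm (G (s / 2 + 2) n x) + 6 * q * norm (G (s / 2 + 1) n x)) has_integral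
      (4 * q\<^sup>2 * (q powr (- Re (s / 2 + 2)) * Gamma (Re (s / 2 + 2))) + 6 * q * (q powr (- Re (s / 2 + 1)) * Gamma (Re (s / 2 + 1))))) {0<..}"
      by (intro has_integral_add has_integral_mult_right GG rz)
    moreover have "((\<lambda>x. norm (f n x)) has_integral integral {0<..} (\<lambda>x. norm (f n x))) {0<..}"
      using fai[of n] by (intro integrable_integral) (simp add: absolutely_integrable_on_def)
    moreover have "norm (f n x) \<le> 4 * q\<^sup>2 * norm (G (s / 2 + 2) n x) + 6 * q * norm (G (s / 2 + 1) n x)" for x
      unfolding f_def q_def[symmetric] using q by (intro order_trans[OF norm_triangle_ineq4]) (simp add: norm_mult norm_power)
    ultimately have "integral {0<..} (\<lambda>x. norm (f n x)) \<le> 4 * q\<^sup>2 * (q powr (- Re (s / 2 + 2)) * Gamma (Re (s / 2 + 2))) + 6 * q * (q powr (- Re (s / 2 + 1)) * Gamma (Re (s / 2 + 1)))"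
      using has_integral_le by blast
    also have "q powr (- Re (s / 2 + 2)) = q powr (- Re s / 2) / q\<^sup>2"
      using q by (simp add: powr_diff[symmetric] powr_numeral[symmetric] del: powr_numeral)
    also have "q powr (- Re (s / 2 + 1)) = q powr (- Re s / 2) / q"
    proof -
      have e: "- Re (s / 2 + 1) = - Re s / 2 - 1" by simp
      show ?thesis unfolding e powr_diff using q by simp
    qed
    finally show ?thesis using q unfolding q_def[symmetric] by (simp add: C_def algebra_simps)
  qed
  have "summable (\<lambda>n. integral {0<..} (\<lambda>x. norm (f n x)))"
  proof (rule summable_comparison_test')
    have "summable (\<lambda>n. real (Suc n) powr - Re s)" using assms by (subst summable_Suc_iff) (simp add: summable_real_powr_iff)
    then show "summable (\<lambda>n. C * pi powr (- Re s / 2) * real (Suc n) powr - Re s)" by (rule summable_mult)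
    fix n :: nat
    have "m n powr (- Re s / 2) = real (Suc n) powr - Re s"
    proof -
      have "m n = real (Suc n) powr 2" by (simp add: m_def)
      then show ?thesis by (simp only: powr_powr) simp
    qed
    then have "(pi * m n) powr (- Re s / 2) = pi powr (- Re s / 2) * real (Suc n) powr - Re s"
      using m[of n] by (simp add: powr_mult)
    then show "norm (integral {0<..} (\<lambda>x. norm (f n x))) \<le> C * pi powr (- Re s / 2) * real (Suc n) powr - Re s"
      using f_int_norm[of n] fai[of n] by (simp add: absolutely_integrable_on_def integral_nonneg mult.assoc)
  qed
  moreover have "summable (\<lambda>n. norm (f n x))" if "x \<in> {0<..}" for x
  proof (rule summable_comparison_test')
    show "summable (\<lambda>n. 4 * pi\<^sup>2 * x\<^sup>2 * x powr (Re s / 2 - 1) * (((real (Suc n))\<^sup>2) ^ 2 * exp (- pi * (real (Suc n))\<^sup>2 * x))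
      + 6 * pi * x * x powr (Re s / 2 - 1) * (((real (Suc n))\<^sup>2) ^ 1 * exp (- pi * (real (Suc n))\<^sup>2 * x)))"
      using that by (intro summable_add summable_mult summable_theta_moment) auto
    show "norm (norm (f n x)) \<le> 4 * pi\<^sup>2 * x\<^sup>2 * x powr (Re s / 2 - 1) * (((real (Suc n))\<^sup>2) ^ 2 * exp (- pi * (real (Suc n))\<^sup>2 * x))
      + 6 * pi * x * x powr (Re s / 2 - 1) * (((real (Suc n))\<^sup>2) ^ 1 * exp (- pi * (real (Suc n))\<^sup>2 * x))" for n
      using f_norm[of x n] that by simp
  qed
  ultimately have I: "(\<lambda>x. \<Sum>n. f n x) absolutely_integrable_on {0<..}" "(\<lambda>n. integral {0<..} (f n)) sums integral {0<..} (\<lambda>x. \<Sum>n. f n x)"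
    using absolutely_integrable_suminf[OF fai] by auto
  have eq: "(\<Sum>n. f n x) = of_real (xi_kernel x) * of_real x powr (s / 2 - 1)" if "x \<in> {0<..}" for x
  proof -
    have x: "x > 0" using that by simp
    have "(\<lambda>n. f n x) sums (of_real (xi_kernel x) * of_real x powr (s / 2 - 1))"
      unfolding f_eq[OF x] by (intro sums_mult2 sums_of_real xi_kernel_sums x)
    then show ?thesis by (simp add: sums_iff)
  qed
  show "(\<lambda>x. of_real (xi_kernel x) * of_real x powr (s / 2 - 1)) absolutely_integrable_on {0<..}"
    using I(1) by (subst (asm) set_integrable_cong[OF refl refl eq]) auto
  have "integral {0<..} (\<lambda>x. \<Sum>n. f n x) = xi_mellin s"
    unfolding xi_mellin_def by (rule integral_cong) (rule eq)
  then show "(\<lambda>n. s * (s - 1) * of_real pi powr (- s / 2) * Gamma (s / 2) * (1 / of_nat (Suc n) powr s)) sums xi_mellin s"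
    using I(2) unfolding fint pw by (simp add: mult_ac)
qed

subsection \<open>Power series of Xi and continuation of zeta\<close>

text \<open>The substitution of \<open>1/x\<close> for \<open>x\<close> on \<open>(0, 1]\<close> and
  the symmetry of the kernel replace \<open>s\<close> by \<open>1 - s\<close>. The folded integrand
  is integrable on \<open>[1, \<infinity>)\<close> for every \<open>s\<close>, so the formula
  carries both the continuation and the functional equation.\<close>

lemma xi_mellin_fold:
  assumes "Re s > 1"
  shows "((\<lambda>x. of_real (xi_kernel x) * (of_real x powr (s / 2 - 1) + of_real x powr ((1 - s) / 2 - 1))) has_integral xi_mellin s) {1..}"
proof -
  define h where "h x = of_real (xi_kernel x) * of_real x powr (s / 2 - 1)" for x
  have h: "h absolutely_integrable_on {0<..}" unfolding h_def by (rule xi_mellin_dirichlet(1)[OF assms])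
  have h1: "h absolutely_integrable_on {0<..1}" "h absolutely_integrable_on {1..}"
    by (rule set_integrable_subset[OF h]; auto)+
  have img: "(\<lambda>x. 1 / x) ` {1..} = {0<..1::real}"
  proof -
    have "x \<in> (\<lambda>x. 1 / x) ` {1..}" if "0 < x" "x \<le> 1" for x :: real
      using that by (intro image_eqI[of _ _ "1 / x"]) auto
    then show ?thesis by auto
  qed
  have inj: "inj_on (\<lambda>x::real. 1 / x) {1..}" by (auto intro!: inj_onI)
  have der: "((\<lambda>x::real. 1 / x) has_field_derivative - (1 / x\<^sup>2)) (at x within {1..})" if "x \<in> {1..}" for x
    using that by (auto intro!: derivative_eq_intros simp: power2_eq_square)
  have S: "{1::real..} \<in> sets lebesgue" by simp
  have "h absolutely_integrable_on (\<lambda>x. 1 / x) ` {1..} \<and> integral ((\<lambda>x. 1 / x) ` {1..}) h = integral {0<..1} h"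
    unfolding img using h1(1) by simp
  then have sub: "(\<lambda>x. \<bar>- (1 / x\<^sup>2)\<bar> *\<^sub>R h (1 / x)) absolutely_integrable_on {1..} \<and> integral {1..} (\<lambda>x. \<bar>- (1 / x\<^sup>2)\<bar> *\<^sub>R h (1 / x)) = integral {0<..1} h"
    using has_absolute_integral_change_of_variables_real[OF S der inj, where f = h and b = "integral {0<..1} h"] by blast
  have eq: "\<bar>- (1 / x\<^sup>2)\<bar> *\<^sub>R h (1 / x) = of_real (xi_kernel x) * of_real x powr ((1 - s) / 2 - 1)" if "x \<in> {1..}" for x
  proof -
    have x: "x > 0" using that by auto
    define L where "L = ln x"
    have xe: "x = exp L" using x by (simp add: L_def)
    have p: "complex_of_real x powr w = exp (w * of_real L)" for w
      using x Ln_of_real[OF x] by (simp add: powr_def L_def)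
    have p': "complex_of_real (1 / x) powr w = exp (- (w * of_real L))" for w
    proof -
      have "Ln (of_real (1 / x)) = of_real (ln (1 / x))" using x by (intro Ln_of_real) simp
      moreover have "ln (1 / x) = - L" using x by (simp add: L_def ln_div)
      moreover have "complex_of_real (1 / x) \<noteq> 0" using x by simp
      ultimately show ?thesis unfolding powr_def by simp
    qed
    have sq: "complex_of_real (sqrt x) = exp (of_real L / 2)"
    proof -
      have "sqrt x = exp (L / 2)" using x by (simp add: xe powr_half_sqrt[symmetric] powr_def)
      then show ?thesis by (simp add: exp_of_real[symmetric])
    qed
    have x2: "complex_of_real (1 / x\<^sup>2) = exp (- (2 * of_real L))"
    proof -
      have "1 / x\<^sup>2 = exp (- (2 * L))" unfolding xe by (simp add: exp_minus inverse_eq_divide power2_eq_square exp_add[symmetric])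
      then show ?thesis by (simp only: exp_of_real[symmetric] of_real_minus of_real_mult of_real_numeral)
    qed
    have "\<bar>- (1 / x\<^sup>2)\<bar> *\<^sub>R h (1 / x) = of_real (1 / x\<^sup>2) * (of_real (sqrt x * xi_kernel x) * of_real (1 / x) powr (s / 2 - 1))"
      unfolding h_def xi_kernel_inverse[OF x] scaleR_conv_of_real by simp
    also have "\<dots> = of_real (xi_kernel x) * (exp (- (2 * of_real L)) * exp (of_real L / 2) * exp (- ((s / 2 - 1) * of_real L)))"
      unfolding of_real_mult sq x2 p' by (simp only: mult_ac)
    also have "\<dots> = of_real (xi_kernel x) * exp (((1 - s) / 2 - 1) * of_real L)"
      unfolding exp_add[symmetric] by (simp add: field_simps)
    finally show ?thesis unfolding p .
  qed
  have i1: "((\<lambda>x. of_real (xi_kernel x) * of_real x powr ((1 - s) / 2 - 1)) has_integral integral {0<..1} h) {1..}"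
  proof -
    have "((\<lambda>x. \<bar>- (1 / x\<^sup>2)\<bar> *\<^sub>R h (1 / x)) has_integral integral {0<..1} h) {1..}"
      using sub set_lebesgue_integral_eq_integral(1) integrable_integral by metis
    then show ?thesis by (rule has_integral_eq[rotated]) (rule eq)
  qed
  have i2: "(h has_integral integral {1..} h) {1..}" and i3: "(h has_integral integral {0<..1} h) {0<..1}"
    using h1 by (auto intro!: integrable_integral set_lebesgue_integral_eq_integral(1))
  have un: "{0<..1} \<union> {1..} = {0::real<..}" "{0<..1} \<inter> {1..} = {1::real}" by auto
  have "(h has_integral integral {0<..1} h + integral {1..} h) ({0<..1} \<union> {1..})"
    by (rule has_integral_Un[OF i3 i2]) (simp add: un)
  then have "xi_mellin s = integral {0<..1} h + integral {1..} h"
    unfolding un xi_mellin_def h_def by (rule integral_unique)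
  moreover have "((\<lambda>x. h x + of_real (xi_kernel x) * of_real x powr ((1 - s) / 2 - 1)) has_integral integral {1..} h + integral {0<..1} h) {1..}"
    by (rule has_integral_add[OF i2 i1])
  ultimately show ?thesis by (simp add: h_def distrib_left add.commute)
qed

lemma xi_kernel_powr_integrable: "(\<lambda>x. xi_kernel x * x powr p) absolutely_integrable_on {1..}"
proof (rule measurable_bounded_by_integrable_imp_absolutely_integrable)
  define C where "C = 4 * pi\<^sup>2 * theta_moment 2 (2 / pi)"
  have C: "C \<ge> 0" unfolding C_def by (intro mult_nonneg_nonneg theta_moment_nonneg) auto
  define q where "q = 3 + \<bar>p\<bar>"
  have q: "q > 0" by (simp add: q_def)
  have "(\<lambda>t. t powr (q - 1) / exp t) absolutely_integrable_on {0..}"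
    by (rule nonnegative_absolutely_integrable_1) (use Gamma_integral_real[OF q] in \<open>auto simp: has_integral_integrable\<close>)
  then have "(\<lambda>t. t powr (q - 1) / exp t) absolutely_integrable_on {1..}" by (rule set_integrable_subset) auto
  then have "(\<lambda>t. t powr (q - 1) / exp t) integrable_on {1..}" by (rule set_lebesgue_integral_eq_integral(1))
  then show "(\<lambda>t. C * (t powr (q - 1) / exp t)) integrable_on {1..}" by (rule integrable_on_mult_right)
  show "norm (xi_kernel x * x powr p) \<le> C * (x powr (q - 1) / exp x)" if "x \<in> {1..}" for x
  proof -
    have x: "x \<ge> 1" using that by simp
    have "norm (xi_kernel x * x powr p) = xi_kernel x * x powr p" using xi_kernel_pos[OF x] by (simp add: abs_mult)
    also have "\<dots> \<le> (C * (x powr 2 / exp x)) * x powr \<bar>p\<bar>"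
      using xi_kernel_le[OF x] xi_kernel_pos[OF x] x by (intro mult_mono) (auto simp: C_def intro!: powr_mono)
    also have "\<dots> = C * (x powr (2 + \<bar>p\<bar>) / exp x)" using x by (simp add: powr_add)
    also have "2 + \<bar>p\<bar> = q - 1" by (simp add: q_def)
    finally show ?thesis .
  qed
  have "continuous_on {1..} xi_kernel" by (rule continuous_on_subset[OF continuous_on_xi_kernel]) auto
  then have "continuous_on {1..} (\<lambda>x. xi_kernel x * x powr p)" by (intro continuous_intros) auto
  then show "(\<lambda>x. xi_kernel x * x powr p) \<in> borel_measurable (lebesgue_on {1..})"
    by (rule continuous_imp_measurable_on_sets_lebesgue) simp
qed simp

text \<open>The exponent \<open>- 3/4\<close> is the midpoint of \<open>s/2 - 1\<close> and
  \<open>(1 - s)/2 - 1\<close>; factoring it out turns the sum of the two powers into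
  \<open>2 cos (z ln x / 2)\<close> with \<open>s = 1/2 + i z\<close>.\<close>

definition xi_weight :: "real \<Rightarrow> real" where "xi_weight x = xi_kernel x * x powr (- 3 / 4)"

definition xi_coeff :: "nat \<Rightarrow> real" where
  "xi_coeff n = integral {1..} (\<lambda>x. xi_weight x * ((ln x / 2) ^ (2 * n) / fact (2 * n)))"

lemma xi_weight_pos: "x \<ge> 1 \<Longrightarrow> xi_weight x > 0"
  unfolding xi_weight_def using xi_kernel_pos[of x] by simp

lemma even_exp_partial_sum_le:
  assumes "y \<ge> (0::real)" shows "(\<Sum>n<N. y ^ (2 * n) / fact (2 * n)) \<le> exp y"
proof -
  have "(\<Sum>n<N. y ^ (2 * n) / fact (2 * n)) = (\<Sum>k\<in>(\<lambda>n. 2 * n) ` {..<N}. y ^ k /\<^sub>R fact k)"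
    by (subst sum.reindex) (auto simp: inj_on_def divide_inverse mult.commute)
  also have "\<dots> \<le> (\<Sum>k. y ^ k /\<^sub>R fact k)"
    using assms by (intro sum_le_suminf summable_exp_generic) auto
  finally show ?thesis by (simp add: exp_def)
qed

lemma xi_moment_integrable:
  assumes "y \<ge> 0" shows "(\<lambda>x. xi_weight x * ((y * (ln x / 2)) ^ (2 * n) / fact (2 * n))) absolutely_integrable_on {1..}"
proof (rule measurable_bounded_by_integrable_imp_absolutely_integrable)
  show "(\<lambda>x. xi_kernel x * x powr (- 3 / 4 + y / 2)) integrable_on {1..}"
    by (rule set_lebesgue_integral_eq_integral(1)[OF xi_kernel_powr_integrable])
  have "continuous_on {1..} xi_kernel" by (rule continuous_on_subset[OF continuous_on_xi_kernel]) auto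
  then have "continuous_on {1..} (\<lambda>x. xi_weight x * ((y * (ln x / 2)) ^ (2 * n) / fact (2 * n)))"
    unfolding xi_weight_def by (intro continuous_intros) auto
  then show "(\<lambda>x. xi_weight x * ((y * (ln x / 2)) ^ (2 * n) / fact (2 * n))) \<in> borel_measurable (lebesgue_on {1..})"
    by (rule continuous_imp_measurable_on_sets_lebesgue) simp
  show "norm (xi_weight x * ((y * (ln x / 2)) ^ (2 * n) / fact (2 * n))) \<le> xi_kernel x * x powr (- 3 / 4 + y / 2)" if "x \<in> {1..}" for x
  proof -
    have x: "x \<ge> 1" using that by simp
    have L: "y * (ln x / 2) \<ge> 0" using x assms by simp
    have "(y * (ln x / 2)) ^ (2 * n) / fact (2 * n) \<le> exp (y * (ln x / 2))" by (rule power_div_fact_le_exp[OF L])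
    also have "\<dots> = x powr (y / 2)" using x by (simp add: powr_def)
    finally have le: "(y * (ln x / 2)) ^ (2 * n) / fact (2 * n) \<le> x powr (y / 2)" .
    have "norm (xi_weight x * ((y * (ln x / 2)) ^ (2 * n) / fact (2 * n))) = xi_weight x * ((y * (ln x / 2)) ^ (2 * n) / fact (2 * n))"
      using xi_weight_pos[OF x] L by (simp add: abs_mult)
    also have "\<dots> \<le> xi_weight x * x powr (y / 2)" using le xi_weight_pos[OF x] by (intro mult_left_mono) auto
    also have "\<dots> = xi_kernel x * x powr (- 3 / 4 + y / 2)" unfolding xi_weight_def by (simp only: powr_add mult.assoc)
    finally show ?thesis .
  qed
qed simp

lemma xi_moment_eq: "integral {1..} (\<lambda>x. xi_weight x * ((y * (ln x / 2)) ^ (2 * n) / fact (2 * n))) = y ^ (2 * n) * xi_coeff n"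
proof -
  have "(\<lambda>x. xi_weight x * ((y * (ln x / 2)) ^ (2 * n) / fact (2 * n))) = (\<lambda>x. y ^ (2 * n) * (xi_weight x * ((ln x / 2) ^ (2 * n) / fact (2 * n))))"
    by (rule ext) (simp only: power_mult_distrib, simp)
  then show ?thesis unfolding xi_coeff_def by simp
qed

text \<open>The integrand vanishes at \<open>x = 1\<close> for \<open>n > 0\<close>, so the strict
  lower bound is taken from its minimum over \<open>[2, 3]\<close>.\<close>

lemma xi_coeff_pos: "xi_coeff n > 0"
proof -
  define g where "g x = xi_weight x * ((1 * (ln x / 2)) ^ (2 * n) / fact (2 * n))" for x
  have gi: "g absolutely_integrable_on {1..}" unfolding g_def by (rule xi_moment_integrable) simp
  have g0: "g x \<ge> 0" if "x \<ge> 1" for x using xi_weight_pos[OF that] that by (simp add: g_def)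
  have "continuous_on {2..3} xi_kernel" by (rule continuous_on_subset[OF continuous_on_xi_kernel]) auto
  then have cont: "continuous_on {2..3} g" unfolding g_def xi_weight_def by (intro continuous_intros) auto
  obtain x0 where x0: "x0 \<in> {2..3}" "\<And>x. x \<in> {2..3} \<Longrightarrow> g x0 \<le> g x"
    using continuous_attains_inf[of "{2..3::real}" g] cont by auto
  have "g x0 > 0" unfolding g_def using xi_weight_pos[of x0] x0(1) by (intro mult_pos_pos divide_pos_pos zero_less_power) auto
  also have "g x0 \<le> integral {2..3} g"
  proof -
    have "integral {2..3} (\<lambda>_::real. g x0) \<le> integral {2..3} g"
      by (rule integral_le) (use x0(2) cont integrable_continuous_interval in auto)
    then show ?thesis by simp
  qed
  also have "\<dots> \<le> integral {1..} g"
    by (rule integral_subset_le) (use g0 cont gi integrable_continuous_interval set_lebesgue_integral_eq_integral(1) in auto)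
  also have "\<dots> = xi_coeff n" unfolding g_def using xi_moment_eq[of 1 n] by simp
  finally show ?thesis .
qed

lemma cos_even_sums: "(\<lambda>n. (-1) ^ n * w ^ (2 * n) / fact (2 * n)) sums cos (w::complex)"
proof -
  have "cos_coeff n *\<^sub>R w ^ n = 0" if "n \<notin> range (\<lambda>n. 2 * n)" for n
    using that by (auto simp: cos_coeff_def elim!: evenE)
  then have "(\<lambda>n. cos_coeff (2 * n) *\<^sub>R w ^ (2 * n)) sums cos w"
    using cos_converges[of w] sums_mono_reindex[of "\<lambda>n. 2 * n" "\<lambda>n. cos_coeff n *\<^sub>R w ^ n" "cos w"]
    by (auto simp: strict_mono_def)
  then show ?thesis by (simp add: cos_coeff_def scaleR_conv_of_real)
qed

text \<open>The absolute values sum to at most \<open>exp (|z| ln x / 2) = x^(|z|/2)\<close>, and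
  the exponential decay of the kernel absorbs every power; so the cosine series may be integrated
  termwise for all \<open>z\<close>.\<close>

lemma xi_cos_sums:
  fixes z :: complex
  shows "(\<lambda>n. (-1) ^ n * of_real (xi_coeff n) * z ^ (2 * n)) sums
     integral {1..} (\<lambda>x. of_real (xi_weight x) * cos (z * of_real (ln x / 2)))"
proof -
  define f where "f n x = of_real (xi_weight x) * ((-1) ^ n * (z * of_real (ln x / 2)) ^ (2 * n) / fact (2 * n))" for n x
  define g where "g n x = xi_weight x * ((1 * (ln x / 2)) ^ (2 * n) / fact (2 * n))" for n x
  have fg: "f n x = (-1) ^ n * z ^ (2 * n) * of_real (g n x)" for n x
    unfolding f_def g_def power_mult_distrib of_real_mult by simp
  have gi: "g n absolutely_integrable_on {1..}" for n unfolding g_def by (rule xi_moment_integrable) simp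
  have gi': "(\<lambda>x. complex_of_real (g n x)) absolutely_integrable_on {1..}" for n
    using absolutely_integrable_linear[OF gi[of n] bounded_linear_of_real] by (simp add: o_def)
  have fi: "f n absolutely_integrable_on {1..}" for n
    unfolding fg[abs_def] by (intro set_integrable_mult_right gi')
  have fn: "norm (f n x) = xi_weight x * ((norm z * (ln x / 2)) ^ (2 * n) / fact (2 * n))" if "x \<in> {1..}" for n x
    using xi_weight_pos[of x] that by (simp add: f_def norm_mult norm_power norm_divide abs_mult)
  have int_norm: "integral {1..} (\<lambda>x. norm (f n x)) = norm z ^ (2 * n) * xi_coeff n" for n
    unfolding xi_moment_eq[symmetric] by (rule integral_cong) (rule fn)
  have si: "summable (\<lambda>n. integral {1..} (\<lambda>x. norm (f n x)))"
  proof (rule summableI_nonneg_bounded)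
    show "0 \<le> integral {1..} (\<lambda>x. norm (f n x))" for n
      unfolding int_norm using xi_coeff_pos[of n] by simp
    fix N
    have hi: "((\<lambda>x. \<Sum>n<N. xi_weight x * ((norm z * (ln x / 2)) ^ (2 * n) / fact (2 * n))) has_integral (\<Sum>n<N. integral {1..} (\<lambda>x. norm (f n x)))) {1..}"
      unfolding int_norm xi_moment_eq[symmetric]
      by (intro has_integral_sum integrable_integral set_lebesgue_integral_eq_integral(1) xi_moment_integrable) auto
    have hj: "((\<lambda>x. xi_kernel x * x powr (- 3 / 4 + norm z / 2)) has_integral integral {1..} (\<lambda>x. xi_kernel x * x powr (- 3 / 4 + norm z / 2))) {1..}"
      by (intro integrable_integral set_lebesgue_integral_eq_integral(1) xi_kernel_powr_integrable)
    show "(\<Sum>n<N. integral {1..} (\<lambda>x. norm (f n x))) \<le> integral {1..} (\<lambda>x. xi_kernel x * x powr (- 3 / 4 + norm z / 2))"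
    proof (rule has_integral_le[OF hi hj])
      fix x :: real assume "x \<in> {1..}"
      then have x: "x \<ge> 1" by simp
      have "(\<Sum>n<N. xi_weight x * ((norm z * (ln x / 2)) ^ (2 * n) / fact (2 * n))) = xi_weight x * (\<Sum>n<N. (norm z * (ln x / 2)) ^ (2 * n) / fact (2 * n))"
        by (simp add: sum_distrib_left)
      also have "\<dots> \<le> xi_weight x * exp (norm z * (ln x / 2))"
        using x xi_weight_pos[OF x] by (intro mult_left_mono even_exp_partial_sum_le) auto
      also have "exp (norm z * (ln x / 2)) = x powr (norm z / 2)" using x by (simp add: powr_def)
      also have "xi_weight x * x powr (norm z / 2) = xi_kernel x * x powr (- 3 / 4 + norm z / 2)" unfolding xi_weight_def by (simp only: powr_add mult.assoc)
      finally show "(\<Sum>n<N. xi_weight x * ((norm z * (ln x / 2)) ^ (2 * n) / fact (2 * n))) \<le> xi_kernel x * x powr (- 3 / 4 + norm z / 2)" .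
    qed
  qed
  have fs: "(\<lambda>n. f n x) sums (of_real (xi_weight x) * cos (z * of_real (ln x / 2)))" for x
    unfolding f_def by (intro sums_mult cos_even_sums)
  have sx: "summable (\<lambda>n. norm (f n x))" if "x \<in> {1..}" for x
  proof (rule summableI_nonneg_bounded)
    show "(\<Sum>n<N. norm (f n x)) \<le> xi_weight x * exp (norm z * (ln x / 2))" for N
      unfolding fn[OF that] sum_distrib_left[symmetric]
      using that xi_weight_pos[of x] by (intro mult_left_mono even_exp_partial_sum_le) auto
  qed simp
  have "(\<lambda>n. integral {1..} (f n)) sums integral {1..} (\<lambda>x. \<Sum>n. f n x)"
    using absolutely_integrable_suminf(2)[OF fi _ sx si] by simp
  moreover have "integral {1..} (f n) = (-1) ^ n * of_real (xi_coeff n) * z ^ (2 * n)" for n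
  proof -
    have "integral {1..} (f n) = (-1) ^ n * z ^ (2 * n) * integral {1..} (\<lambda>x. complex_of_real (g n x))"
      unfolding fg[abs_def] by simp
    also have "integral {1..} (\<lambda>x. complex_of_real (g n x)) = of_real (integral {1..} (g n))"
      using gi[of n] by (intro integral_unique has_integral_of_real integrable_integral set_lebesgue_integral_eq_integral(1))
    also have "integral {1..} (g n) = xi_coeff n" unfolding g_def using xi_moment_eq[of 1 n] by simp
    finally show ?thesis by simp
  qed
  ultimately show ?thesis using fs by (simp add: sums_iff)
qed

section \<open>The entire function of the variable w = - z^2\<close>

definition xi_fun :: "complex \<Rightarrow> complex" where
  "xi_fun w = (\<Sum>n. of_real (xi_coeff n) * w ^ n)"

lemma xi_fun_sums: "(\<lambda>n. of_real (xi_coeff n) * w ^ n) sums xi_fun w"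
proof -
  define z where "z = csqrt (- w)"
  have z2: "z ^ (2 * n) = (- w) ^ n" for n by (simp add: z_def power_mult)
  have e: "(-1) ^ n * of_real (xi_coeff n) * z ^ (2 * n) = of_real (xi_coeff n) * w ^ n" for n
  proof -
    have "(-1) ^ n * (- w) ^ n = w ^ n" by (simp add: power_mult_distrib[symmetric])
    then show ?thesis unfolding z2 by (simp add: mult_ac)
  qed
  have "summable (\<lambda>n. of_real (xi_coeff n) * w ^ n)" using xi_cos_sums[of z] unfolding e by (rule sums_summable)
  then show ?thesis unfolding xi_fun_def by (rule summable_sums)
qed

lemma xi_fun_sums_Xi: "(\<lambda>n. (-1) ^ n * of_real (xi_coeff n) * z ^ (2 * n)) sums xi_fun (- z\<^sup>2)"
proof -
  have "of_real (xi_coeff n) * (- z\<^sup>2) ^ n = (-1) ^ n * of_real (xi_coeff n) * z ^ (2 * n)" for n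
    by (simp add: power_minus[of "z\<^sup>2"] power_mult)
  with xi_fun_sums[of "- z\<^sup>2"] show ?thesis by simp
qed

lemma xi_fun_holomorphic: "xi_fun holomorphic_on S"
proof -
  have hb: "xi_fun holomorphic_on ball 0 r" for r
    by (rule power_series_holomorphic[where a = "\<lambda>n. of_real (xi_coeff n)"]) (use xi_fun_sums in simp)
  then have "xi_fun analytic_on UNIV" unfolding analytic_on_def
  proof (intro ballI)
    fix x :: complex
    have "ball x 1 \<subseteq> ball 0 (norm x + 1)" by (auto simp: dist_norm) (metis add.commute add_less_cancel_left norm_minus_commute norm_triangle_sub order_le_less_trans)
    then show "\<exists>e>0. xi_fun holomorphic_on ball x e"
      using holomorphic_on_subset[OF hb] by (intro exI[of _ 1]) auto
  qed
  then show ?thesis using analytic_imp_holomorphic holomorphic_on_subset by blast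
qed

lemma xi_fun_mellin:
  assumes "Re s > 1" shows "2 * xi_fun ((s - 1 / 2)\<^sup>2) = xi_mellin s"
proof -
  define z where "z = - \<i> * (s - 1 / 2)"
  have zz: "- z\<^sup>2 = (s - 1 / 2)\<^sup>2" by (simp add: z_def power_mult_distrib)
  have xi: "xi_fun ((s - 1 / 2)\<^sup>2) = integral {1..} (\<lambda>x. of_real (xi_weight x) * cos (z * of_real (ln x / 2)))"
    using sums_unique2[OF xi_fun_sums_Xi[of z] xi_cos_sums[of z]] unfolding zz .
  have eq: "of_real (xi_kernel x) * (of_real x powr (s / 2 - 1) + of_real x powr ((1 - s) / 2 - 1)) = 2 * (of_real (xi_weight x) * cos (z * of_real (ln x / 2)))"
    if "x \<in> {1..}" for x
  proof -
    have x: "x > 0" using that by auto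
    define L where "L = ln x"
    have p: "complex_of_real x powr w = exp (w * of_real L)" for w
      using x Ln_of_real[OF x] by (simp add: powr_def L_def)
    have w: "complex_of_real (x powr (- 3 / 4)) = exp (- 3 / 4 * of_real L)"
      using p[of "- 3 / 4"] x powr_of_real[of x "- 3 / 4"] by simp
    have c: "2 * cos (z * of_real (ln x / 2)) = exp (((s - 1 / 2) / 2) * of_real L) + exp (- (((s - 1 / 2) / 2) * of_real L))"
      unfolding cos_exp_eq z_def L_def by (simp add: field_simps)
    have "2 * (of_real (xi_weight x) * cos (z * of_real (ln x / 2))) = of_real (xi_kernel x) * (exp (- 3 / 4 * of_real L) * (2 * cos (z * of_real (ln x / 2))))"
      unfolding xi_weight_def of_real_mult w by (simp only: mult_ac)
    also have "\<dots> = of_real (xi_kernel x) * (exp (- 3 / 4 * of_real L + ((s - 1 / 2) / 2) * of_real L) + exp (- 3 / 4 * of_real L - (((s - 1 / 2) / 2) * of_real L)))"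
      unfolding c by (simp only: distrib_left exp_add diff_conv_add_uminus)
    also have "- 3 / 4 * of_real L + ((s - 1 / 2) / 2) * of_real L = (s / 2 - 1) * of_real L" by (simp add: field_simps)
    also have "- 3 / 4 * of_real L - ((s - 1 / 2) / 2) * of_real L = ((1 - s) / 2 - 1) * of_real L" by (simp add: field_simps)
    finally show ?thesis unfolding p by simp
  qed
  have "xi_mellin s = integral {1..} (\<lambda>x. 2 * (of_real (xi_weight x) * cos (z * of_real (ln x / 2))))"
    unfolding integral_unique[OF xi_mellin_fold[OF assms], symmetric] by (rule integral_cong) (rule eq)
  then show ?thesis unfolding xi by simp
qed

section \<open>Identification of zeta, Xi and the coefficients\<close>

definition zeta_series :: "complex \<Rightarrow> complex" where
  "zeta_series s = (\<Sum>n. 1 / of_nat (Suc n) powr s)"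

lemma xi_fun_eq_zeta_series:
  assumes "Re s > 1"
  shows "xi_fun ((s - 1 / 2)\<^sup>2) = 1 / 2 * s * (s - 1) * of_real pi powr (- s / 2) * Gamma (s / 2) * zeta_series s"
    and "(\<lambda>n. 1 / of_nat (Suc n) powr s) sums zeta_series s"
proof -
  define c where "c = s * (s - 1) * of_real pi powr (- s / 2) * Gamma (s / 2)"
  have "s / 2 \<notin> \<int>\<^sub>\<le>\<^sub>0" using assms by (auto elim!: nonpos_Ints_cases simp: complex_eq_iff)
  then have "Gamma (s / 2) \<noteq> 0" by (simp add: Gamma_eq_zero_iff)
  moreover have "s \<noteq> 0" "s \<noteq> 1" using assms by auto
  ultimately have c: "c \<noteq> 0" by (simp add: c_def)
  have s: "(\<lambda>n. c * (1 / of_nat (Suc n) powr s)) sums xi_mellin s"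
    using xi_mellin_dirichlet(2)[OF assms] by (simp add: c_def)
  from sums_mult_D[OF this c] have z: "(\<lambda>n. 1 / of_nat (Suc n) powr s) sums (xi_mellin s / c)" .
  then show "(\<lambda>n. 1 / of_nat (Suc n) powr s) sums zeta_series s" by (simp add: zeta_series_def sums_iff)
  have "zeta_series s = xi_mellin s / c" using z by (simp add: zeta_series_def sums_iff)
  then have "c * zeta_series s = 2 * xi_fun ((s - 1 / 2)\<^sup>2)" using c xi_fun_mellin[OF assms] by simp
  then show "xi_fun ((s - 1 / 2)\<^sup>2) = 1 / 2 * s * (s - 1) * of_real pi powr (- s / 2) * Gamma (s / 2) * zeta_series s"
    by (simp add: c_def)
qed

text \<open>The product solved for zeta: since \<open>s/2 * Gamma (s/2) = Gamma (s/2 + 1)\<close>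
  and the reciprocal Gamma function is entire, the only singularity left is at \<open>s = 1\<close>,
  where the prescribed value is inserted.\<close>

definition zeta_cont :: "complex \<Rightarrow> complex" where
  "zeta_cont s = (if s = 1 then 0 else xi_fun ((s - 1 / 2)\<^sup>2) * of_real pi powr (s / 2) * rGamma (s / 2 + 1) / (s - 1))"

lemma zeta_cont_holomorphic: "zeta_cont holomorphic_on - {1}"
proof -
  have "(\<lambda>s. xi_fun ((s - 1 / 2)\<^sup>2) * of_real pi powr (s / 2) * rGamma (s / 2 + 1) / (s - 1)) holomorphic_on - {1}"
    by (intro holomorphic_intros holomorphic_on_compose_gen[OF _ xi_fun_holomorphic[of UNIV], unfolded o_def]) auto
  then show ?thesis by (rule holomorphic_transform) (auto simp: zeta_cont_def)
qed

lemma pi_powr_cancel: "complex_of_real pi powr (- s / 2) * of_real pi powr (s / 2) = 1"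
  by (simp add: powr_add[symmetric])

lemma zeta_cont_eq_series: assumes "Re s > 1" shows "zeta_cont s = zeta_series s"
proof -
  have s: "s \<noteq> 0" "s \<noteq> 1" using assms by auto
  have np: "s / 2 \<notin> \<int>\<^sub>\<le>\<^sub>0" "s / 2 + 1 \<notin> \<int>\<^sub>\<le>\<^sub>0"
    using assms by (auto elim!: nonpos_Ints_cases simp: complex_eq_iff)
  have "Gamma (s / 2 + 1) = s / 2 * Gamma (s / 2)" by (rule Gamma_plus1[OF np(1)])
  moreover have "Gamma (s / 2 + 1) * rGamma (s / 2 + 1) = 1" using np(2) by (simp add: rGamma_inverse_Gamma Gamma_eq_zero_iff)
  ultimately have "s / 2 * Gamma (s / 2) * rGamma (s / 2 + 1) = 1" by metis
  then have g: "s * Gamma (s / 2) * rGamma (s / 2 + 1) = 2" by simp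
  have "zeta_cont s = 1 / 2 * (s * Gamma (s / 2) * rGamma (s / 2 + 1)) * (of_real pi powr (- s / 2) * of_real pi powr (s / 2)) * zeta_series s"
  proof -
    define d where "d = s - 1"
    have "d \<noteq> 0" using s by (simp add: d_def)
    then show ?thesis
      unfolding zeta_cont_def xi_fun_eq_zeta_series(1)[OF assms] d_def[symmetric] using s by (simp add: field_simps)
  qed
  then show ?thesis unfolding g pi_powr_cancel by simp
qed

lemma riemann_zeta_eq: "riemann_zeta = zeta_cont"
  unfolding riemann_zeta_def
proof (rule the_equality)
  show "zeta_cont holomorphic_on - {1} \<and> (\<forall>s. 1 < Re s \<longrightarrow> zeta_cont s = (\<Sum>n. 1 / of_nat (Suc n) powr s)) \<and> zeta_cont 1 = 0"
    using zeta_cont_holomorphic zeta_cont_eq_series by (auto simp: zeta_series_def zeta_cont_def[of 1])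
next
  fix f assume f: "f holomorphic_on - {1} \<and> (\<forall>s. 1 < Re s \<longrightarrow> f s = (\<Sum>n. 1 / of_nat (Suc n) powr s)) \<and> f 1 = 0"
  have "f s = zeta_cont s" for s
  proof (cases "s = 1")
    case True then show ?thesis using f by (simp add: zeta_cont_def)
  next
    case False
    show ?thesis
    proof (rule analytic_continuation_open[where f = f and g = zeta_cont and s = "{s. Re s > 1}" and s' = "- {1}"])
      show "open {s. Re s > 1}" by (rule open_halfspace_Re_gt)
      show "open (- {1::complex})" by auto
      have "2 \<in> {s. Re s > 1}" by simp
      then show "{s. Re s > 1} \<noteq> {}" by blast
      show "connected (- {1::complex})" by (rule connected_punctured_universe) simp
      show "{s. Re s > 1} \<subseteq> - {1}" by auto
      show "f holomorphic_on - {1}" using f by blast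
      show "zeta_cont holomorphic_on - {1}" by (rule zeta_cont_holomorphic)
      show "f t = zeta_cont t" if "t \<in> {s. Re s > 1}" for t
        using f that zeta_cont_eq_series[of t] by (simp add: zeta_series_def)
      show "s \<in> - {1}" using False by simp
    qed
  qed
  then show "f = zeta_cont" by blast
qed

text \<open>The literal product can differ from the entire function only at zeros of
  \<open>(s - 1) rGamma (s/2)\<close>. These are isolated, and the limits taken by
  \<open>remove_sings\<close> do not see them.\<close>

lemma riemann_Xi_eq: "riemann_Xi z = xi_fun (- z\<^sup>2)"
  unfolding riemann_Xi_def
proof (rule remove_sings_eqI)
  define s where "s w = 1 / 2 + \<i> * w" for w
  have "(\<lambda>w. (s w - 1) * rGamma (s w / 2)) holomorphic_on UNIV" unfolding s_def by (intro holomorphic_intros) auto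
  \<comment> \<open>The point \<open>s = 2\<close>, where the value is \<open>rGamma 1 = 1\<close>,
    shows that the function is not identically zero.\<close>
  moreover have "(s (- \<i> * (3 / 2)) - 1) * rGamma (s (- \<i> * (3 / 2)) / 2) \<noteq> 0" by (simp add: s_def)
  ultimately have ev: "\<forall>\<^sub>F w in at z. (s w - 1) * rGamma (s w / 2) \<noteq> 0 \<and> w \<in> UNIV"
    by (intro non_zero_neighbour_alt[where \<beta> = "- \<i> * (3 / 2)"]) auto
  have "(\<lambda>w::complex. - w\<^sup>2) holomorphic_on UNIV" by (intro holomorphic_on_minus holomorphic_on_power holomorphic_on_ident)
  then have "(xi_fun \<circ> (\<lambda>w. - w\<^sup>2)) holomorphic_on UNIV"
    by (rule holomorphic_on_compose_gen[OF _ xi_fun_holomorphic[of UNIV]]) auto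
  then have "continuous_on UNIV (\<lambda>w. xi_fun (- w\<^sup>2))"
    unfolding o_def by (rule holomorphic_on_imp_continuous_on)
  then have "isCont (\<lambda>w. xi_fun (- w\<^sup>2)) z" by (simp add: continuous_on_eq_continuous_at)
  then have "(\<lambda>w. xi_fun (- w\<^sup>2)) \<midarrow>z\<rightarrow> xi_fun (- z\<^sup>2)" by (rule isContD)
  moreover have "\<forall>\<^sub>F w in at z. xi_fun (- w\<^sup>2) = (let s = 1 / 2 + \<i> * w in 1 / 2 * s * (s - 1) * complex_of_real pi powr (- s / 2) * Gamma (s / 2) * riemann_zeta s)"
    using ev
  proof eventually_elim
    case (elim w)
    have s1: "s w \<noteq> 1" and np: "s w / 2 \<notin> \<int>\<^sub>\<le>\<^sub>0" using elim by (auto simp: rGamma_eq_zero_iff)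
    have "Gamma (s w / 2 + 1) = s w / 2 * Gamma (s w / 2)" by (rule Gamma_plus1[OF np])
    moreover have "s w / 2 + 1 \<notin> \<int>\<^sub>\<le>\<^sub>0" using np plus_one_in_nonpos_Ints_imp by blast
    then have "Gamma (s w / 2 + 1) * rGamma (s w / 2 + 1) = 1" by (simp add: rGamma_inverse_Gamma Gamma_eq_zero_iff)
    ultimately have "s w / 2 * Gamma (s w / 2) * rGamma (s w / 2 + 1) = 1" by metis
    then have g: "s w * Gamma (s w / 2) * rGamma (s w / 2 + 1) = 2" by simp
    have sq: "(s w - 1 / 2)\<^sup>2 = - w\<^sup>2" by (simp add: s_def power_mult_distrib)
    have "1 / 2 * s w * (s w - 1) * complex_of_real pi powr (- s w / 2) * Gamma (s w / 2) * riemann_zeta (s w)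
      = 1 / 2 * (s w * Gamma (s w / 2) * rGamma (s w / 2 + 1)) * (of_real pi powr (- s w / 2) * of_real pi powr (s w / 2)) * xi_fun (- w\<^sup>2)"
    proof -
      define d where "d = s w - 1"
      have "d \<noteq> 0" using s1 by (simp add: d_def)
      then show ?thesis unfolding riemann_zeta_eq zeta_cont_def sq d_def[symmetric] using s1 by simp
    qed
    then have "1 / 2 * s w * (s w - 1) * complex_of_real pi powr (- s w / 2) * Gamma (s w / 2) * riemann_zeta (s w) = xi_fun (- w\<^sup>2)"
      unfolding g pi_powr_cancel by simp
    then show ?case unfolding s_def Let_def by (rule sym)
  qed
  ultimately show "(\<lambda>w. let s = 1 / 2 + \<i> * w in 1 / 2 * s * (s - 1) * complex_of_real pi powr (- s / 2) * Gamma (s / 2) * riemann_zeta s) \<midarrow>z\<rightarrow> xi_fun (- z\<^sup>2)"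
    by (rule Lim_transform_eventually)
qed

text \<open>Every \<open>w\<close> has the form \<open>- z^2\<close>, so both expansions become
  ordinary power series in \<open>w\<close>, whose coefficients are unique.\<close>

lemma A_flat_eq: "A_flat = xi_coeff"
  unfolding A_flat_def
proof (rule the_equality)
  show "\<forall>z. (\<lambda>n. (-1) ^ n * complex_of_real (xi_coeff n) * z ^ (2 * n)) sums riemann_Xi z"
    unfolding riemann_Xi_eq using xi_fun_sums_Xi by blast
next
  fix a assume a: "\<forall>z. (\<lambda>n. (-1) ^ n * complex_of_real (a n) * z ^ (2 * n)) sums riemann_Xi z"
  have "(\<lambda>n. of_real (a n) * w ^ n) sums xi_fun w" for w
  proof -
    define z where "z = csqrt (- w)"
    have z2: "z ^ (2 * n) = (- w) ^ n" "- z\<^sup>2 = w" for n by (simp_all add: z_def power_mult)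
    have e: "(-1) ^ n * of_real (a n) * z ^ (2 * n) = of_real (a n) * w ^ n" for n
    proof -
      have "(-1) ^ n * (- w) ^ n = w ^ n" by (simp add: power_mult_distrib[symmetric])
      then show ?thesis unfolding z2(1) by (simp add: mult_ac)
    qed
    show ?thesis using a[rule_format, of z] unfolding riemann_Xi_eq z2(2) e .
  qed
  then have "xi_fun has_fps_expansion Abs_fps (\<lambda>n. of_real (a n))" by (intro has_fps_expansionI always_eventually) simp
  moreover have "xi_fun has_fps_expansion Abs_fps (\<lambda>n. of_real (xi_coeff n))"
    using xi_fun_sums by (intro has_fps_expansionI always_eventually) simp
  ultimately have "Abs_fps (\<lambda>n. complex_of_real (a n)) = Abs_fps (\<lambda>n. of_real (xi_coeff n))"
    by (rule fps_expansion_unique_complex)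
  then show "a = xi_coeff" by (auto simp: fps_eq_iff)
qed

subsection \<open>Polynomial approximation of entire functions of order below one\<close>

lemma entire_divide_root:
  assumes "h holomorphic_on UNIV" "h \<rho> = 0"
  obtains g where "g holomorphic_on UNIV" "\<And>z. h z = (z - \<rho>) * g z"
proof
  let ?g = "\<lambda>z. if z = \<rho> then deriv h \<rho> else (h z - h \<rho>) / (z - \<rho>)"
  show "?g holomorphic_on UNIV" by (rule pole_lemma[OF assms(1)]) simp
  show "h z = (z - \<rho>) * ?g z" for z using assms(2) by simp
qed

text \<open>A root \<open>x\<close> satisfies \<open>|z - x| \<ge> (t - 1) |x|\<close>, and
  normalizing by the value at 0 cancels \<open>|x|\<close>. With \<open>t = 3\<close> the bound
  grows with the degree; with \<open>t = 2\<close> it is the value at 0.\<close>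

lemma poly_norm_ge_of_root_bound:
  fixes q :: "complex poly"
  assumes "\<And>x. poly q x = 0 \<Longrightarrow> norm x \<le> R" "norm z \<ge> t * R" "t \<ge> 1"
  shows "norm (poly q z) \<ge> (t - 1) ^ degree q * norm (poly q 0)"
  using assms(1)
proof (induction "degree q" arbitrary: q)
  case 0
  then obtain c where "q = [:c:]" by (metis degree_eq_zeroE)
  then show ?case by simp
next
  case (Suc n)
  have "degree q > 0" using Suc(2) by simp
  then obtain x where x: "poly q x = 0" using alg_closed_imp_poly_has_root by blast
  then obtain g where g: "q = [:- x, 1:] * g" by (auto simp: poly_eq_0_iff_dvd)
  have "g \<noteq> 0" using g Suc(2) by auto
  then have dq: "degree q = Suc (degree g)" unfolding g by (subst degree_mult_eq) auto
  have IH: "(t - 1) ^ degree g * norm (poly g 0) \<le> norm (poly g z)"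
    by (rule Suc(1)) (use dq Suc(2) Suc.prems g in auto)
  have "norm x \<le> R" using Suc.prems x by blast
  then have "t * norm x \<le> norm z" using assms(2,3) by (meson mult_left_mono order_trans zero_le_one)
  then have "(t - 1) * norm x \<le> norm (z - x)" using norm_triangle_ineq2[of z x] by (simp add: left_diff_distrib)
  then have "((t - 1) * norm x) * ((t - 1) ^ degree g * norm (poly g 0)) \<le> norm (z - x) * norm (poly g z)"
    using IH assms(3) by (intro mult_mono) auto
  moreover have "norm (poly q 0) = norm x * norm (poly g 0)" "norm (poly q z) = norm (z - x) * norm (poly g z)"
    unfolding g by (simp_all add: norm_mult[symmetric] algebra_simps)
  ultimately show ?case unfolding dq by (simp add: mult_ac)
qed

lemma cpoly_norm_ge_of_root_bound:
  assumes "\<And>x. cpoly p x = 0 \<Longrightarrow> norm x \<le> R" "norm z \<ge> t * R" "t \<ge> 1" "poly p 0 = 1"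
  shows "norm (cpoly p z) \<ge> (t - 1) ^ degree p"
proof -
  have "cpoly p 0 = 1" using cpoly_of_real[of p 0] assms(4) by simp
  then show ?thesis
    using poly_norm_ge_of_root_bound[of "map_poly of_real p" R t z] assms(1-3)
    by (simp add: cpoly_def of_real_hom.degree_map_poly_hom)
qed

lemma cpoly_holomorphic [holomorphic_intros]: "cpoly p holomorphic_on S"
  unfolding cpoly_def by (intro holomorphic_intros)

lemma max_modulus_cball:
  assumes "h holomorphic_on UNIV" "\<And>z. norm z = r \<Longrightarrow> norm (h z) \<le> B" "norm z \<le> r" "r > 0"
  shows "norm (h z) \<le> B"
proof (rule maximum_modulus_frontier[of h "cball 0 r"])
  show "h holomorphic_on interior (cball 0 r)" "continuous_on (closure (cball 0 r)) h"
    using assms(1) holomorphic_on_subset holomorphic_on_imp_continuous_on by blast+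
qed (use assms in \<open>auto simp: frontier_cball\<close>)

section \<open>Splitting off the zeros in a disc\<close>

locale real_entire =
  fixes F :: "complex \<Rightarrow> complex"
  assumes entire: "F holomorphic_on UNIV" and real_sym: "F (cnj z) = cnj (F z)" and F0: "F 0 \<noteq> 0"
begin

definition partial_factorization :: "real \<Rightarrow> real poly \<Rightarrow> (complex \<Rightarrow> complex) \<Rightarrow> bool" where
  "partial_factorization R p h \<longleftrightarrow> h holomorphic_on UNIV \<and> (\<forall>z. F z = cpoly p z * h z) \<and> poly p 0 = 1 \<and>
     (\<forall>w. cpoly p w = 0 \<longrightarrow> norm w \<le> R)"

lemma partial_factorization_sym:
  assumes "partial_factorization R p h" shows "h (cnj z) = cnj (h z)"
proof -
  have h: "h holomorphic_on UNIV" and Fp: "\<And>z. F z = cpoly p z * h z" and p0: "poly p 0 = 1"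
    using assms by (auto simp: partial_factorization_def)
  define g where "g = cnj \<circ> h \<circ> cnj"
  have g: "g holomorphic_on UNIV" unfolding g_def by (rule holomorphic_on_compose_cnj_cnj) (use h holomorphic_on_subset in auto)
  have "g z = h z"
  proof (rule analytic_continuation_open[where f = g and g = h and s = "{z. cpoly p z \<noteq> 0}" and s' = UNIV])
    have "continuous_on UNIV (cpoly p)" by (intro holomorphic_on_imp_continuous_on holomorphic_intros)
    then show "open {z. cpoly p z \<noteq> 0}" by (simp add: open_Collect_neq)
    have "cpoly p 0 \<noteq> 0" using cpoly_of_real[of p 0] p0 by simp
    then show "{z. cpoly p z \<noteq> 0} \<noteq> {}" by blast
    show "g w = h w" if "w \<in> {z. cpoly p z \<noteq> 0}" for w
    proof -
      have "cnj (F (cnj w)) = F w" using real_sym[of w] by simp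
      then have "cpoly p w * g w = cpoly p w * h w" unfolding Fp g_def by (simp add: cpoly_cnj)
      then show ?thesis using that by simp
    qed
  qed (use g h in auto)
  then have "cnj (h (cnj z)) = h z" by (simp add: g_def)
  then show ?thesis by (metis complex_cnj_cnj)
qed

text \<open>On \<open>|z| = 3 R\<close> the polynomial is at least \<open>2^d\<close>, so the
  maximum principle gives \<open>2^d |F 0| \<le> M\<close> and bounds the degree \<open>d\<close>.
  At maximal degree a remaining zero of the cofactor could be split off, together with its conjugate
  if it is not real, a contradiction.\<close>

lemma exists_factorization:
  assumes R: "R > 0"
  obtains p h where "partial_factorization R p h" "\<And>z. norm z \<le> R \<Longrightarrow> h z \<noteq> 0"
proof -
  define D where "D = {d. \<exists>p h. partial_factorization R p h \<and> degree p = d}"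
  have "partial_factorization R 1 F" unfolding partial_factorization_def using entire by simp
  then have D0: "degree (1 :: real poly) \<in> D" unfolding D_def by blast
  have "compact (F ` cball 0 (3 * R))"
    by (intro compact_continuous_image holomorphic_on_imp_continuous_on holomorphic_on_subset[OF entire]) auto
  then obtain M where M: "M > 0" "\<And>z. norm z \<le> 3 * R \<Longrightarrow> norm (F z) \<le> M"
    using compact_imp_bounded bounded_pos by (metis (no_types, lifting) imageI mem_cball_0)
  have bound: "2 ^ d \<le> M / norm (F 0)" if "d \<in> D" for d
  proof -
    from that obtain p h where ph: "partial_factorization R p h" and d: "degree p = d" unfolding D_def by blast
    have h: "h holomorphic_on UNIV" and Fp: "\<And>z. F z = cpoly p z * h z" and p0: "poly p 0 = 1"
      and roots: "\<And>w. cpoly p w = 0 \<Longrightarrow> norm w \<le> R" using ph by (auto simp: partial_factorization_def)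
    have "norm (h 0) \<le> M / 2 ^ d"
    proof (rule max_modulus_cball[OF h, of "3 * R"])
      fix z :: complex assume z: "norm z = 3 * R"
      have "2 ^ d \<le> norm (cpoly p z)"
        using cpoly_norm_ge_of_root_bound[OF roots _ _ p0, of 3 z] z d by simp
      then have "2 ^ d * norm (h z) \<le> norm (cpoly p z) * norm (h z)" by (rule mult_right_mono) simp
      also have "\<dots> = norm (F z)" by (simp add: Fp norm_mult)
      also have "\<dots> \<le> M" using M(2)[of z] z by simp
      finally show "norm (h z) \<le> M / 2 ^ d" by (simp add: field_simps)
    qed (use R in auto)
    moreover have "F 0 = h 0" using Fp[of 0] cpoly_of_real[of p 0] p0 by simp
    ultimately show ?thesis using F0 by (simp add: field_simps)
  qed
  have "d \<le> nat \<lceil>M / norm (F 0)\<rceil>" if "d \<in> D" for d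
  proof -
    have "real d \<le> 2 ^ d" by (simp add: of_nat_less_two_power less_imp_le)
    then have "real d \<le> M / norm (F 0)" using bound[OF that] by linarith
    then show ?thesis by linarith
  qed
  then have "finite D" by (metis finite_nat_set_iff_bounded_le)
  define d where "d = Max D"
  have "d \<in> D" using \<open>finite D\<close> D0 unfolding d_def by (intro Max_in) auto
  then obtain p h where ph: "partial_factorization R p h" and d: "degree p = d" unfolding D_def by blast
  have max: "degree q \<le> d" if "partial_factorization R q g" for q g
    using \<open>finite D\<close> that unfolding d_def by (intro Max_ge) (auto simp: D_def)
  have h: "h holomorphic_on UNIV" and Fp: "\<And>z. F z = cpoly p z * h z" and p0: "poly p 0 = 1"
    and roots: "\<And>w. cpoly p w = 0 \<Longrightarrow> norm w \<le> R" using ph by (auto simp: partial_factorization_def)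
  have h0: "h 0 \<noteq> 0" using Fp[of 0] F0 by auto
  have pn: "p \<noteq> 0" using p0 by auto
  have "h z \<noteq> 0" if "norm z \<le> R" for z
  proof
    assume hz: "h z = 0"
    have z0: "z \<noteq> 0" using hz h0 by auto
    obtain g where g: "g holomorphic_on UNIV" "\<And>w. h w = (w - z) * g w" using entire_divide_root[OF h hz] by blast
    show False
    proof (cases "Im z = 0")
      case True
      define r where "r = Re z"
      have zr: "z = of_real r" using True by (simp add: r_def complex_eq_iff)
      have r: "r \<noteq> 0" using z0 zr by auto
      have q: "cpoly [:1, - 1 / r:] w = (w - z) / (- z)" for w
        using r unfolding zr by (simp add: field_simps)
      have "partial_factorization R ([:1, - 1 / r:] * p) (\<lambda>w. - z * g w)"
        unfolding partial_factorization_def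
      proof (intro conjI allI impI)
        show "(\<lambda>w. - z * g w) holomorphic_on UNIV" by (intro holomorphic_intros g)
        show "F w = cpoly ([:1, - 1 / r:] * p) w * (- z * g w)" for w
          unfolding cpoly_mult q Fp g(2) using z0 by (simp add: field_simps)
        show "poly ([:1, - 1 / r:] * p) 0 = 1" using p0 by simp
        show "norm w \<le> R" if "cpoly ([:1, - 1 / r:] * p) w = 0" for w
          using that roots[of w] \<open>norm z \<le> R\<close> z0 unfolding cpoly_mult q by auto
      qed
      from max[OF this] have "degree ([:1, - 1 / r:] * p) \<le> d" .
      moreover have "degree ([:1, - 1 / r:] * p) = Suc d" using pn r d by (subst degree_mult_eq) auto
      ultimately show False by simp
    next
      case False
      have "h (cnj z) = 0" using partial_factorization_sym[OF ph, of z] hz by simp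
      moreover have ne: "cnj z - z \<noteq> 0" using False by (simp add: complex_eq_iff)
      ultimately have "g (cnj z) = 0" using g(2)[of "cnj z"] by simp
      then obtain k where k: "k holomorphic_on UNIV" "\<And>w. g w = (w - cnj z) * k w" using entire_divide_root[OF g(1)] by blast
      define N where "N = (norm z)\<^sup>2"
      have N: "N > 0" using z0 by (simp add: N_def)
      \<comment> \<open>The real quadratic \<open>(1 - x/z) (1 - x/cnj z)\<close>, with value 1 at
        0.\<close>
      define q where "q = [:1, - 2 * Re z / N, 1 / N:]"
      have NN: "of_real N = z * cnj z" unfolding N_def by (rule complex_norm_square)
      have qe: "of_real N * cpoly q w = (w - z) * (w - cnj z)" for w
      proof -
        have "of_real N * cpoly q w = of_real N - of_real (2 * Re z) * w + w * w"
          using N by (simp add: q_def field_simps)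
        also have "\<dots> = (w - z) * (w - cnj z)"
          unfolding NN complex_add_cnj[symmetric] by (simp add: algebra_simps)
        finally show ?thesis .
      qed
      have "partial_factorization R (q * p) (\<lambda>w. of_real N * k w)"
        unfolding partial_factorization_def
      proof (intro conjI allI impI)
        show "(\<lambda>w. of_real N * k w) holomorphic_on UNIV" by (intro holomorphic_intros k)
        have "F w = cpoly p w * ((w - z) * (w - cnj z)) * k w" for w
          unfolding Fp g(2) k(2) by (simp only: mult_ac)
        then show "F w = cpoly (q * p) w * (of_real N * k w)" for w
          unfolding qe[symmetric] cpoly_mult by (simp only: mult_ac)
        show "poly (q * p) 0 = 1" using p0 by (simp add: q_def)
        show "norm w \<le> R" if "cpoly (q * p) w = 0" for w
        proof (cases "cpoly p w = 0")
          case True then show ?thesis by (rule roots)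
        next
          case False
          then have "cpoly q w = 0" using that unfolding cpoly_mult by simp
          then have "(w - z) * (w - cnj z) = 0" using qe[of w] by simp
          then have "w = z \<or> w = cnj z" by auto
          then show ?thesis using \<open>norm z \<le> R\<close> by auto
        qed
      qed
      from max[OF this] have "degree (q * p) \<le> d" .
      moreover have "degree q = 2" using N by (simp add: q_def)
      then have "degree (q * p) = d + 2" using pn d by (subst degree_mult_eq) auto
      ultimately show False by simp
    qed
  qed
  with ph show ?thesis by (rule that)
qed

end

text \<open>The logarithm \<open>L\<close> of \<open>h / h 0\<close> maps the disc into the
  half-plane \<open>Re < B\<close>. The map \<open>l / (2 B - l)\<close> takes that half-plane to
  the unit disc and fixes 0, which reduces the bound to Schwarz's lemma.\<close>

lemma borel_caratheodory_log:
  assumes h: "h holomorphic_on ball 0 R" "\<And>z. norm z < R \<Longrightarrow> h z \<noteq> 0"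
    and B: "B > 0" "\<And>z. norm z < R \<Longrightarrow> norm (h z) < exp B * norm (h 0)" and R: "R > 0"
  shows "\<exists>L. \<forall>z. norm z < R \<longrightarrow> h z = h 0 * exp (L z) \<and> norm (L z) \<le> 2 * B * norm z / (R - norm z)"
proof -
  have h0: "h 0 \<noteq> 0" using h(2)[of 0] R by simp
  obtain g where g: "g holomorphic_on ball 0 R" "\<And>z. z \<in> ball 0 R \<Longrightarrow> h z = exp (g z)"
    using contractible_imp_holomorphic_log[OF h(1)] h(2) by (metis convex_ball convex_imp_contractible mem_ball_0)
  define L where "L z = g z - g 0" for z
  have hL: "h z = h 0 * exp (L z)" if "norm z < R" for z
    using g(2)[of z] g(2)[of 0] that R by (simp add: L_def exp_diff)
  have ReL: "Re (L z) < B" if "norm z < R" for z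
  proof -
    have "norm (h 0) * exp (Re (L z)) < norm (h 0) * exp B"
      using B(2)[OF that] hL[OF that] by (simp add: norm_mult mult.commute)
    then show ?thesis using h0 by simp
  qed
  have den: "2 * of_real B - L z \<noteq> 0" if "norm z < R" for z
  proof
    assume "2 * of_real B - L z = 0"
    then have "Re (L z) = 2 * B" by (metis Re_complex_of_real eq_iff_diff_eq_0 of_real_mult of_real_numeral)
    then show False using ReL[OF that] B(1) by simp
  qed
  define w where "w z = L (of_real R * z) / (2 * of_real B - L (of_real R * z))" for z
  have Rz: "norm (of_real R * z) < R" if "norm z < 1" for z :: complex
    using that R by (simp add: norm_mult)
  have "L holomorphic_on ball 0 R" unfolding L_def by (intro holomorphic_intros g)
  moreover have "(\<lambda>z::complex. of_real R * z) ` ball 0 1 \<subseteq> ball 0 R" using Rz by auto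
  moreover have "(\<lambda>z::complex. of_real R * z) holomorphic_on ball 0 1" by (intro holomorphic_intros)
  ultimately have "(L \<circ> (\<lambda>z. of_real R * z)) holomorphic_on ball 0 1" by (intro holomorphic_on_compose_gen)
  then have "(\<lambda>z. L (of_real R * z)) holomorphic_on ball 0 1" unfolding o_def .
  then have hw: "w holomorphic_on ball 0 1" unfolding w_def
    by (intro holomorphic_intros) (use den Rz in auto)
  have w0: "w 0 = 0" by (simp add: w_def L_def)
  have w1: "norm (w z) < 1" if "norm z < 1" for z
  proof -
    let ?l = "L (of_real R * z)"
    have "(norm (2 * of_real B - ?l))\<^sup>2 - (norm ?l)\<^sup>2 = 4 * B * (B - Re ?l)"
      unfolding cmod_power2 by (simp add: power2_eq_square algebra_simps)
    also have "\<dots> > 0" using ReL[OF Rz[OF that]] B(1) by simp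
    finally have "(norm ?l)\<^sup>2 < (norm (2 * of_real B - ?l))\<^sup>2" by linarith
    then have "norm ?l < norm (2 * of_real B - ?l)" by (rule power2_less_imp_less) simp
    moreover have "norm (2 * of_real B - ?l) > 0" using den[OF Rz[OF that]] zero_less_norm_iff by blast
    ultimately show ?thesis unfolding w_def norm_divide by (simp only: divide_less_eq_1_pos)
  qed
  show ?thesis
  proof (intro exI[of _ L] allI impI conjI)
    show "norm (L z) \<le> 2 * B * norm z / (R - norm z)" if z: "norm z < R" for z
    proof -
      define u where "u = z / of_real R"
      have zu: "z = of_real R * u" using R by (simp add: u_def)
      have nu: "norm u = norm z / R" using R by (simp add: u_def norm_divide)
      have u1: "norm u < 1" using z R by (simp add: nu)
      have sw: "norm (w u) \<le> norm u" by (rule Schwarz_Lemma(1)[OF hw w0 w1 u1])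
      have "L z * (1 + w u) = 2 * of_real B * w u"
        using den[OF z] unfolding w_def zu[symmetric] by (simp add: field_simps)
      then have e: "norm (L z) * norm (1 + w u) = 2 * B * norm (w u)" using B(1) by (metis abs_of_pos norm_mult norm_numeral norm_of_real)
      have "1 - norm u \<le> norm (1 + w u)" using norm_triangle_ineq4[of "1 + w u" "w u"] sw by simp
      then have "norm (L z) * (1 - norm u) \<le> 2 * B * norm (w u)" unfolding e[symmetric] by (intro mult_left_mono) auto
      also have "\<dots> \<le> 2 * B * norm u" using sw B(1) by (intro mult_left_mono) auto
      finally have "norm (L z) \<le> 2 * B * norm u / (1 - norm u)" using u1 by (simp add: field_simps)
      also have "\<dots> = 2 * B * norm z / (R - norm z)" unfolding nu using R z by (simp add: field_simps)
      finally show ?thesis .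
    qed
  qed (rule hL)
qed

lemma norm_exp_minus_1_le: "norm (exp z - 1) \<le> exp (norm z) * norm (z::complex)"
proof -
  have "norm (exp z - 1) \<le> exp \<bar>Re z\<bar> * norm z" using Taylor_exp[of z 0] by simp
  also have "\<dots> \<le> exp (norm z) * norm z" using abs_Re_le_cmod[of z] by (intro mult_right_mono) auto
  finally show ?thesis .
qed

lemma cpoly_has_fps_expansion: "cpoly p has_fps_expansion Abs_fps (\<lambda>n. of_real (coeff p n))"
proof (rule has_fps_expansionI, rule always_eventually, rule allI)
  fix u :: complex
  have "(\<lambda>n. of_real (coeff p n) * u ^ n) sums (\<Sum>n\<le>degree p. of_real (coeff p n) * u ^ n)"
    by (rule sums_finite) (auto simp: coeff_eq_0)
  then show "(\<lambda>n. fps_nth (Abs_fps (\<lambda>n. of_real (coeff p n))) n * u ^ n) sums cpoly p u"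
    by (simp add: cpoly_eq_sum[OF order_refl])
qed

context real_entire
begin

text \<open>The genus-zero case of Hadamard's factorization: growth \<open>exp (o(R))\<close> along a sequence of radii forces the
  zero-free cofactors to converge to a constant.\<close>
theorem polynomial_approximation:
  assumes growth: "\<And>\<epsilon> R0. \<epsilon> > 0 \<Longrightarrow> \<exists>R\<ge>R0. \<forall>z. norm z \<le> R \<longrightarrow> norm (F z) \<le> exp (\<epsilon> * R)"
  obtains p :: "nat \<Rightarrow> real poly" where "\<And>m. poly (p m) 0 = 1" "\<And>m w. cpoly (p m) w = 0 \<Longrightarrow> F w = 0"
    "\<And>k. (\<lambda>m. complex_of_real (coeff (p m) k)) \<longlonglongrightarrow> (deriv ^^ k) F 0 / (fact k * F 0)"
proof -
  \<comment> \<open>\<open>exp (- \<kappa>)\<close> lies below \<open>|F 0|\<close>, which pays for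
    the comparison with \<open>h 0\<close>; the added 1 makes the inequality strict.\<close>
  define \<kappa> where "\<kappa> = \<bar>ln (norm (F 0))\<bar> + 1"
  have \<kappa>: "\<kappa> \<ge> 1" by (simp add: \<kappa>_def)
  have "\<exists>p L. poly p 0 = 1 \<and> (\<forall>w. cpoly p w = 0 \<longrightarrow> F w = 0) \<and>
      (\<forall>z. norm z < 1 \<longrightarrow> cpoly p z = F z / F 0 * exp (- L z) \<and> norm (L z) \<le> (8 + 4 * \<kappa>) / real (Suc m))" for m
  proof -
    obtain R where R: "R \<ge> 4 * real (Suc m)" "\<And>z. norm z \<le> R \<Longrightarrow> norm (F z) \<le> exp (1 / real (Suc m) * R)"
      using growth[of "1 / real (Suc m)" "4 * real (Suc m)"] by auto
    \<comment> \<open>Zeros are collected only up to \<open>R/2\<close>. On \<open>|z| = R\<close>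
      the polynomial then has modulus at least 1, so the bound for \<open>F\<close> carries over to
      \<open>h\<close>.\<close>
    define S where "S = R / 2"
    have S: "S \<ge> 2 * real (Suc m)" "R = 2 * S" using R(1) by (auto simp: S_def)
    then have S0: "S \<ge> 2" by simp
    obtain p h where ph: "partial_factorization S p h" and nz: "\<And>z. norm z \<le> S \<Longrightarrow> h z \<noteq> 0"
      using exists_factorization[of S] S0 by auto
    have h: "h holomorphic_on UNIV" and Fp: "\<And>z. F z = cpoly p z * h z" and p0: "poly p 0 = 1"
      and roots: "\<And>w. cpoly p w = 0 \<Longrightarrow> norm w \<le> S" using ph by (auto simp: partial_factorization_def)
    have h0: "h 0 = F 0" using Fp[of 0] cpoly_of_real[of p 0] p0 by simp
    have hb: "norm (h z) \<le> exp (1 / real (Suc m) * R)" if "norm z \<le> R" for z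
    proof (rule max_modulus_cball[OF h _ that])
      fix z :: complex assume z: "norm z = R"
      have "1 \<le> norm (cpoly p z)" using cpoly_norm_ge_of_root_bound[OF roots _ _ p0, of 2 z] z S(2) by simp
      then have "1 * norm (h z) \<le> norm (cpoly p z) * norm (h z)" by (rule mult_right_mono) simp
      also have "\<dots> = norm (F z)" by (simp add: Fp norm_mult)
      also have "\<dots> \<le> exp (1 / real (Suc m) * R)" using R(2)[of z] z by simp
      finally show "norm (h z) \<le> exp (1 / real (Suc m) * R)" by simp
    qed (use S S0 in auto)
    define B where "B = 2 * S / real (Suc m) + \<kappa>"
    have B: "B > 0" using S0 \<kappa> by (simp add: B_def add_pos_pos)
    have hB: "norm (h z) < exp B * norm (h 0)" if "norm z < S" for z
    proof -
      have "exp (- \<kappa>) < norm (F 0)"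
      proof -
        have "- \<kappa> < ln (norm (F 0))" unfolding \<kappa>_def by linarith
        then have "exp (- \<kappa>) < exp (ln (norm (F 0)))" by simp
        then show ?thesis using F0 by simp
      qed
      then have "exp B * exp (- \<kappa>) < exp B * norm (F 0)" by simp
      moreover have "exp B * exp (- \<kappa>) = exp (1 / real (Suc m) * R)" by (simp add: B_def S(2) exp_add[symmetric])
      ultimately show ?thesis using hb[of z] that S(2) S0 by (simp add: h0)
    qed
    have hS: "h holomorphic_on ball 0 S" using h holomorphic_on_subset by blast
    have nzS: "h z \<noteq> 0" if "norm z < S" for z using nz[of z] that by simp
    have Spos: "S > 0" using S0 by simp
    obtain L where L: "\<And>z. norm z < S \<Longrightarrow> h z = h 0 * exp (L z)"
      "\<And>z. norm z < S \<Longrightarrow> norm (L z) \<le> 2 * B * norm z / (S - norm z)"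
      using borel_caratheodory_log[OF hS nzS B hB Spos] by metis
    have "cpoly p z = F z / F 0 * exp (- L z) \<and> norm (L z) \<le> (8 + 4 * \<kappa>) / real (Suc m)" if z: "norm z < 1" for z
    proof
      have zS: "norm z < S" using z S0 by simp
      have "F z = cpoly p z * (F 0 * exp (L z))" using Fp[of z] L(1)[OF zS] h0 by simp
      then show "cpoly p z = F z / F 0 * exp (- L z)" using F0 by (simp add: exp_minus)
      have "norm (L z) \<le> 2 * B * norm z / (S - norm z)" by (rule L(2)[OF zS])
      \<comment> \<open>\<open>B\<close> is \<open>2 S / (m + 1)\<close> plus a constant, so
        dividing by \<open>S - |z| \<ge> S/2\<close> leaves a bound of order
        \<open>1 / (m + 1)\<close> on the unit disc.\<close>
      also have "\<dots> \<le> 2 * B * 1 / (S / 2)" using z S0 B by (intro frac_le mult_left_mono) auto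
      also have "\<dots> = 8 / real (Suc m) + 4 * \<kappa> / S" using S0 by (simp add: B_def field_simps)
      also have "\<dots> \<le> 8 / real (Suc m) + 4 * \<kappa> / real (Suc m)" using S \<kappa> by (intro add_left_mono divide_left_mono) auto
      finally show "norm (L z) \<le> (8 + 4 * \<kappa>) / real (Suc m)" by (simp add: add_divide_distrib)
    qed
    moreover have "F w = 0" if "cpoly p w = 0" for w using Fp[of w] that by simp
    ultimately show ?thesis using p0 by blast
  qed
  then obtain p L where p: "\<And>m. poly (p m) 0 = 1" "\<And>m w. cpoly (p m) w = 0 \<Longrightarrow> F w = 0"
    and pL: "\<And>m z. norm z < 1 \<Longrightarrow> cpoly (p m) z = F z / F 0 * exp (- L m z)"
    and L: "\<And>m z. norm z < 1 \<Longrightarrow> norm (L m z) \<le> (8 + 4 * \<kappa>) / real (Suc m)" by metis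
  define c where "c m = (8 + 4 * \<kappa>) / real (Suc m)" for m
  have c0: "c \<longlonglongrightarrow> 0" unfolding c_def by (rule LIMSEQ_Suc[OF lim_const_over_n])
  have "compact ((\<lambda>z. F z / F 0) ` cball 0 1)"
    using F0 by (intro compact_continuous_image holomorphic_on_imp_continuous_on holomorphic_intros holomorphic_on_subset[OF entire]) auto
  then obtain M where M: "M > 0" "\<And>z. norm z \<le> 1 \<Longrightarrow> norm (F z / F 0) \<le> M"
    using compact_imp_bounded bounded_pos by (metis (no_types, lifting) imageI mem_cball_0)
  have ul: "uniform_limit (ball 0 1) (\<lambda>m z. cpoly (p m) z) (\<lambda>z. F z / F 0) sequentially"
  proof (rule uniform_limitI)
    fix e :: real assume e: "e > 0"
    have "(\<lambda>m. M * (exp (c m) * c m)) \<longlonglongrightarrow> M * (exp 0 * 0)" by (intro tendsto_intros c0)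
    then have "eventually (\<lambda>m. M * (exp (c m) * c m) < e) sequentially" using e by (intro order_tendstoD(2)) auto
    then show "\<forall>\<^sub>F m in sequentially. \<forall>z\<in>ball 0 1. dist (cpoly (p m) z) (F z / F 0) < e"
    proof eventually_elim
      case (elim m)
      show ?case
      proof
        fix z :: complex assume "z \<in> ball 0 1"
        then have z: "norm z < 1" by simp
        have Lc: "norm (L m z) \<le> c m" using L[OF z] by (simp add: c_def)
        have "cpoly (p m) z - F z / F 0 = F z / F 0 * (exp (- L m z) - 1)" unfolding pL[OF z] by (simp add: algebra_simps)
        then have "norm (cpoly (p m) z - F z / F 0) = norm (F z / F 0) * norm (exp (- L m z) - 1)"
          by (simp only: norm_mult)
        also have "\<dots> \<le> M * (exp (norm (- L m z)) * norm (- L m z))"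
          using M(1) M(2)[of z] z by (intro mult_mono norm_exp_minus_1_le) auto
        also have "\<dots> \<le> M * (exp (c m) * c m)"
          using Lc M(1) order_trans[OF norm_ge_zero Lc] by (intro mult_left_mono mult_mono) auto
        finally show "dist (cpoly (p m) z) (F z / F 0) < e" using elim by (simp add: dist_norm)
      qed
    qed
  qed
  have "(\<lambda>m. complex_of_real (coeff (p m) k)) \<longlonglongrightarrow> (deriv ^^ k) F 0 / (fact k * F 0)" for k
  proof -
    have "(\<lambda>m. (deriv ^^ k) (cpoly (p m)) 0) \<longlonglongrightarrow> (deriv ^^ k) (\<lambda>z. F z / F 0) 0"
      by (rule higher_deriv_complex_uniform_limit[OF ul]) (auto intro!: always_eventually holomorphic_intros)
    moreover have "(deriv ^^ k) (cpoly (p m)) 0 = fact k * of_real (coeff (p m) k)" for m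
      using fps_nth_fps_expansion[OF cpoly_has_fps_expansion[of "p m"], of k] by simp
    moreover have "(deriv ^^ k) (\<lambda>z. F z / F 0) 0 = (deriv ^^ k) F 0 / F 0"
    proof -
      have "(deriv ^^ k) (\<lambda>z. inverse (F 0) * F z) 0 = inverse (F 0) * (deriv ^^ k) F 0"
        by (rule higher_deriv_cmult[OF entire]) auto
      then show ?thesis by (simp add: divide_inverse mult.commute)
    qed
    ultimately have "(\<lambda>m. fact k * complex_of_real (coeff (p m) k)) \<longlonglongrightarrow> (deriv ^^ k) F 0 / F 0" by simp
    then have "(\<lambda>m. fact k * complex_of_real (coeff (p m) k) / fact k) \<longlonglongrightarrow> (deriv ^^ k) F 0 / F 0 / fact k"
      by (intro tendsto_divide tendsto_const) auto
    then show ?thesis by (simp add: mult.commute)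
  qed
  then show ?thesis using that[of p] p by blast
qed

end

subsection \<open>Growth and zero-free regions of Xi\<close>

text \<open>As all coefficients are positive, for \<open>r \<ge> 0\<close> this is also the maximum
  modulus of \<open>xi_fun\<close> on the circle of radius \<open>r\<close>.\<close>

definition xi_real :: "real \<Rightarrow> real" where "xi_real r = Re (xi_fun (of_real r))"

lemma xi_real_sums: "(\<lambda>n. xi_coeff n * r ^ n) sums xi_real r"
  using sums_Re[OF xi_fun_sums[of "of_real r"]] by (simp add: xi_real_def of_real_power[symmetric] del: of_real_power)

lemma norm_xi_fun_le: "norm (xi_fun z) \<le> xi_real (norm z)"
  by (rule norm_sums_le[OF xi_fun_sums xi_real_sums]) (use xi_coeff_pos in \<open>simp add: norm_mult norm_power less_imp_le\<close>)

lemma xi_real_mono: assumes "0 \<le> r" "r \<le> t" shows "xi_real r \<le> xi_real t"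
  by (rule sums_le[OF _ xi_real_sums xi_real_sums], rule mult_left_mono, rule power_mono)
     (use assms less_imp_le[OF xi_coeff_pos] in auto)

lemma xi_fun_0: "xi_fun 0 = of_real (xi_coeff 0)"
  using xi_fun_sums[of 0] by (simp only: powser_sums_zero_iff)

lemma xi_real_0: "xi_real 0 = xi_coeff 0"
  by (simp add: xi_real_def xi_fun_0)

interpretation xi: real_entire xi_fun
proof
  show "xi_fun (cnj z) = cnj (xi_fun z)" for z
  proof -
    have "(\<lambda>n. cnj (of_real (xi_coeff n) * z ^ n)) sums cnj (xi_fun z)" using xi_fun_sums[of z] by (simp only: sums_cnj)
    then show ?thesis using sums_unique2[OF xi_fun_sums[of "cnj z"]] by simp
  qed
  show "xi_fun 0 \<noteq> 0" unfolding xi_fun_0 using xi_coeff_pos[of 0] by simp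
qed (rule xi_fun_holomorphic)

lemma xi_fun_of_real: "xi_fun (of_real r) = of_real (xi_real r)"
  using xi.real_sym[of "of_real r"] by (simp add: xi_real_def complex_eq_iff)

lemma xi_real_pos: assumes "r \<ge> 0" shows "xi_real r > 0"
  using xi_real_mono[OF order_refl assms] xi_real_0 xi_coeff_pos[of 0] by simp

text \<open>At \<open>s = 2 m\<close> Gamma and the power of \<open>\<pi>\<close> are elementary.
  The values at the radii \<open>(2 m - 1/2)^2\<close> feed both the growth bound and the zero-free
  disc.\<close>

lemma xi_real_even_integer:
  assumes "m > 0"
  shows "xi_real ((2 * real m - 1 / 2)\<^sup>2) = real m * (2 * real m - 1) * fact (m - 1) / pi ^ m * (\<Sum>n. 1 / real (Suc n) ^ (2 * m))"
    and "summable (\<lambda>n. 1 / real (Suc n) ^ (2 * m))"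
proof -
  define s where "s = complex_of_nat (2 * m)"
  have s: "Re s > 1" using assms by (simp add: s_def)
  have t: "1 / of_nat (Suc n) powr s = complex_of_real (1 / real (Suc n) ^ (2 * m))" for n
    unfolding s_def by (subst powr_complexpow) (auto simp del: of_nat_Suc)
  have sm: "(\<lambda>n. complex_of_real (1 / real (Suc n) ^ (2 * m))) sums zeta_series s"
    using xi_fun_eq_zeta_series(2)[OF s] unfolding t .
  then have "(\<lambda>n. 1 / real (Suc n) ^ (2 * m)) sums Re (zeta_series s)" using sums_Re by fastforce
  then show su: "summable (\<lambda>n. 1 / real (Suc n) ^ (2 * m))" by (rule sums_summable)
  have Z: "zeta_series s = of_real (\<Sum>n. 1 / real (Suc n) ^ (2 * m))"
    using sums_unique2[OF sm sums_of_real[OF summable_sums[OF su]]] .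
  have G: "Gamma (s / 2) = fact (m - 1)"
  proof -
    have "s / 2 = 1 + of_nat (m - 1)" using assms by (simp add: s_def of_nat_diff)
    then show ?thesis by (simp only: Gamma_fact)
  qed
  have P: "of_real pi powr (- s / 2) = complex_of_real (1 / pi ^ m)"
  proof -
    have "- s / 2 = - of_nat m" by (simp add: s_def)
    then have "of_real pi powr (- s / 2) = inverse (complex_of_real pi powr of_nat m)" by (simp only: powr_minus)
    also have "complex_of_real pi powr of_nat m = of_real pi ^ m" by (rule powr_complexpow) simp
    finally show ?thesis by (simp add: inverse_eq_divide)
  qed
  have "xi_fun ((s - 1 / 2)\<^sup>2) = 1 / 2 * s * (s - 1) * complex_of_real (1 / pi ^ m) * fact (m - 1) * of_real (\<Sum>n. 1 / real (Suc n) ^ (2 * m))"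
    unfolding xi_fun_eq_zeta_series(1)[OF s] P G Z ..
  also have "\<dots> = of_real (real m * (2 * real m - 1) * fact (m - 1) / pi ^ m * (\<Sum>n. 1 / real (Suc n) ^ (2 * m)))"
    by (simp add: s_def)
  also have "(s - 1 / 2)\<^sup>2 = of_real ((2 * real m - 1 / 2)\<^sup>2)" by (simp add: s_def)
  finally show "xi_real ((2 * real m - 1 / 2)\<^sup>2) = real m * (2 * real m - 1) * fact (m - 1) / pi ^ m * (\<Sum>n. 1 / real (Suc n) ^ (2 * m))"
    unfolding xi_real_def by (metis Re_complex_of_real)
qed

lemma suminf_inverse_squares: "(\<Sum>n. 1 / real (Suc n) ^ 2) = pi\<^sup>2 / 6"
  using inverse_squares_sums by (simp add: sums_iff add.commute)

lemma pi_squared_less: "pi\<^sup>2 < 10"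
proof -
  have "pi\<^sup>2 \<le> (3.15)\<^sup>2" using pi_approx(2) by (intro power_mono) auto
  then show ?thesis by (simp add: power2_eq_square)
qed

lemma xi_real_even_integer_le:
  assumes "m > 0" shows "xi_real ((2 * real m - 1 / 2)\<^sup>2) \<le> 4 * real m ^ 2 * real m ^ m"
proof -
  have "(\<Sum>n. 1 / real (Suc n) ^ (2 * m)) \<le> (\<Sum>n. 1 / real (Suc n) ^ 2)"
  proof (rule suminf_le)
    show "1 / real (Suc n) ^ (2 * m) \<le> 1 / real (Suc n) ^ 2" for n
      using assms by (intro divide_left_mono power_increasing) auto
  qed (use xi_real_even_integer(2)[OF assms] xi_real_even_integer(2)[of 1] in auto)
  also have "\<dots> \<le> 2" unfolding suminf_inverse_squares using pi_squared_less by simp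
  finally have Z: "(\<Sum>n. 1 / real (Suc n) ^ (2 * m)) \<le> 2" .
  have Z0: "(\<Sum>n. 1 / real (Suc n) ^ (2 * m)) \<ge> 0" using xi_real_even_integer(2)[OF assms] by (intro suminf_nonneg) auto
  have f: "fact (m - 1) \<le> real m ^ m"
  proof -
    have "fact (m - 1) \<le> (fact m :: real)" by (rule fact_mono) simp
    also have "\<dots> \<le> real (m ^ m)" by (rule fact_le_power)
    finally show ?thesis by simp
  qed
  have pi: "1 \<le> pi ^ m" using pi_gt3 by (intro one_le_power) simp
  have c: "0 \<le> real m * (2 * real m - 1)" "real m * (2 * real m - 1) \<le> real m * (2 * real m)"
    using assms by auto
  have "real m * (2 * real m - 1) * fact (m - 1) / pi ^ m \<le> real m * (2 * real m - 1) * fact (m - 1) / 1"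
    by (rule divide_left_mono[OF pi mult_nonneg_nonneg[OF c(1)]]) (use pi in auto)
  also have "\<dots> \<le> real m * (2 * real m) * real m ^ m"
    unfolding div_by_1 by (rule mult_mono[OF c(2) f]) auto
  finally have "real m * (2 * real m - 1) * fact (m - 1) / pi ^ m \<le> 2 * real m ^ 2 * real m ^ m" by (simp add: power2_eq_square)
  then have "real m * (2 * real m - 1) * fact (m - 1) / pi ^ m * (\<Sum>n. 1 / real (Suc n) ^ (2 * m)) \<le> 2 * real m ^ 2 * real m ^ m * 2"
    using Z Z0 by (intro mult_mono) auto
  then show ?thesis unfolding xi_real_even_integer(1)[OF assms] by simp
qed

text \<open>At \<open>R = (2 m - 1/2)^2\<close> the logarithm of the maximum is at most of size
  \<open>m ln m\<close>, that is \<open>sqrt R ln R\<close>, hence \<open>o(R)\<close>. Such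
  unboundedly large radii are all that the approximation theorem asks for.\<close>

lemma xi_fun_growth:
  assumes "\<epsilon> > 0" shows "\<exists>R\<ge>R0. \<forall>z. norm z \<le> R \<longrightarrow> norm (xi_fun z) \<le> exp (\<epsilon> * R)"
proof -
  have "((\<lambda>m. (ln 4 + 2 * ln (real m) + real m * ln (real m)) / (2 * real m - 1 / 2)\<^sup>2) \<longlonglongrightarrow> 0)" by real_asymp
  then have 1: "eventually (\<lambda>m. (ln 4 + 2 * ln (real m) + real m * ln (real m)) / (2 * real m - 1 / 2)\<^sup>2 < \<epsilon>) sequentially"
    using assms by (rule order_tendstoD(2))
  have "filterlim (\<lambda>m. (2 * real m - 1 / 2)\<^sup>2) at_top sequentially" by real_asymp
  then have 2: "eventually (\<lambda>m. (2 * real m - 1 / 2)\<^sup>2 \<ge> R0) sequentially" by (simp add: filterlim_at_top)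
  have "eventually (\<lambda>m. m > 0 \<and> (2 * real m - 1 / 2)\<^sup>2 \<ge> R0 \<and> (ln 4 + 2 * ln (real m) + real m * ln (real m)) / (2 * real m - 1 / 2)\<^sup>2 < \<epsilon>) sequentially"
    using 1 2 eventually_gt_at_top[of "0::nat"] by eventually_elim auto
  then obtain m where m: "m > 0" "(2 * real m - 1 / 2)\<^sup>2 \<ge> R0" "(ln 4 + 2 * ln (real m) + real m * ln (real m)) / (2 * real m - 1 / 2)\<^sup>2 < \<epsilon>"
    using eventually_happens[of _ sequentially] by auto
  define R where "R = (2 * real m - 1 / 2)\<^sup>2"
  have R: "R > 0" using m(1) by (simp add: R_def)
  have "4 * real m ^ 2 * real m ^ m = exp (ln 4 + 2 * ln (real m) + real m * ln (real m))"
    using m(1) by (simp add: exp_add exp_of_nat_mult exp_double)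
  also have "\<dots> \<le> exp (\<epsilon> * R)" using m(3) R unfolding R_def[symmetric] by (simp add: divide_less_eq)
  finally have "xi_real R \<le> exp (\<epsilon> * R)" using xi_real_even_integer_le[OF m(1)] unfolding R_def by simp
  moreover have "norm (xi_fun z) \<le> xi_real R" if "norm z \<le> R" for z
    using norm_xi_fun_le[of z] xi_real_mono[of "norm z" R] that by simp
  ultimately show ?thesis using m(2) unfolding R_def[symmetric] by (intro exI[of _ R]) (auto intro: order_trans)
qed

lemma xi_polynomial_approximation:
  "\<exists>p :: nat \<Rightarrow> real poly. (\<forall>m. poly (p m) 0 = 1) \<and> (\<forall>m w. cpoly (p m) w = 0 \<longrightarrow> xi_fun w = 0) \<and>
    (\<forall>k. (\<lambda>m. coeff (p m) k) \<longlonglongrightarrow> xi_coeff k / xi_coeff 0)"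
proof (rule xi.polynomial_approximation[OF xi_fun_growth])
  fix p :: "nat \<Rightarrow> real poly"
  assume p: "\<And>m. poly (p m) 0 = 1" "\<And>m w. cpoly (p m) w = 0 \<Longrightarrow> xi_fun w = 0"
    "\<And>k. (\<lambda>m. complex_of_real (coeff (p m) k)) \<longlonglongrightarrow> (deriv ^^ k) xi_fun 0 / (fact k * xi_fun 0)"
  have "xi_fun has_fps_expansion Abs_fps (\<lambda>n. of_real (xi_coeff n))"
    using xi_fun_sums by (intro has_fps_expansionI always_eventually) simp
  from fps_nth_fps_expansion[OF this] have d: "(deriv ^^ k) xi_fun 0 = fact k * of_real (xi_coeff k)" for k by simp
  have "(\<lambda>m. coeff (p m) k) \<longlonglongrightarrow> xi_coeff k / xi_coeff 0" for k
  proof -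
    have "(deriv ^^ k) xi_fun 0 / (fact k * xi_fun 0) = of_real (xi_coeff k / xi_coeff 0)"
      unfolding d xi_fun_0 by simp
    with p(3)[of k] show ?thesis by (simp only: tendsto_of_real_iff)
  qed
  with p show "\<exists>p :: nat \<Rightarrow> real poly. (\<forall>m. poly (p m) 0 = 1) \<and> (\<forall>m w. cpoly (p m) w = 0 \<longrightarrow> xi_fun w = 0) \<and>
    (\<forall>k. (\<lambda>m. coeff (p m) k) \<longlonglongrightarrow> xi_coeff k / xi_coeff 0)" by blast
qed

section \<open>Zero-free regions\<close>

lemma xi_real_convexity:
  assumes "0 < a" "a \<le> b" shows "b / a * (xi_real a - xi_coeff 0) \<le> xi_real b - xi_coeff 0"
proof -
  have "(\<lambda>n. xi_coeff (Suc n) * r ^ Suc n) sums (xi_real r - xi_coeff 0)" for r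
    using xi_real_sums[of r] by (subst sums_Suc_iff) simp
  note s = this
  show ?thesis
  proof (rule sums_le[OF _ sums_mult[OF s] s])
    fix n
    have "b / a * a ^ Suc n = b * a ^ n" using assms by simp
    also have "\<dots> \<le> b * b ^ n" using assms by (intro mult_left_mono power_mono) auto
    finally have "b / a * a ^ Suc n \<le> b ^ Suc n" by simp
    then have "xi_coeff (Suc n) * (b / a * a ^ Suc n) \<le> xi_coeff (Suc n) * b ^ Suc n"
      by (rule mult_left_mono) (rule less_imp_le[OF xi_coeff_pos])
    then show "b / a * (xi_coeff (Suc n) * a ^ Suc n) \<le> xi_coeff (Suc n) * b ^ Suc n"
      by (simp only: mult.left_commute)
  qed
qed

text \<open>Write \<open>F\<close> for \<open>xi_fun\<close>. As
  \<open>|F(w) - F(0)| \<le> F(|w|) - F(0)\<close>, it suffices that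
  \<open>F(49/4) < 2 F(0)\<close>. The radii \<open>9/4\<close> and \<open>49/4\<close> belong to
  \<open>s = 2\<close> and \<open>s = 4\<close>, with values \<open>\<pi>/6 \<ge> 1/2\<close> and
  \<open>6 zeta(4) / \<pi>^2 \<le> 3/4\<close>; since \<open>(F(r) - F(0)) / r\<close> increases,
  these two values bound \<open>F(0)\<close> from below.\<close>

lemma xi_fun_nonzero_small: assumes "norm w \<le> 49 / 4" shows "xi_fun w \<noteq> 0"
proof
  assume w: "xi_fun w = 0"
  define X where "X = xi_coeff 0"
  have e1: "xi_real (9 / 4) = pi / 6"
    using xi_real_even_integer(1)[of 1] suminf_inverse_squares by (simp add: power2_eq_square)
  define Z where "Z = (\<Sum>n. 1 / real (Suc n) ^ 4)"
  have e2: "xi_real (49 / 4) = 6 / pi\<^sup>2 * Z"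
    using xi_real_even_integer(1)[of 2] by (simp add: power2_eq_square Z_def)
  have sZ: "summable (\<lambda>n. 1 / real (Suc n) ^ 4)" using xi_real_even_integer(2)[of 2] by simp
  have s2: "summable (\<lambda>n. 1 / real (Suc n) ^ 2)" using xi_real_even_integer(2)[of 1] by simp
  \<comment> \<open>For \<open>n \<ge> 2\<close> one has \<open>1/n^4 \<le> 1/(4 n^2)\<close>, so
    the value of \<open>zeta(2)\<close> is enough to bound \<open>zeta(4)\<close>.\<close>
  have Z: "Z \<le> 3 / 4 + pi\<^sup>2 / 24"
  proof -
    have "Z = 1 + (\<Sum>n. 1 / real (Suc (Suc n)) ^ 4)" unfolding Z_def using suminf_split_head[OF sZ] by simp
    also have "(\<Sum>n. 1 / real (Suc (Suc n)) ^ 4) \<le> (\<Sum>n. 1 / 4 * (1 / real (Suc (Suc n)) ^ 2))"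
    proof (rule suminf_le)
      show "1 / real (Suc (Suc n)) ^ 4 \<le> 1 / 4 * (1 / real (Suc (Suc n)) ^ 2)" for n
      proof -
        define x where "x = real (Suc (Suc n))"
        have x: "x \<ge> 2" by (simp add: x_def)
        then have "2 * 2 \<le> x * x" by (intro mult_mono) auto
        then have "4 * x ^ 2 \<le> x ^ 2 * x ^ 2" by (simp add: power2_eq_square mult_right_mono)
        then have "1 / (x ^ 2 * x ^ 2) \<le> 1 / (4 * x ^ 2)" using x by (intro divide_left_mono) auto
        then show ?thesis unfolding x_def[symmetric] by (simp add: power_add[symmetric])
      qed
      show "summable (\<lambda>n. 1 / real (Suc (Suc n)) ^ 4)" using sZ by (subst (asm) summable_Suc_iff[symmetric])
      show "summable (\<lambda>n. 1 / 4 * (1 / real (Suc (Suc n)) ^ 2))"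
        by (intro summable_mult) (use s2 in \<open>subst (asm) summable_Suc_iff[symmetric]\<close>)
    qed
    also have "(\<Sum>n. 1 / 4 * (1 / real (Suc (Suc n)) ^ 2)) = 1 / 4 * (\<Sum>n. 1 / real (Suc (Suc n)) ^ 2)"
      by (rule suminf_mult) (use s2 in \<open>subst (asm) summable_Suc_iff[symmetric]\<close>)
    also have "(\<Sum>n. 1 / real (Suc (Suc n)) ^ 2) = pi\<^sup>2 / 6 - 1"
      using suminf_split_head[OF s2] suminf_inverse_squares by simp
    finally have "Z \<le> 1 + 1 / 4 * (pi\<^sup>2 / 6 - 1)" by simp
    then show ?thesis by (simp add: algebra_simps)
  qed
  have pi2: "pi\<^sup>2 \<ge> 9"
  proof -
    have "3\<^sup>2 \<le> pi\<^sup>2" using pi_gt3 by (intro power_mono) auto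
    then show ?thesis by simp
  qed
  have "6 / pi\<^sup>2 * Z \<le> 6 / pi\<^sup>2 * (3 / 4 + pi\<^sup>2 / 24)" using Z by (intro mult_left_mono) auto
  also have "\<dots> \<le> 3 / 4"
  proof -
    have "6 / q * (3 / 4 + q / 24) \<le> 3 / 4" if "q \<ge> 9" for q :: real
    proof -
      define r where "r = 1 / q"
      have r: "q * r = 1" "6 / q = 6 * r" "r \<ge> 0" using that by (simp_all add: r_def)
      have "9 * r \<le> q * r" by (rule mult_right_mono[OF that r(3)])
      moreover have "6 * r * (3 / 4 + q / 24) = 9 / 2 * r + q * r / 4" by (simp add: algebra_simps)
      ultimately show ?thesis unfolding r(2) using r(1) by linarith
    qed
    from this[OF pi2] show ?thesis .
  qed
  finally have b2: "xi_real (49 / 4) \<le> 3 / 4" unfolding e2 .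
  have b1: "xi_real (9 / 4) \<ge> 1 / 2" unfolding e1 using pi_gt3 by simp
  have "49 / 9 * (xi_real (9 / 4) - X) \<le> xi_real (49 / 4) - X"
    using xi_real_convexity[of "9 / 4" "49 / 4"] by (simp add: X_def)
  moreover have "2 * t > v" if "49 / 9 * (u - t) \<le> v - t" "u \<ge> 1 / 2" "v \<le> 3 / 4" for t u v :: real
    using that by (simp add: field_simps)
  ultimately have X: "2 * X > xi_real (49 / 4)" using b1 b2 by blast
  have "(\<lambda>n. of_real (xi_coeff (Suc n)) * w ^ Suc n) sums (xi_fun w - of_real X)"
    using xi_fun_sums[of w] by (subst sums_Suc_iff) (simp add: X_def)
  moreover have "(\<lambda>n. xi_coeff (Suc n) * norm w ^ Suc n) sums (xi_real (norm w) - X)"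
    using xi_real_sums[of "norm w"] by (subst sums_Suc_iff) (simp add: X_def)
  ultimately have "norm (xi_fun w - of_real X) \<le> xi_real (norm w) - X"
    by (rule norm_sums_le) (use xi_coeff_pos in \<open>simp add: norm_mult norm_power less_imp_le\<close>)
  also have "\<dots> \<le> xi_real (49 / 4) - X" using xi_real_mono[of "norm w" "49 / 4"] assms by simp
  also have "\<dots> < X" using X by simp
  finally show False using w xi_coeff_pos[of 0] by (simp add: X_def)
qed

text \<open>Comparison with \<open>zeta(2)\<close>:
  \<open>|zeta(s) - 1| \<le> \<pi>^2/6 - 1 < 1\<close>.\<close>

lemma xi_fun_nonzero_halfplane: assumes "Re s \<ge> 2" shows "xi_fun ((s - 1 / 2)\<^sup>2) \<noteq> 0"
proof -
  have s1: "Re s > 1" using assms by simp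
  have s2: "summable (\<lambda>n. 1 / real (Suc n) ^ 2)" using xi_real_even_integer(2)[of 1] by simp
  have "zeta_series s \<noteq> 0"
  proof
    assume z: "zeta_series s = 0"
    have "(\<lambda>n. 1 / of_nat (Suc (Suc n)) powr s) sums (zeta_series s - 1)"
      using xi_fun_eq_zeta_series(2)[OF s1] by (subst sums_Suc_iff) simp
    moreover have "(\<lambda>n. 1 / real (Suc (Suc n)) ^ 2) sums (pi\<^sup>2 / 6 - 1)"
      using summable_sums[OF s2] unfolding suminf_inverse_squares by (subst sums_Suc_iff) simp
    ultimately have "norm (zeta_series s - 1) \<le> pi\<^sup>2 / 6 - 1"
    proof (rule norm_sums_le)
      fix n
      have "norm (of_nat (Suc (Suc n)) powr s) = real (Suc (Suc n)) powr Re s"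
        using norm_powr_real_powr[of "of_nat (Suc (Suc n))" s] by (simp del: of_nat_Suc)
      also have "\<dots> \<ge> real (Suc (Suc n)) powr 2" using assms by (intro powr_mono) auto
      finally have "real (Suc (Suc n)) ^ 2 \<le> norm (of_nat (Suc (Suc n)) powr s)" by simp
      then show "norm (1 / of_nat (Suc (Suc n)) powr s) \<le> 1 / real (Suc (Suc n)) ^ 2"
        unfolding norm_divide norm_one by (intro divide_left_mono mult_pos_pos) (auto simp del: of_nat_Suc)
    qed
    then show False using z pi_squared_less by simp
  qed
  moreover have "s / 2 \<notin> \<int>\<^sub>\<le>\<^sub>0" using assms by (auto elim!: nonpos_Ints_cases simp: complex_eq_iff)
  then have "Gamma (s / 2) \<noteq> 0" by (simp add: Gamma_eq_zero_iff)
  moreover have "s \<noteq> 0" "s \<noteq> 1" using assms by auto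
  ultimately show ?thesis unfolding xi_fun_eq_zeta_series(1)[OF s1] by simp
qed

text \<open>The zeros of \<open>\<Xi>\<close> satisfy \<open>\<bar>Im z\<bar> < 3/2\<close> and \<open>\<bar>z\<bar> > 7/2\<close>, so their negated squares lie in the sector
  \<open>\<bar>arg (- w)\<bar> \<le> \<pi>/3\<close>.\<close>
lemma xi_fun_zero_sector: assumes "xi_fun w = 0" shows "norm w / 2 \<le> - Re w"
proof -
  define u where "u = csqrt w"
  have u2: "u\<^sup>2 = w" by (simp add: u_def)
  have ru: "Re u \<ge> 0" unfolding u_def using csqrt_principal[of w] by auto
  have "Re u < 3 / 2"
  proof (rule ccontr)
    assume "\<not> Re u < 3 / 2"
    then have "xi_fun ((u + 1 / 2 - 1 / 2)\<^sup>2) \<noteq> 0" by (intro xi_fun_nonzero_halfplane) simp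
    then show False using assms u2 by simp
  qed
  \<comment> \<open>With \<open>w = u^2\<close> one has \<open>- Re w = |w| - 2 (Re u)^2\<close>,
    and \<open>2 (Re u)^2 \<le> 9/2\<close> stays below half of \<open>49/4\<close>.\<close>
  then have "(Re u)\<^sup>2 \<le> (3 / 2)\<^sup>2" using ru by (intro power_mono) auto
  moreover have "norm w > 49 / 4" using xi_fun_nonzero_small[of w] assms by force
  moreover have "norm w = (Re u)\<^sup>2 + (Im u)\<^sup>2" unfolding u2[symmetric] norm_power cmod_power2 ..
  moreover have "Re w = (Re u)\<^sup>2 - (Im u)\<^sup>2" unfolding u2[symmetric] by (simp add: power2_eq_square)
  ultimately show ?thesis by (simp add: power_divide)
qed

text \<open>The zeros of the approximating polynomials are zeros of \<open>xi_fun\<close>, hence lie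
  in the sector, and a non-strict inequality between coefficients survives the limit.\<close>

lemma xi_coeff_log_concave: "xi_coeff k * xi_coeff (Suc (Suc k)) \<le> (xi_coeff (Suc k))\<^sup>2"
proof -
  obtain p :: "nat \<Rightarrow> real poly" where p: "\<And>m. poly (p m) 0 = 1" "\<And>m w. cpoly (p m) w = 0 \<Longrightarrow> xi_fun w = 0"
    "\<And>k. (\<lambda>m. coeff (p m) k) \<longlonglongrightarrow> xi_coeff k / xi_coeff 0" using xi_polynomial_approximation by blast
  have "log_concave (coeff (p m))" for m
    by (rule log_concave_sector) (use p(1)[of m] p(2)[of m] xi_fun_zero_sector in auto)
  then have "coeff (p m) k * coeff (p m) (Suc (Suc k)) \<le> (coeff (p m) (Suc k))\<^sup>2" for m by (simp add: log_concave_def)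
  then have "xi_coeff k / xi_coeff 0 * (xi_coeff (Suc (Suc k)) / xi_coeff 0) \<le> (xi_coeff (Suc k) / xi_coeff 0)\<^sup>2"
    by (intro LIMSEQ_le[OF tendsto_mult[OF p(3) p(3)] tendsto_power[OF p(3)]]) auto
  then show ?thesis using xi_coeff_pos[of 0] by (simp add: power2_eq_square field_simps)
qed

subsection \<open>Jensen polynomials\<close>

lemma coeff_B_J_flat:
  "coeff (B_J_flat y n) k = (if k \<le> n then fact n / fact (n - k) * xi_coeff k * y ^ (k * (k + 1) div 2) else 0)"
  unfolding B_J_flat_def A_flat_eq by (auto simp: coeff_sum)

lemma B_J_flat_coeff_pos: "y > 0 \<Longrightarrow> k \<le> n \<Longrightarrow> coeff (B_J_flat y n) k > 0"
  using xi_coeff_pos[of k] by (simp add: coeff_B_J_flat)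

lemma degree_B_J_flat: assumes "y > 0" shows "degree (B_J_flat y n) = n"
proof (rule antisym)
  show "degree (B_J_flat y n) \<le> n" by (rule degree_le) (simp add: coeff_B_J_flat)
  show "n \<le> degree (B_J_flat y n)" by (rule le_degree) (use B_J_flat_coeff_pos[OF assms, of n n] in simp)
qed

lemma B_J_flat_nonzero: "y > 0 \<Longrightarrow> B_J_flat y n \<noteq> 0"
  using B_J_flat_coeff_pos[of y 0 n] by auto

text \<open>Log-concavity and the powers of \<open>1/4\<close> give quotients of at least 4;
  strictness comes from the factor \<open>(D + 1) / D\<close> of the factorials, with
  \<open>D = n - k\<close>.\<close>

lemma hyp_B_J_flat_quarter: "hyp (B_J_flat (1 / 4) n)"
proof (rule hyp_Kurtz[of n "\<lambda>k. fact n / fact (n - k) * xi_coeff k * (1 / 4) ^ (k * (k + 1) div 2)"])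
  show "0 < fact n / fact (n - k) * xi_coeff k * (1 / 4) ^ (k * (k + 1) div 2)" for k
    using xi_coeff_pos[of k] by simp
  show "coeff (B_J_flat (1 / 4) n) k = (if k \<le> n then fact n / fact (n - k) * xi_coeff k * (1 / 4) ^ (k * (k + 1) div 2) else 0)" for k
    by (rule coeff_B_J_flat)
  fix k assume k: "1 \<le> k" "k < n"
  then obtain j where j: "k = Suc j" by (cases k) auto
  obtain d where d: "n = Suc (Suc (j + d))" using k j by (metis Suc_leI add_Suc le_Suc_ex)
  define T where "T = j * (j + 1) div 2"
  have T1: "Suc j * (Suc j + 1) div 2 = T + Suc j"
  proof -
    have "Suc j * (Suc j + 1) = j * (j + 1) + 2 * Suc j" by simp
    then show ?thesis unfolding T_def by (metis div_mult_self2 add.commute zero_neq_numeral)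
  qed
  have T2: "Suc (Suc j) * (Suc (Suc j) + 1) div 2 = T + Suc j + Suc (Suc j)"
  proof -
    have "Suc (Suc j) * (Suc (Suc j) + 1) = Suc j * (Suc j + 1) + 2 * Suc (Suc j)" by simp
    then show ?thesis unfolding T1[symmetric] by (metis div_mult_self2 add.commute zero_neq_numeral)
  qed
  define q where "q = (1 / 4 :: real) ^ T"
  define r where "r = (1 / 4 :: real) ^ Suc j"
  define A B C where "A = xi_coeff j" and "B = xi_coeff (Suc j)" and "C = xi_coeff (Suc (Suc j))"
  define f where "f = (fact d :: real)"
  have pos: "q > 0" "r > 0" "A > 0" "B > 0" "C > 0" "f > 0" using xi_coeff_pos by (auto simp: q_def r_def A_def B_def C_def f_def)
  define D where "D = real (Suc d)"
  have D: "D > 0" by (simp add: D_def)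
  have lc: "A * C \<le> B * B" using xi_coeff_log_concave[of j] by (simp add: A_def B_def C_def power2_eq_square)
  have nd: "n - j = Suc (Suc d)" "n - Suc j = Suc d" "n - Suc (Suc j) = d" using d by auto
  have fs: "fact (n - j) = (D + 1) * (D * f)" "fact (n - Suc j) = D * f" "fact (n - Suc (Suc j)) = f"
    unfolding nd by (simp_all add: D_def f_def algebra_simps)
  define N where "N = (fact n :: real)"
  have N: "N > 0" by (simp add: N_def)
  define M where "M = N / (D * f)"
  have M: "M > 0" "N / ((D + 1) * (D * f)) = M / (D + 1)" "N / f = M * D"
    using N D pos by (simp_all add: M_def)
  have e0: "fact n / fact (n - (k - 1)) * xi_coeff (k - 1) * (1 / 4) ^ ((k - 1) * (k - 1 + 1) div 2) = M / (D + 1) * A * q"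
    unfolding M(2)[symmetric] j diff_Suc_1 fs(1) N_def A_def q_def T_def ..
  have e1: "fact n / fact (n - k) * xi_coeff k * (1 / 4) ^ (k * (k + 1) div 2) = M * B * (q * r)"
    unfolding M_def j fs(2) T1 N_def B_def q_def r_def power_add ..
  have e2: "fact n / fact (n - Suc k) * xi_coeff (Suc k) * (1 / 4) ^ (Suc k * (Suc k + 1) div 2) = M * D * C * (q * r * (r / 4))"
    unfolding M(3)[symmetric] j fs(3) T2 N_def C_def q_def r_def power_add by simp
  have "4 * (M / (D + 1) * A * q * (M * D * C * (q * r * (r / 4)))) = (M * q * r)\<^sup>2 * (A * C * (D / (D + 1)))"
  proof -
    define i where "i = 1 / (D + 1)"
    have i: "M / (D + 1) = M * i" "D / (D + 1) = D * i" by (simp_all add: i_def)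
    show ?thesis unfolding i by (simp add: power2_eq_square)
  qed
  also have "\<dots> < (M * q * r)\<^sup>2 * (B * B)"
  proof (rule mult_strict_left_mono)
    have "A * C * (D / (D + 1)) < A * C * 1" using D pos by (intro mult_strict_left_mono) auto
    then show "A * C * (D / (D + 1)) < B * B" using lc by linarith
    show "0 < (M * q * r)\<^sup>2" using pos M(1) by simp
  qed
  also have "\<dots> = M * B * (q * r) * (M * B * (q * r))"
    by (simp add: power2_eq_square)
  finally show "4 * (fact n / fact (n - (k - 1)) * xi_coeff (k - 1) * (1 / 4) ^ ((k - 1) * (k - 1 + 1) div 2) *
      (fact n / fact (n - Suc k) * xi_coeff (Suc k) * (1 / 4) ^ (Suc k * (Suc k + 1) div 2)))
     < fact n / fact (n - k) * xi_coeff k * (1 / 4) ^ (k * (k + 1) div 2) * (fact n / fact (n - k) * xi_coeff k * (1 / 4) ^ (k * (k + 1) div 2))"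
    unfolding e0 e1 e2 .
qed

section \<open>Between the parameters 1/4 and 1\<close>

lemma B_J_flat_eq_gauss_mult:
  assumes "0 < y" shows "B_J_flat y n = gauss_mult (- ln y / 2) (B_J_flat 1 n)"
proof (rule poly_eqI)
  fix k :: nat
  have "even (k * (k + 1))" by simp
  then have "real (k * (k + 1) div 2) = real k * (real k + 1) / 2"
    by (subst real_of_nat_div) (simp_all add: algebra_simps)
  then have "exp (- (- ln y / 2) * (real k * (real k + 1))) = exp (real (k * (k + 1) div 2) * ln y)" by simp
  also have "\<dots> = y ^ (k * (k + 1) div 2)" using assms by (simp add: exp_of_nat_mult)
  finally have e: "exp (- (- ln y / 2) * (real k * (real k + 1))) = y ^ (k * (k + 1) div 2)" .
  show "coeff (B_J_flat y n) k = coeff (gauss_mult (- ln y / 2) (B_J_flat 1 n)) k"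
    unfolding coeff_gauss_mult e coeff_B_J_flat by simp
qed

text \<open>The flow from \<open>y = 1\<close> makes every nonzero root simple for
  \<open>y < 1\<close>, and 0 is no root because the constant coefficient is positive.\<close>

lemma Delta_nonzero_of_hyp:
  assumes "hyp (B_J_flat 1 n)" "n > 0" "0 < y" "y < 1" shows "Delta n y \<noteq> 0"
  unfolding Delta_def
proof (rule hyp_poly_discriminant_nonzero)
  have s: "- ln y / 2 > 0" using assms by simp
  show "hyp (B_J_flat y n)" unfolding B_J_flat_eq_gauss_mult[OF assms(3)]
    by (rule hyp_gauss_mult[OF assms(1)]) (use s in simp)
  show "order x (B_J_flat y n) \<le> 1" for x
  proof (cases "x = 0")
    case True
    have "poly (B_J_flat y n) 0 \<noteq> 0" using B_J_flat_coeff_pos[OF assms(3), of 0 n] by (simp add: poly_0_coeff_0)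
    then show ?thesis using True by (simp add: order_0I)
  next
    case False
    then show ?thesis unfolding B_J_flat_eq_gauss_mult[OF assms(3)] using order_gauss_mult_le_1[OF assms(1) s] by blast
  qed
  show "degree (B_J_flat y n) > 0" using degree_B_J_flat assms by simp
qed

text \<open>The discriminant may vanish at \<open>y = 1\<close>, so hyperbolicity is carried through
  \<open>[1/4, 1)\<close> and reaches 1 as a left limit.\<close>

lemma hyp_B_J_flat_1_of_Delta:
  assumes "n > 0" "\<And>y. y \<in> {1/4..<1} \<Longrightarrow> Delta n y \<noteq> 0" shows "hyp (B_J_flat 1 n)"
proof (rule hyp_limit[of "at_left 1" "\<lambda>y. B_J_flat y n"])
  have "hyp (B_J_flat y n)" if "y \<in> {1/4..<1}" for y
  proof (rule hyp_continuation[of "1/4" 1 "\<lambda>y. B_J_flat y n" n, OF _ assms(1) _ _ hyp_B_J_flat_quarter _ that])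
    show "degree (B_J_flat y n) = n" if "y \<in> {1/4..<1}" for y using degree_B_J_flat that by simp
    show "0 \<le> coeff (B_J_flat y n) k" if "y \<in> {1/4..<1}" for y k
      using that xi_coeff_pos[of k] by (simp add: coeff_B_J_flat)
    show "continuous_on {1/4..<1} (\<lambda>y. coeff (B_J_flat y n) k)" for k
      unfolding coeff_B_J_flat by (cases "k \<le> n") (auto intro!: continuous_intros)
    show "poly_discriminant (B_J_flat y n) \<noteq> 0" if "y \<in> {1/4..<1}" for y
      using assms(2)[OF that] by (simp add: Delta_def)
  qed
  moreover have "eventually (\<lambda>y. y \<in> {1/4..<1}) (at_left (1::real))"
    using eventually_at_left_real[of "1/4" "1::real"] by (auto elim!: eventually_mono)
  ultimately show "\<forall>\<^sub>F y in at_left 1. hyp (B_J_flat y n) \<and> degree (B_J_flat y n) = degree (B_J_flat 1 n)"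
    by (auto elim!: eventually_mono simp: degree_B_J_flat)
  show "((\<lambda>y. coeff (B_J_flat y n) k) \<longlongrightarrow> coeff (B_J_flat 1 n) k) (at_left 1)" for k
    unfolding coeff_B_J_flat by (cases "k \<le> n") (auto intro!: tendsto_eq_intros)
qed (auto simp: B_J_flat_nonzero)

text \<open>Positive coefficients exclude zeros \<open>w \<ge> 0\<close>. A real zero
  \<open>w = - z^2\<close> is therefore negative and comes from a real \<open>z\<close>.\<close>

lemma riemann_hypothesis_iff: "riemann_hypothesis \<longleftrightarrow> (\<forall>w. Im w \<noteq> 0 \<longrightarrow> xi_fun w \<noteq> 0)"
proof
  assume rh: riemann_hypothesis
  show "\<forall>w. Im w \<noteq> 0 \<longrightarrow> xi_fun w \<noteq> 0"
  proof (intro allI impI notI)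
    fix w assume w: "Im w \<noteq> 0" "xi_fun w = 0"
    have "- (csqrt (- w))\<^sup>2 = w" by simp
    then have "riemann_Xi (csqrt (- w)) = 0" using w(2) by (simp only: riemann_Xi_eq)
    then have "csqrt (- w) \<in> \<real>" using rh unfolding riemann_hypothesis_def by blast
    then have "- (csqrt (- w))\<^sup>2 \<in> \<real>" by (intro Reals_minus Reals_power)
    then show False using w(1) \<open>- (csqrt (- w))\<^sup>2 = w\<close> by (simp add: complex_is_Real_iff)
  qed
next
  assume a: "\<forall>w. Im w \<noteq> 0 \<longrightarrow> xi_fun w \<noteq> 0"
  show riemann_hypothesis unfolding riemann_hypothesis_def
  proof (intro allI impI)
    fix z assume "riemann_Xi z = 0"
    then have z: "xi_fun (- z\<^sup>2) = 0" by (simp add: riemann_Xi_eq)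
    then have "Im (- z\<^sup>2) = 0" using a by blast
    then have im: "Im z = 0 \<or> Re z = 0" by (auto simp: power2_eq_square)
    have "Re z \<noteq> 0"
    proof
      assume "Re z = 0"
      then have "- z\<^sup>2 = of_real ((Im z)\<^sup>2)" by (simp add: complex_eq_iff power2_eq_square)
      then have "xi_real ((Im z)\<^sup>2) = 0" using z xi_fun_of_real by (metis of_real_eq_0_iff)
      then show False using xi_real_pos[of "(Im z)\<^sup>2"] by simp
    qed
    then show "z \<in> \<real>" using im by (simp add: complex_is_Real_iff)
  qed
qed

text \<open>Under the hypothesis the approximants have real zeros only, and log-concavity supplies
  nonnegative coefficients, so they are hyperbolic. Jensen multipliers act coefficientwise and
  therefore commute with the limit.\<close>

lemma hyp_B_J_flat_1_of_riemann_hypothesis: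
  assumes "riemann_hypothesis" shows "hyp (B_J_flat 1 n)"
proof -
  obtain p :: "nat \<Rightarrow> real poly" where p: "\<And>m. poly (p m) 0 = 1" "\<And>m w. cpoly (p m) w = 0 \<Longrightarrow> xi_fun w = 0"
    "\<And>k. (\<lambda>m. coeff (p m) k) \<longlonglongrightarrow> xi_coeff k / xi_coeff 0" using xi_polynomial_approximation by blast
  have J: "hyp (jensen_mult n (p m))" for m
  proof -
    have "log_concave (coeff (p m))"
      by (rule log_concave_sector) (use p(1)[of m] p(2)[of m] xi_fun_zero_sector in auto)
    then have "coeff (p m) k \<ge> 0" for k by (simp add: log_concave_def)
    moreover have "cpoly (p m) z \<noteq> 0" if "Im z > 0" for z
      using p(2)[of m z] that assms unfolding riemann_hypothesis_iff by force
    moreover have "p m \<noteq> 0" using p(1)[of m] by auto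
    ultimately have "hyp (p m)" by (intro hypI) auto
    then obtain c rs where c: "c > 0" and rs: "\<forall>r\<in>set rs. r \<ge> 0" and pm: "p m = smult c (\<Prod>r\<leftarrow>rs. [:r, 1:])"
      unfolding hyp_def by blast
    \<comment> \<open>\<open>hyp_jensen_mult\<close> asks for \<open>r > 0\<close>; the
      normalization of \<open>p m\<close> at 0 excludes the factor \<open>x\<close>.\<close>
    have "r \<noteq> 0" if "r \<in> set rs" for r
    proof
      assume "r = 0"
      then have "poly (\<Prod>r\<leftarrow>rs. [:r, 1:]) 0 = 0" using that
        by (induction rs) (auto simp: poly_mult simp del: mult_pCons_left)
      then show False using p(1)[of m] pm by simp
    qed
    then have "\<forall>r\<in>set rs. r > 0" using rs by force
    then show ?thesis unfolding pm by (rule hyp_jensen_mult[OF _ c])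
  qed
  have cJ: "coeff (smult (xi_coeff 0) (jensen_mult n (p m))) k = (if k \<le> n then fact n / fact (n - k) * (xi_coeff 0 * coeff (p m) k) else 0)" for m k
    by (simp add: jensen_mult_def)
  have lim: "(\<lambda>m. coeff (smult (xi_coeff 0) (jensen_mult n (p m))) k) \<longlonglongrightarrow> coeff (B_J_flat 1 n) k" for k
  proof -
    have "(\<lambda>m. fact n / fact (n - k) * (xi_coeff 0 * coeff (p m) k)) \<longlonglongrightarrow> fact n / fact (n - k) * (xi_coeff 0 * (xi_coeff k / xi_coeff 0))"
      by (intro tendsto_intros p(3))
    moreover have "xi_coeff 0 * (xi_coeff k / xi_coeff 0) = xi_coeff k" using xi_coeff_pos[of 0] by simp
    ultimately show ?thesis unfolding cJ coeff_B_J_flat by auto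
  qed
  show ?thesis
  proof (rule hyp_limit[of sequentially "\<lambda>m. smult (xi_coeff 0) (jensen_mult n (p m))", OF _ _ lim])
    \<comment> \<open>An approximant may have degree below \<open>n\<close>; since its coefficient
      of index \<open>n\<close> tends to a positive number, this does not happen for large
      \<open>m\<close>.\<close>
    have "eventually (\<lambda>m. coeff (smult (xi_coeff 0) (jensen_mult n (p m))) n > 0) sequentially"
      by (rule order_tendstoD(1)[OF lim]) (rule B_J_flat_coeff_pos, auto)
    then show "\<forall>\<^sub>F m in sequentially. hyp (smult (xi_coeff 0) (jensen_mult n (p m))) \<and>
        degree (smult (xi_coeff 0) (jensen_mult n (p m))) = degree (B_J_flat 1 n)"
    proof eventually_elim
      case (elim m)
      have "degree (smult (xi_coeff 0) (jensen_mult n (p m))) \<le> n" by (rule degree_le) (simp only: cJ, simp)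
      moreover have "n \<le> degree (smult (xi_coeff 0) (jensen_mult n (p m)))" by (rule le_degree) (use elim in \<open>metis less_irrefl\<close>)
      ultimately show ?case using hyp_smult[OF xi_coeff_pos J] degree_B_J_flat[of 1 n] by simp
    qed
  qed (auto simp: B_J_flat_nonzero)
qed

section \<open>Convergence of the Jensen polynomials\<close>

lemma falling_factorial_ratio:
  assumes "k \<le> n" "n > 0"
  shows "fact n / (fact (n - k) * real n ^ k) = (\<Prod>i<k. 1 - real i / real n)"
  using assms(1)
proof (induction k)
  case (Suc k)
  have "n - k = Suc (n - Suc k)" using Suc.prems by simp
  then have "(fact (n - k) :: real) = (real n - real k) * fact (n - Suc k)" using Suc.prems by (simp add: of_nat_diff)
  moreover have "real n - real k \<noteq> 0" using Suc.prems by simp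
  ultimately have "fact n / (fact (n - Suc k) * real n ^ Suc k) = fact n / (fact (n - k) * real n ^ k) * ((real n - real k) / real n)"
    by simp
  also have "(real n - real k) / real n = 1 - real k / real n" using assms(2) by (simp add: diff_divide_distrib)
  finally show ?case using Suc by simp
qed simp

text \<open>The coefficients are those of \<open>xi_fun\<close> times factors \<open>b k n\<close>
  in \<open>[0, 1]\<close> that tend to 1. With the majorant \<open>xi_coeff k * R^k\<close>,
  Tannery's theorem gives an error bound that is uniform on the disc of radius \<open>R\<close>. The
  index \<open>n + 2\<close> runs through the degrees allowed in the theorem.\<close>

lemma jensen_polynomials_converge:
  assumes "compact K"
  shows "uniform_limit K (\<lambda>n z. cpoly (B_J_flat 1 (Suc (Suc n))) (z / of_nat (Suc (Suc n)))) xi_fun sequentially"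
proof -
  obtain R where R: "R > 0" "\<And>z. z \<in> K \<Longrightarrow> norm z \<le> R"
    using compact_imp_bounded[OF assms] bounded_pos by metis
  define b where "b k n = (if k \<le> Suc (Suc n) then fact (Suc (Suc n)) / (fact (Suc (Suc n) - k) * real (Suc (Suc n)) ^ k) else 0 :: real)" for k n
  have b01: "0 \<le> b k n \<and> b k n \<le> 1" for k n
  proof (cases "k \<le> Suc (Suc n)")
    case True
    then have "b k n = (\<Prod>i<k. 1 - real i / real (Suc (Suc n)))"
      unfolding b_def using falling_factorial_ratio[of k "Suc (Suc n)"] by simp
    moreover have "0 \<le> 1 - real i / real (Suc (Suc n)) \<and> 1 - real i / real (Suc (Suc n)) \<le> 1" if "i < k" for i
      using that True by (simp add: divide_le_eq)
    ultimately show ?thesis by (auto intro!: prod_nonneg prod_le_1)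
  qed (simp add: b_def)
  have blim: "(\<lambda>n. b k n) \<longlonglongrightarrow> 1" for k
  proof -
    have l: "(\<lambda>n. 1 - real i / real (Suc (Suc n))) \<longlonglongrightarrow> 1" for i by real_asymp
    have "(\<lambda>n. \<Prod>i<k. 1 - real i / real (Suc (Suc n))) \<longlonglongrightarrow> (\<Prod>i<k. 1)" by (intro tendsto_prod l)
    moreover have "eventually (\<lambda>n. (\<Prod>i<k. 1 - real i / real (Suc (Suc n))) = b k n) sequentially"
      using eventually_ge_at_top[of k]
    proof eventually_elim
      case (elim n)
      then show ?case unfolding b_def using falling_factorial_ratio[of k "Suc (Suc n)"] by simp
    qed
    ultimately show ?thesis using Lim_transform_eventually by fastforce
  qed
  define e where "e n = (\<Sum>k. (1 - b k n) * (xi_coeff k * R ^ k))" for n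
  have sR: "summable (\<lambda>k. xi_coeff k * R ^ k)" using xi_real_sums sums_summable by blast
  have cR: "xi_coeff k * R ^ k \<ge> 0" for k using xi_coeff_pos[of k] R(1) by simp
  have bnd: "norm ((1 - b k n) * (xi_coeff k * R ^ k)) \<le> xi_coeff k * R ^ k" for k n
  proof -
    have "(1 - b k n) * (xi_coeff k * R ^ k) \<le> 1 * (xi_coeff k * R ^ k)"
      using b01[of k n] cR[of k] by (intro mult_right_mono) auto
    moreover have "(1 - b k n) * (xi_coeff k * R ^ k) \<ge> 0" using b01[of k n] cR[of k] by simp
    ultimately show ?thesis unfolding real_norm_def abs_of_nonneg by linarith
  qed
  have "e \<longlonglongrightarrow> (\<Sum>k. (1 - 1) * (xi_coeff k * R ^ k))"
    unfolding e_def
  proof (rule conjunct2[OF conjunct2[OF tannerys_theorem]])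
    show "(\<lambda>n. (1 - b k n) * (xi_coeff k * R ^ k)) \<longlonglongrightarrow> (1 - 1) * (xi_coeff k * R ^ k)" for k
      by (intro tendsto_intros blim)
    show "\<forall>\<^sub>F (k, n) in at_top \<times>\<^sub>F sequentially. norm ((1 - b k n) * (xi_coeff k * R ^ k)) \<le> xi_coeff k * R ^ k"
      using bnd by (intro always_eventually) auto
  qed (use sR in auto)
  then have e0: "e \<longlonglongrightarrow> 0" by simp
  have le: "norm (cpoly (B_J_flat 1 (Suc (Suc n))) (z / of_nat (Suc (Suc n))) - xi_fun z) \<le> e n" if "z \<in> K" for n z
  proof -
    let ?N = "Suc (Suc n)"
    have dN: "degree (B_J_flat 1 ?N) \<le> ?N" by (simp add: degree_B_J_flat)
    have "cpoly (B_J_flat 1 ?N) (z / of_nat ?N) = (\<Sum>k\<le>?N. of_real (b k n * xi_coeff k) * z ^ k)"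
      unfolding cpoly_eq_sum[OF dN]
    proof (rule sum.cong)
      fix k assume "k \<in> {..?N}"
      then have "of_real (coeff (B_J_flat 1 ?N) k) = complex_of_real (b k n * xi_coeff k) * of_nat ?N ^ k"
        unfolding b_def coeff_B_J_flat by (simp del: of_nat_Suc fact_Suc)
      moreover have "complex_of_nat ?N ^ k \<noteq> 0" by (simp del: of_nat_Suc)
      ultimately show "of_real (coeff (B_J_flat 1 ?N) k) * (z / of_nat ?N) ^ k = of_real (b k n * xi_coeff k) * z ^ k"
        unfolding power_divide by (simp del: of_nat_Suc)
    qed simp
    moreover have "(\<lambda>k. of_real (b k n * xi_coeff k) * z ^ k) sums (\<Sum>k\<le>?N. of_real (b k n * xi_coeff k) * z ^ k)"
      by (rule sums_finite) (auto simp: b_def)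
    ultimately have "(\<lambda>k. of_real (b k n * xi_coeff k) * z ^ k - of_real (xi_coeff k) * z ^ k) sums (cpoly (B_J_flat 1 ?N) (z / of_nat ?N) - xi_fun z)"
      using sums_diff[OF _ xi_fun_sums] by simp
    moreover have "(\<lambda>k. (1 - b k n) * (xi_coeff k * R ^ k)) sums e n"
      unfolding e_def by (rule summable_sums, rule summable_comparison_test'[OF sR]) (rule bnd)
    ultimately show ?thesis
    proof (rule norm_sums_le)
      fix k
      have "of_real (b k n * xi_coeff k) * z ^ k - of_real (xi_coeff k) * z ^ k = of_real ((b k n - 1) * xi_coeff k) * z ^ k"
        by (simp add: algebra_simps)
      then have "norm (of_real (b k n * xi_coeff k) * z ^ k - of_real (xi_coeff k) * z ^ k) = (1 - b k n) * (xi_coeff k * norm z ^ k)"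
        using b01[of k n] xi_coeff_pos[of k] by (simp only: norm_mult norm_of_real norm_power abs_mult) simp
      also have "\<dots> \<le> (1 - b k n) * (xi_coeff k * R ^ k)"
        using b01[of k n] xi_coeff_pos[of k] R(2)[OF that] by (intro mult_left_mono power_mono) auto
      finally show "norm (of_real (b k n * xi_coeff k) * z ^ k - of_real (xi_coeff k) * z ^ k) \<le> (1 - b k n) * (xi_coeff k * R ^ k)" .
    qed
  qed
  show ?thesis
  proof (rule uniform_limitI)
    fix \<epsilon> :: real assume "\<epsilon> > 0"
    then have "eventually (\<lambda>n. e n < \<epsilon>) sequentially" using e0 by (intro order_tendstoD(2))
    then show "\<forall>\<^sub>F n in sequentially. \<forall>z\<in>K. dist (cpoly (B_J_flat 1 (Suc (Suc n))) (z / of_nat (Suc (Suc n)))) (xi_fun z) < \<epsilon>"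
    proof eventually_elim
      case (elim n)
      then show ?case using le[of _ n] by (fastforce simp: dist_norm)
    qed
  qed
qed

text \<open>Hurwitz's theorem requires a nonconstant limit; here the linear coefficient is
  positive.\<close>

lemma xi_fun_not_constant: assumes "open S" "S \<noteq> {}" shows "\<not> xi_fun constant_on S"
proof
  assume "xi_fun constant_on S"
  then obtain c where c: "\<And>z. z \<in> S \<Longrightarrow> xi_fun z = c" unfolding constant_on_def by blast
  have "xi_fun z = c" for z
    by (rule analytic_continuation_open[where f = xi_fun and g = "\<lambda>_. c" and s = S and s' = UNIV])
       (use assms c xi_fun_holomorphic in auto)
  then have "xi_real 1 = xi_real 0" by (simp add: xi_real_def)
  moreover have "1 / 1 * (xi_real 1 - xi_coeff 0) \<ge> xi_coeff 1"
  proof -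
    have "(\<lambda>n. xi_coeff (Suc n) * 1 ^ Suc n) sums (xi_real 1 - xi_coeff 0)"
      using xi_real_sums[of 1] by (subst sums_Suc_iff) simp
    then have s: "summable (\<lambda>n. xi_coeff (Suc n) * 1 ^ Suc n)" "(\<Sum>n. xi_coeff (Suc n) * 1 ^ Suc n) = xi_real 1 - xi_coeff 0"
      by (auto simp: sums_iff)
    have "(\<Sum>n<1. xi_coeff (Suc n) * 1 ^ Suc n) \<le> (\<Sum>n. xi_coeff (Suc n) * 1 ^ Suc n)"
      by (rule sum_le_suminf[OF s(1)]) (use less_imp_le[OF xi_coeff_pos] in auto)
    then have "(\<Sum>n<1. xi_coeff (Suc n) * 1 ^ Suc n) \<le> xi_real 1 - xi_coeff 0" unfolding s(2) .
    then show ?thesis by simp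
  qed
  ultimately show False using xi_coeff_pos[of 1] by (simp add: xi_real_0)
qed

text \<open>Division by a positive integer preserves the upper half-plane, so the rescaled Jensen
  polynomials have no zeros there and neither has their limit. Conjugation covers the lower
  half-plane.\<close>

lemma riemann_hypothesis_of_hyp:
  assumes "\<And>n. n \<ge> 2 \<Longrightarrow> hyp (B_J_flat 1 n)" shows riemann_hypothesis
proof -
  have upper: "xi_fun z \<noteq> 0" if "Im z > 0" for z
  proof (rule Hurwitz_no_zeros[where g = xi_fun and ?z0.0 = z and S = "{z. Im z > 0}" and \<F> = "\<lambda>n z. cpoly (B_J_flat 1 (Suc (Suc n))) (z / of_nat (Suc (Suc n)))"])
    show "open {z. Im z > 0}" by (rule open_halfspace_Im_gt)
    show "connected {z. Im z > 0}" by (intro convex_connected convex_halfspace_Im_gt)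
    show "(\<lambda>z. cpoly (B_J_flat 1 (Suc (Suc n))) (z / of_nat (Suc (Suc n)))) holomorphic_on {z. Im z > 0}" for n
      unfolding cpoly_def by (intro holomorphic_intros) (simp del: of_nat_Suc)
    show "xi_fun holomorphic_on {z. Im z > 0}" by (rule xi_fun_holomorphic)
    show "uniform_limit K (\<lambda>n z. cpoly (B_J_flat 1 (Suc (Suc n))) (z / of_nat (Suc (Suc n)))) xi_fun sequentially"
      if "compact K" for K by (rule jensen_polynomials_converge[OF that])
    have "\<i> \<in> {z. Im z > 0}" by simp
    then show "\<not> xi_fun constant_on {z. Im z > 0}" by (intro xi_fun_not_constant open_halfspace_Im_gt) blast
    show "cpoly (B_J_flat 1 (Suc (Suc n))) (z / of_nat (Suc (Suc n))) \<noteq> 0" if "z \<in> {z. Im z > 0}" for n z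
    proof (rule hyp_upper)
      show "hyp (B_J_flat 1 (Suc (Suc n)))" by (rule assms) simp
      show "Im (z / of_nat (Suc (Suc n))) \<noteq> 0" using that by (simp add: Im_divide_of_nat del: of_nat_Suc)
    qed
    show "z \<in> {z. Im z > 0}" using that by simp
  qed
  show ?thesis unfolding riemann_hypothesis_iff
  proof (intro allI impI)
    fix w assume w: "Im w \<noteq> 0"
    show "xi_fun w \<noteq> 0"
    proof (cases "Im w > 0")
      case True then show ?thesis by (rule upper)
    next
      case False
      then have "xi_fun (cnj w) \<noteq> 0" using w by (intro upper) simp
      then show ?thesis by (simp add: xi.real_sym)
    qed
  qed
qed

theorem theorem5p1:
  shows "riemann_hypothesis \<longleftrightarrow> (\<forall>n\<ge>2. \<forall>y\<in>{1/4..<1}. Delta n y \<noteq> 0)"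
proof
  assume rh: riemann_hypothesis
  show "\<forall>n\<ge>2. \<forall>y\<in>{1/4..<1}. Delta n y \<noteq> 0"
  proof (intro allI impI ballI)
    fix n :: nat and y :: real assume "n \<ge> 2" "y \<in> {1/4..<1}"
    then show "Delta n y \<noteq> 0"
      by (intro Delta_nonzero_of_hyp hyp_B_J_flat_1_of_riemann_hypothesis[OF rh]) auto
  qed
next
  assume a: "\<forall>n\<ge>2. \<forall>y\<in>{1/4..<1}. Delta n y \<noteq> 0"
  show riemann_hypothesis
  proof (rule riemann_hypothesis_of_hyp)
    fix n :: nat assume "n \<ge> 2"
    then show "hyp (B_J_flat 1 n)" using a by (intro hyp_B_J_flat_1_of_Delta) auto
  qed
qed

end
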